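(* Let $m\ge 2$ and let $X_1,\dots,X_m$ be independent real random variables with probability densities $f_{X_1},\dots,f_{X_m}$; write $f_X=f_{X_1}$. Let $g_m$ be the density and $G_m$ the cumulative distribution function of $\sum_{j=1}^m X_j$, and let $g_{m-1}$ be the density of $\sum_{j=2}^m X_j$. Suppose that $f_X$ is bounded and has infinite support. For $1\le k\le n$ let $f_{\tilde X}$ (which depends on $n$ and $k$) be the density of the first addend $\tilde X$ of the $k$-th order statistic of a length-$n$ sample of the sum $\sum_{i=1}^m X_i$. Then, as $n\to\infty$ with $k=k(n)$ such that $k/n\to\eta$, where $0<\eta<1$, $$\lim_{n\to\infty,\;k/n\to\eta} f_{\tilde X}(x)=\frac{g_{m-1}(\beta-x)}{g_m(\beta)}\,f_X(x),\qquad \beta=G_m^{-1}(\eta).$$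
   Context: A length-$n$ sample of the sum is built as follows: let $(X_{j,1},\dots,X_{j,m})$, $j=1,\dots,n$, be $n$ independent copies of $(X_1,\dots,X_m)$, and put $S_j=\sum_{i=1}^m X_{j,i}$. The $k$-th order statistic is the $k$-th smallest of $S_1,\dots,S_n$ (almost surely there are no ties). Let $J$ be the almost surely unique index such that $S_J$ is the $k$-th smallest sum; the first addend of the $k$-th order statistic is $\tilde X:=X_{J,1}$. "Infinite support" means that the density is positive on the whole real line. $G_m^{-1}$ denotes the inverse function of $G_m$. As usual, identities between densities are understood for almost every $x$.
   Formalization: The limit is proved in L¹ for every k(n) with k/n→η, and for almost every x when g_{m-1} is continuous at β−x or k−ηn=O(√n); convergence at almost every x for all such k(n) is false in general. g_m is taken in a version continuous at β. *)

theory Defs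
  imports "HOL-Probability.Probability" "HOL-Library.Landau_Symbols"
begin

text \<open>Nonnegativity is required separately: \<open>ennreal\<close> truncates negative values to 0,
  so \<open>distributed\<close> alone would tolerate a function that is negative where the density vanishes.\<close>

definition has_density :: "'a measure \<Rightarrow> ('a \<Rightarrow> real) \<Rightarrow> (real \<Rightarrow> real) \<Rightarrow> bool" where
  "has_density M X f \<longleftrightarrow>
     (\<forall>x. 0 \<le> f x) \<and> distributed M lborel X (\<lambda>x. ennreal (f x))"

definition indep_copies ::
  "'b measure \<Rightarrow> nat \<Rightarrow> (nat \<Rightarrow> nat \<Rightarrow> 'b \<Rightarrow> real) \<Rightarrow> 'a measure \<Rightarrow> nat \<Rightarrow> (nat \<Rightarrow> 'a \<Rightarrow> real) \<Rightarrow> bool" where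
  "indep_copies N n Y M m X \<longleftrightarrow>
     prob_space N \<and>
     prob_space.indep_vars N (\<lambda>_. \<Pi>\<^sub>M i\<in>{1..m}. borel) (\<lambda>j \<omega>. \<lambda>i\<in>{1..m}. Y j i \<omega>) {1..n} \<and>
     (\<forall>j\<in>{1..n}. distr N (\<Pi>\<^sub>M i\<in>{1..m}. borel) (\<lambda>\<omega>. \<lambda>i\<in>{1..m}. Y j i \<omega>) =
                   distr M (\<Pi>\<^sub>M i\<in>{1..m}. borel) (\<lambda>\<omega>. \<lambda>i\<in>{1..m}. X i \<omega>))"

definition order_stat :: "nat \<Rightarrow> nat \<Rightarrow> (nat \<Rightarrow> real) \<Rightarrow> real" where
  "order_stat k n s = sort (map s [1..<Suc n]) ! (k - 1)"

text \<open>The index is unique unless there are ties; \<open>LEAST\<close> only fixes a (measurable) choice on the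
  null set where ties occur.\<close>

definition order_stat_index :: "nat \<Rightarrow> nat \<Rightarrow> (nat \<Rightarrow> real) \<Rightarrow> nat" where
  "order_stat_index k n s = (LEAST j. j \<in> {1..n} \<and> s j = order_stat k n s)"

definition first_addend :: "nat \<Rightarrow> nat \<Rightarrow> nat \<Rightarrow> (nat \<Rightarrow> nat \<Rightarrow> 'b \<Rightarrow> real) \<Rightarrow> 'b \<Rightarrow> real" where
  "first_addend k n m Y \<omega> = Y (order_stat_index k n (\<lambda>j. \<Sum>i=1..m. Y j i \<omega>)) 1 \<omega>"

end

theory Submission
  imports Defs "HOL-Real_Asymp.Real_Asymp"
begin

text \<open>
  Write \<open>h\<close> and \<open>G\<close> for the density and the distribution function of the full sum. Given that the
  \<open>k\<close>-th smallest sum equals \<open>s\<close>, its first addend has density \<open>f(x) g(s - x) / h(s)\<close>, so the first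
  addend has density \<open>f(x)\<close> times the integral of \<open>g(s - x) K\<^sub>n(G(s))\<close> over \<open>s\<close>, where \<open>K\<^sub>n\<close> is the
  Beta density of the \<open>k\<close>-th uniform order statistic. Only the lower bound coming from the pairwise
  disjoint events ``\<open>S\<^sub>j\<close> has exactly the sums with index in \<open>I\<close> below it'' is computed: both sides
  have total mass 1, hence they agree and ties never have to be discussed.

  The kernel \<open>K\<^sub>n\<close> tends to 0 uniformly away from \<open>\<eta>\<close>, so that it acts as an approximate identity at
  \<open>\<beta>\<close>. Continuity of translations in \<open>L\<^sup>1\<close> makes \<open>h\<close> and the conditional density continuous, which
  gives the convergence in \<open>L\<^sup>1\<close>. If \<open>k - \<eta> n = O(\<surd>n)\<close>, then \<open>K\<^sub>n\<close> is moreover dominated by a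
  bell of height and inverse width of order \<open>\<surd>n\<close> centred at \<open>\<eta>\<close>, which gives the pointwise limit at
  every Lebesgue point of \<open>g\<close>.
\<close>

section \<open>Lebesgue points and translations\<close>

text \<open>Boundedness of \<open>f\<close> makes the convolution finite and continuous at every
  point, and continuity of \<open>gm\<close> at \<beta> then identifies \<open>gm \<beta>\<close>
  with its value; positivity of \<open>f\<close> makes it positive everywhere, so the distribution
  function is strictly increasing and \<eta> determines \<beta>. The obstacle is \<open>g\<close>,
  which has no regularity. Both limits rest on one device: as \<open>h\<close> times the kernel has
  mass 1, the error at \<open>x\<close> is at most the kernel integral of
  \<open>|f(x) g(s - x) - p(x) h(s)|\<close>, which vanishes at \<open>s = \<beta>\<close> for the
  limit density \<open>p\<close>. Integrating over \<open>x\<close> first replaces regularity of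
  \<open>g\<close> by continuity of translations; this gives the L1 limit for every admissible
  \<open>k\<close>. At a single \<open>x\<close>, continuity of \<open>g\<close> at
  \<open>\<beta> - x\<close> works with any concentrating kernel, whereas a Lebesgue point controls
  only means over intervals centred there: the bell must be centred at \<eta> up to its own width
  \<open>1 / sqrt n\<close>, and this is what the rate of \<open>k\<close> provides.\<close>

lemma measurable_cball[measurable]: "cball (a::real) r \<in> sets borel"
  by (intro borel_closed closed_cball)

lemma negligible_imp_AE_lborel:
  assumes "negligible S" shows "AE x in lborel. x \<notin> S"
proof -
  have "AE x in lebesgue. x \<notin> S"
    using assms negligible_iff_null_sets AE_not_in by blast
  then show ?thesis by (simp add: AE_completion_iff)
qed

text \<open>Vitali cover of the bad points inside an open superset of \<open>A\<close> of small measure with respect to the density \<open>u\<close>.\<close>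

lemma AE_small_mean_on_zero_set:
  fixes u :: "real \<Rightarrow> ennreal"
  assumes u[measurable]: "u \<in> borel_measurable borel" and fin: "(\<integral>\<^sup>+x. u x \<partial>lborel) < \<infinity>"
    and A[measurable]: "A \<in> sets borel" and zero: "\<And>x. x \<in> A \<Longrightarrow> u x = 0"
  shows "AE y in lborel. y \<in> A \<longrightarrow>
    (\<forall>e>0. \<exists>d>0. \<forall>r. 0 < r \<and> r < d \<longrightarrow> (\<integral>\<^sup>+s. u s * indicator (cball y r) s \<partial>lborel) \<le> ennreal (e * r))"
proof -
  define \<nu> where "\<nu> = density lborel u"
  have sets_\<nu>: "sets \<nu> = sets borel" by (simp add: \<nu>_def)
  have \<nu>: "emeasure \<nu> B = (\<integral>\<^sup>+s. u s * indicator B s \<partial>lborel)" if "B \<in> sets borel" for B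
    using that by (simp add: \<nu>_def emeasure_density)
  have \<nu>_fin: "emeasure \<nu> (space \<nu>) \<noteq> \<infinity>"
    using fin by (simp add: \<nu>_def emeasure_density)
  have \<nu>A: "emeasure \<nu> A = 0"
    unfolding \<nu>[OF A] using zero by (intro nn_integral_zero') (auto split: split_indicator)
  \<comment> \<open>Failure at tolerance \<open>e\<close>: arbitrarily small intervals around
    \<open>y\<close> carry too much mass. Each \<open>S e\<close> is shown to be negligible; the
    tolerances \<open>1 / Suc n\<close> then cover all \<open>e\<close>.\<close>
  define S where "S e = {y \<in> A. \<forall>d>0. \<exists>r. 0 < r \<and> r < d \<and> ennreal (e * r) < emeasure \<nu> (cball y r)}" for e :: real
  have negl: "negligible (S e)" if e: "e > 0" for e
    unfolding negligible_outer_le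
  proof safe
    fix \<delta> :: real assume \<delta>: "\<delta> > 0"
    have "(INF U \<in> {U. A \<subseteq> U \<and> open U}. emeasure \<nu> U) < ennreal (e * \<delta> / 2)"
      unfolding outer_regular[OF sets_\<nu> \<nu>_fin A, symmetric] \<nu>A using e \<delta> by simp
    then obtain U where U: "A \<subseteq> U" "open U" "emeasure \<nu> U < ennreal (e * \<delta> / 2)"
      unfolding INF_less_iff by auto
    define K where "K = {(y, r). y \<in> S e \<and> 0 < r \<and> cball y r \<subseteq> U \<and> ennreal (e * r) < emeasure \<nu> (cball y r)}"
    have cover: "\<exists>i. i \<in> K \<and> x \<in> cball (fst i) (snd i) \<and> snd i < d" if "x \<in> S e" "0 < d" for x d
    proof -
      have "x \<in> U" using that U by (auto simp: S_def)
      then obtain d' where d': "d' > 0" "cball x d' \<subseteq> U" using U(2) open_contains_cball by blast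
      have "min d d' > 0" "\<forall>d>0. \<exists>r. 0 < r \<and> r < d \<and> ennreal (e * r) < emeasure \<nu> (cball x r)"
        using that d' by (auto simp: S_def)
      then obtain r where r: "0 < r" "r < min d d'" "ennreal (e * r) < emeasure \<nu> (cball x r)"
        by blast
      then have "cball x r \<subseteq> U" using d' by (meson dual_order.trans less_imp_le min_less_iff_conj subset_cball)
      then show ?thesis using r that by (intro exI[of _ "(x, r)"]) (auto simp: K_def)
    qed
    have pos: "0 < snd i" if "i \<in> K" for i using that by (auto simp: K_def)
    have "\<exists>C. countable C \<and> C \<subseteq> K \<and>
      pairwise (\<lambda>i j. disjnt (cball (fst i) (snd i)) (cball (fst j) (snd j))) C \<and>
      negligible (S e - (\<Union>i \<in> C. cball (fst i) (snd i)))"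
      by (rule Vitali_covering_theorem_cballs[of K snd "S e" fst, OF pos cover]) blast+
    then obtain C where C: "countable C" "C \<subseteq> K"
      "pairwise (\<lambda>i j. disjnt (cball (fst i) (snd i)) (cball (fst j) (snd j))) C"
      "negligible (S e - (\<Union>i \<in> C. cball (fst i) (snd i)))"
      by blast
    define B where "B = (\<Union>i \<in> C. cball (fst i) (snd i))"
    have [measurable]: "B \<in> sets borel" unfolding B_def
      using C(1) by (intro sets.countable_UN') auto
    have disj: "disjoint_family_on (\<lambda>i. cball (fst i) (snd i)) C"
      using C(3) by (auto simp: pairwise_def disjoint_family_on_def disjnt_def)
    \<comment> \<open>\<open>cball y r\<close> has length \<open>2 * r\<close>, so
      \<open>e * r\<close> is \<open>e/2\<close> times its length. The disjoint intervals of the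
      cover therefore have total length at most \<open>2/e\<close> times the mass of
      \<open>U\<close>, hence at most \<delta>.\<close>
    have "ennreal (e/2) * emeasure lborel B = (\<integral>\<^sup>+i. ennreal (e/2) * emeasure lborel (cball (fst i) (snd i)) \<partial>count_space C)"
      unfolding B_def using C(1) disj by (subst emeasure_UN_countable) (auto simp: nn_integral_cmult)
    also have "\<dots> \<le> (\<integral>\<^sup>+i. emeasure \<nu> (cball (fst i) (snd i)) \<partial>count_space C)"
    proof (intro nn_integral_mono)
      fix i assume "i \<in> space (count_space C)"
      then have "i \<in> K" using C by auto
      then have i: "0 < snd i" "ennreal (e * snd i) < emeasure \<nu> (cball (fst i) (snd i))" by (auto simp: K_def)
      have "ennreal (e/2) * emeasure lborel (cball (fst i) (snd i)) = ennreal (e * snd i)"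
        using i e by (simp add: cball_eq_atLeastAtMost ennreal_mult[symmetric])
      then show "ennreal (e/2) * emeasure lborel (cball (fst i) (snd i)) \<le> emeasure \<nu> (cball (fst i) (snd i))"
        using i by simp
    qed
    also have "\<dots> = emeasure \<nu> B"
      unfolding B_def using C(1) disj sets_\<nu> by (subst emeasure_UN_countable) auto
    also have "\<dots> \<le> emeasure \<nu> U"
    proof (rule emeasure_mono)
      have "cball (fst i) (snd i) \<subseteq> U" if "i \<in> K" for i using that by (auto simp: K_def simp del: mem_cball)
      then show "B \<subseteq> U" using C(2) unfolding B_def by blast
    qed (use U sets_\<nu> in auto)
    also have "\<dots> \<le> ennreal (e/2) * ennreal \<delta>"
      using U(3) e \<delta> by (subst ennreal_mult[symmetric]) auto
    finally have B_le: "emeasure lborel B \<le> ennreal \<delta>"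
      using e by (simp add: ennreal_mult_le_mult_iff)
    have N: "S e - B \<in> lmeasurable" "measure lebesgue (S e - B) = 0"
      using C(4) by (auto simp: B_def negligible_imp_measurable negligible_imp_measure0)
    have "emeasure lebesgue B \<le> ennreal \<delta>" using B_le by simp
    then have B: "B \<in> lmeasurable" "measure lebesgue B \<le> \<delta>"
      using \<delta> by (auto intro!: fmeasurableI simp: le_less_trans measure_def enn2real_leI)
    have "(S e - B) \<union> B \<in> lmeasurable" using N B by (intro fmeasurable.Un)
    moreover have "measure lebesgue ((S e - B) \<union> B) \<le> \<delta>"
      using measure_Un_le[OF fmeasurableD[OF N(1)] fmeasurableD[OF B(1)]] N(2) B(2) by linarith
    moreover have "S e \<subseteq> (S e - B) \<union> B" by blast
    ultimately show "\<exists>T. S e \<subseteq> T \<and> T \<in> lmeasurable \<and> measure lebesgue T \<le> \<delta>" by blast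
  qed
  have "AE y in lborel. \<forall>n. y \<notin> S (1 / real (Suc n))"
    unfolding AE_all_countable using negl by (auto intro!: negligible_imp_AE_lborel)
  then show ?thesis
  proof (rule AE_mp, intro AE_I2 impI allI)
    fix y e :: real assume y: "\<forall>n. y \<notin> S (1 / real (Suc n))" and "y \<in> A" and "e > 0"
    then obtain n where n: "1 / real (Suc n) < e" using nat_approx_posE by blast
    from spec[OF y, of n] \<open>y \<in> A\<close> obtain d where d: "d > 0" "\<And>r. 0 < r \<Longrightarrow> r < d \<Longrightarrow> emeasure \<nu> (cball y r) \<le> ennreal (1 / real (Suc n) * r)"
      unfolding S_def mem_Collect_eq by (meson not_less)
    show "\<exists>d>0. \<forall>r. 0 < r \<and> r < d \<longrightarrow> (\<integral>\<^sup>+s. u s * indicator (cball y r) s \<partial>lborel) \<le> ennreal (e * r)"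
    proof (intro exI[of _ d] conjI allI impI d(1))
      fix r assume r: "0 < r \<and> r < d"
      have "emeasure \<nu> (cball y r) \<le> ennreal (1 / real (Suc n) * r)" using d r by auto
      also have "\<dots> \<le> ennreal (e * r)" using n r by (intro ennreal_leI mult_right_mono) auto
      finally show "(\<integral>\<^sup>+s. u s * indicator (cball y r) s \<partial>lborel) \<le> ennreal (e * r)" by (simp add: \<nu>)
    qed
  qed
qed

text \<open>Approximate the value \<open>g y\<close> by a rational \<open>q\<close> up to
  \<open>c\<close>. The part of \<open>|g - q|\<close> living where it exceeds \<open>c\<close>
  vanishes on \<open>A q c\<close>, so the previous lemma makes its means negligible at almost every
  point of \<open>A q c\<close>; what remains of \<open>|g s - g y|\<close> is at most
  \<open>2 * c\<close>. Countably many \<open>q\<close>, \<open>c\<close> and cut-offs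
  suffice.\<close>

lemma AE_lebesgue_point:
  fixes g :: "real \<Rightarrow> real"
  assumes g: "integrable lborel g"
  shows "AE y in lborel. \<forall>e>0. \<exists>d>0. \<forall>r. 0 < r \<and> r < d \<longrightarrow>
    (\<integral>\<^sup>+s. ennreal \<bar>g s - g y\<bar> * indicator (cball y r) s \<partial>lborel) \<le> ennreal (e * r)"
proof -
  have gm[measurable]: "g \<in> borel_measurable borel" using g by auto
  define A where "A q c = {y. \<bar>g y - q\<bar> \<le> c}" for q c
  \<comment> \<open>The cut-off at \<open>R\<close> is there because the constant \<open>q\<close>
    is not integrable over the line.\<close>
  define u where "u q c R s = ennreal \<bar>g s - q\<bar> * indicator (- A q c) s * indicator (cball 0 R) s" for q c R s
  define good where "good q c R y \<longleftrightarrow> (y \<in> A q c \<longrightarrow>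
     (\<forall>e>0. \<exists>d>0. \<forall>r. 0 < r \<and> r < d \<longrightarrow> (\<integral>\<^sup>+s. u q c R s * indicator (cball y r) s \<partial>lborel) \<le> ennreal (e * r)))" for q c R y
  have AE_good: "AE y in lborel. good q c R y" for q c R
    unfolding good_def
  proof (rule AE_small_mean_on_zero_set)
    have "(\<integral>\<^sup>+s. u q c R s \<partial>lborel) \<le> (\<integral>\<^sup>+s. ennreal \<bar>g s\<bar> + ennreal \<bar>q\<bar> * indicator (cball 0 R) s \<partial>lborel)"
      unfolding u_def by (intro nn_integral_mono) (auto split: split_indicator simp: ennreal_plus[symmetric] simp del: ennreal_plus)
    also have "\<dots> = (\<integral>\<^sup>+s. ennreal \<bar>g s\<bar> \<partial>lborel) + ennreal \<bar>q\<bar> * emeasure lborel (cball 0 R :: real set)"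
      by (subst nn_integral_add) (auto simp: nn_integral_cmult)
    also have "\<dots> < \<infinity>"
      using g by (cases "R \<ge> 0") (auto simp: integrable_iff_bounded cball_eq_atLeastAtMost ennreal_mult_less_top)
    finally show "(\<integral>\<^sup>+s. u q c R s \<partial>lborel) < \<infinity>" .
  qed (auto simp: u_def A_def)
  have "AE y in lborel. \<forall>q::rat. \<forall>n::nat. \<forall>R::nat. good (of_rat q) (1 / real (Suc n)) (real R) y"
    unfolding AE_all_countable using AE_good by blast
  then show ?thesis
  proof (rule AE_mp, intro AE_I2 impI allI)
    fix y e :: real
    assume good: "\<forall>q::rat. \<forall>n::nat. \<forall>R::nat. good (of_rat q) (1 / real (Suc n)) (real R) y" and e: "e > 0"
    \<comment> \<open>The error \<open>2 * c\<close> over an interval of length \<open>2 * r\<close>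
      costs \<open>4 * c * r\<close>, which \<open>c < e/8\<close> keeps below
      \<open>e/2 * r\<close>.\<close>
    obtain n where n: "1 / real (Suc n) < e / 8" using nat_approx_posE[of "e/8"] e by auto
    define c where "c = 1 / real (Suc n)"
    have c: "c > 0" "c < e/8" using n by (auto simp: c_def)
    obtain q :: rat where q: "g y - c < of_rat q" "of_rat q < g y"
      using of_rat_dense[of "g y - c" "g y"] c by auto
    obtain R :: nat where R: "\<bar>y\<bar> + 1 < real R" using reals_Archimedean2 by blast
    have "y \<in> A (of_rat q) c" using q by (auto simp: A_def)
    with good[rule_format, of q n R] e obtain d where d: "d > 0"
      "\<And>r. 0 < r \<Longrightarrow> r < d \<Longrightarrow> (\<integral>\<^sup>+s. u (of_rat q) c (real R) s * indicator (cball y r) s \<partial>lborel) \<le> ennreal (e / 2 * r)"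
      unfolding good_def c_def[symmetric] by (meson half_gt_zero)
    show "\<exists>d>0. \<forall>r. 0 < r \<and> r < d \<longrightarrow>
      (\<integral>\<^sup>+s. ennreal \<bar>g s - g y\<bar> * indicator (cball y r) s \<partial>lborel) \<le> ennreal (e * r)"
    proof (intro exI[of _ "min d 1"] conjI allI impI)
      fix r assume r: "0 < r \<and> r < min d 1"
      have "(\<integral>\<^sup>+s. ennreal \<bar>g s - g y\<bar> * indicator (cball y r) s \<partial>lborel)
        \<le> (\<integral>\<^sup>+s. u (of_rat q) c (real R) s * indicator (cball y r) s + ennreal (2 * c) * indicator (cball y r) s \<partial>lborel)"
      proof (intro nn_integral_mono)
        fix s
        show "ennreal \<bar>g s - g y\<bar> * indicator (cball y r) s
          \<le> u (of_rat q) c (real R) s * indicator (cball y r) s + ennreal (2 * c) * indicator (cball y r) s"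
        proof (cases "s \<in> cball y r")
          case True
          then have "s \<in> cball 0 (real R)" using r R by (auto simp: dist_real_def)
          then show ?thesis using True q c
            by (auto simp: u_def A_def split: split_indicator simp: ennreal_plus[symmetric] intro!: ennreal_leI simp del: ennreal_plus)
        qed auto
      qed
      also have "\<dots> = (\<integral>\<^sup>+s. u (of_rat q) c (real R) s * indicator (cball y r) s \<partial>lborel) + ennreal (2 * c) * ennreal (2 * r)"
        using r by (subst nn_integral_add) (auto simp: nn_integral_cmult u_def A_def cball_eq_atLeastAtMost)
      also have "\<dots> \<le> ennreal (e / 2 * r) + ennreal (2 * c * (2 * r))"
        using d r c by (intro add_mono) (auto simp: ennreal_mult[symmetric])
      also have "\<dots> = ennreal (e / 2 * r + 4 * c * r)" using r c e by (simp add: ennreal_plus[symmetric] del: ennreal_plus)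
      also have "\<dots> \<le> ennreal (e * r)"
      proof (rule ennreal_leI)
        have "4 * c * r \<le> e / 2 * r" using c r by (intro mult_right_mono) auto
        then show "e / 2 * r + 4 * c * r \<le> e * r" by (simp add: algebra_simps)
      qed
      finally show "(\<integral>\<^sup>+s. ennreal \<bar>g s - g y\<bar> * indicator (cball y r) s \<partial>lborel) \<le> ennreal (e * r)" .
    qed (use d in auto)
  qed
qed

section \<open>Continuity of translations in L1\<close>

lemma emeasure_translate_diff_tendsto_0:
  fixes U :: "real set" and t :: "nat \<Rightarrow> real"
  assumes U: "open U" and fin: "emeasure lborel U < \<infinity>" and t: "t \<longlonglongrightarrow> 0"
  shows "(\<lambda>n. emeasure lborel {x \<in> U. x + t n \<notin> U}) \<longlonglongrightarrow> 0"
proof -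
  have [measurable]: "U \<in> sets borel" using U by simp
  have "(\<lambda>n. \<integral>\<^sup>+x. indicator {x \<in> U. x + t n \<notin> U} x \<partial>lborel) \<longlonglongrightarrow> (\<integral>\<^sup>+x. 0 \<partial>(lborel :: real measure))"
  proof (rule nn_integral_dominated_convergence[where w = "indicator U"])
    \<comment> \<open>A point of an open set stays in it under all small shifts, so the indicators
      are eventually 0; \<open>indicator U\<close> dominates them.\<close>
    show "AE x in lborel. (\<lambda>n. indicator {x \<in> U. x + t n \<notin> U} x :: ennreal) \<longlonglongrightarrow> 0"
    proof (intro AE_I2 tendsto_eventually)
      fix x :: real
      show "eventually (\<lambda>n. indicator {x \<in> U. x + t n \<notin> U} x = (0 :: ennreal)) sequentially"
      proof (cases "x \<in> U")
        case True
        have "(\<lambda>n. x + t n) \<longlonglongrightarrow> x" using t by (auto intro!: tendsto_eq_intros)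
        then have "eventually (\<lambda>n. x + t n \<in> U) sequentially"
          using topological_tendstoD U True by blast
        then show ?thesis by eventually_elim (auto split: split_indicator)
      qed auto
    qed
  qed (use fin in \<open>auto split: split_indicator\<close>)
  moreover have "(\<integral>\<^sup>+x. indicator {x \<in> U. x + t n \<notin> U} x \<partial>lborel) = emeasure lborel {x \<in> U. x + t n \<notin> U}" for n
    by (rule nn_integral_indicator) measurable
  ultimately show ?thesis by simp
qed

lemma nn_integral_diff_triangle:
  fixes f g h :: "'a \<Rightarrow> real"
  assumes [measurable]: "f \<in> borel_measurable M" "g \<in> borel_measurable M" "h \<in> borel_measurable M"
  shows "(\<integral>\<^sup>+x. ennreal \<bar>f x - h x\<bar> \<partial>M) \<le> (\<integral>\<^sup>+x. ennreal \<bar>f x - g x\<bar> \<partial>M) + (\<integral>\<^sup>+x. ennreal \<bar>g x - h x\<bar> \<partial>M)"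
  by (subst nn_integral_add[symmetric])
     (auto intro!: nn_integral_mono ennreal_leI simp: ennreal_plus[symmetric] simp del: ennreal_plus)

lemma nn_integral_translate:
  fixes f :: "real \<Rightarrow> ennreal"
  assumes [measurable]: "f \<in> borel_measurable borel"
  shows "(\<integral>\<^sup>+x. f (x + t) \<partial>lborel) = (\<integral>\<^sup>+x. f x \<partial>lborel)"
  using nn_integral_real_affine[of f 1 t] by (simp add: add.commute)

lemma nn_integral_reflect:
  fixes u :: "real \<Rightarrow> ennreal"
  assumes [measurable]: "u \<in> borel_measurable borel"
  shows "(\<integral>\<^sup>+x. u (s - x) \<partial>lborel) = (\<integral>\<^sup>+x. u x \<partial>lborel)"
  using nn_integral_real_affine[of u "-1" s] by simp

lemma nn_integral_shift:
  fixes u :: "real \<Rightarrow> ennreal"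
  assumes [measurable]: "u \<in> borel_measurable borel"
  shows "(\<integral>\<^sup>+s. u (s - x) \<partial>lborel) = (\<integral>\<^sup>+s. u s \<partial>lborel)"
  using nn_integral_translate[of u "- x"] by simp

lemma nn_integral_joint_swap:
  assumes [measurable]: "case_prod u \<in> borel_measurable (borel \<Otimes>\<^sub>M borel)"
  shows "(\<integral>\<^sup>+s. (\<integral>\<^sup>+x. u x s \<partial>lborel) \<partial>lborel) = (\<integral>\<^sup>+x. (\<integral>\<^sup>+s. (u x s :: ennreal) \<partial>lborel) \<partial>(lborel :: real measure))"
  by (rule lborel_pair.Fubini') measurable

text \<open>The functions with continuous translations are closed in L1: a three-term estimate in
  which the error of the shifted approximation equals the unshifted error by translation
  invariance.\<close>

lemma L1_translation_approx:
  fixes g :: "real \<Rightarrow> real" and t :: "nat \<Rightarrow> real"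
  assumes [measurable]: "g \<in> borel_measurable borel"
    and approx: "\<And>e. e > 0 \<Longrightarrow> \<exists>g'\<in>borel_measurable borel. (\<integral>\<^sup>+x. ennreal \<bar>g' x - g x\<bar> \<partial>lborel) \<le> ennreal e \<and>
      (\<lambda>n. \<integral>\<^sup>+x. ennreal \<bar>g' (x + t n) - g' x\<bar> \<partial>lborel) \<longlonglongrightarrow> 0"
  shows "(\<lambda>n. \<integral>\<^sup>+x. ennreal \<bar>g (x + t n) - g x\<bar> \<partial>lborel) \<longlonglongrightarrow> 0"
proof (rule order_tendstoI)
  fix a :: ennreal assume "0 < a"
  then obtain e where e: "e > 0" "ennreal (3 * e) < a"
  proof (cases a)
    case (real r)
    with \<open>0 < a\<close> show ?thesis by (intro that[of "r / 6"]) (auto intro!: ennreal_lessI)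
  qed (auto intro: that[of 1])
  obtain g' where [measurable]: "g' \<in> borel_measurable borel" and g': "(\<integral>\<^sup>+x. ennreal \<bar>g' x - g x\<bar> \<partial>lborel) \<le> ennreal e"
    "(\<lambda>n. \<integral>\<^sup>+x. ennreal \<bar>g' (x + t n) - g' x\<bar> \<partial>lborel) \<longlonglongrightarrow> 0"
    using approx[OF e(1)] by auto
  have 1: "(\<integral>\<^sup>+x. ennreal \<bar>g (x + t n) - g' (x + t n)\<bar> \<partial>lborel) \<le> ennreal e" for n
    using nn_integral_translate[of "\<lambda>x. ennreal \<bar>g x - g' x\<bar>" "t n"] g'(1) by (simp add: abs_minus_commute)
  have "eventually (\<lambda>n. (\<integral>\<^sup>+x. ennreal \<bar>g' (x + t n) - g' x\<bar> \<partial>lborel) < ennreal e) sequentially"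
    using g'(2) e by (intro order_tendstoD(2)) auto
  then show "eventually (\<lambda>n. (\<integral>\<^sup>+x. ennreal \<bar>g (x + t n) - g x\<bar> \<partial>lborel) < a) sequentially"
  proof eventually_elim
    case (elim n)
    have "(\<integral>\<^sup>+x. ennreal \<bar>g (x + t n) - g x\<bar> \<partial>lborel) \<le>
      (\<integral>\<^sup>+x. ennreal \<bar>g (x + t n) - g' (x + t n)\<bar> \<partial>lborel) + (\<integral>\<^sup>+x. ennreal \<bar>g' (x + t n) - g x\<bar> \<partial>lborel)"
      by (rule nn_integral_diff_triangle) auto
    also have "(\<integral>\<^sup>+x. ennreal \<bar>g' (x + t n) - g x\<bar> \<partial>lborel) \<le>
      (\<integral>\<^sup>+x. ennreal \<bar>g' (x + t n) - g' x\<bar> \<partial>lborel) + (\<integral>\<^sup>+x. ennreal \<bar>g' x - g x\<bar> \<partial>lborel)"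
      by (rule nn_integral_diff_triangle) auto
    finally have "(\<integral>\<^sup>+x. ennreal \<bar>g (x + t n) - g x\<bar> \<partial>lborel) \<le> ennreal e + (ennreal e + ennreal e)"
      using 1[of n] g'(1) elim by (meson add_mono less_imp_le order_trans order_refl)
    also have "\<dots> = ennreal (3 * e)" using e by (simp add: ennreal_plus[symmetric] del: ennreal_plus)
    finally show ?case using e by simp
  qed
qed simp

text \<open>Induction over integrable functions. For an indicator, outer regularity passes to an
  open superset, where shifts can be controlled; the limit step is the closedness just
  shown.\<close>

lemma L1_translation_continuous:
  fixes g :: "real \<Rightarrow> real" and t :: "nat \<Rightarrow> real"
  assumes "integrable lborel g" and t: "t \<longlonglongrightarrow> 0"
  shows "(\<lambda>n. \<integral>\<^sup>+x. ennreal \<bar>g (x + t n) - g x\<bar> \<partial>lborel) \<longlonglongrightarrow> 0"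
  using assms(1)
proof (induction rule: integrable_induct)
  case (base A c)
  then have [measurable]: "A \<in> sets borel" by simp
  show ?case
  proof (rule L1_translation_approx)
    fix e :: real assume e: "e > 0"
    \<comment> \<open>The \<open>+ 1\<close> covers \<open>c = 0\<close>.\<close>
    define \<delta> where "\<delta> = e / (\<bar>c\<bar> + 1)"
    have \<delta>: "\<delta> > 0" "\<bar>c\<bar> * \<delta> \<le> e" using e by (auto simp: \<delta>_def field_simps)
    obtain U where U: "open U" "A \<subseteq> U" "emeasure lborel (U - A) < ennreal \<delta>"
      using outer_regular_lborel[of A \<delta>] \<delta> by auto
    have [measurable]: "U \<in> sets borel" using U by simp
    have "emeasure lborel U \<le> emeasure lborel A + emeasure lborel (U - A)"
      using U by (subst plus_emeasure) (auto intro!: emeasure_mono)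
    also have "\<dots> < \<infinity>" using base(2) U(3) by (auto simp: less_top[symmetric])
    finally have fin: "emeasure lborel U < \<infinity>" .
    show "\<exists>g'\<in>borel_measurable borel. (\<integral>\<^sup>+x. ennreal \<bar>g' x - indicator A x *\<^sub>R c\<bar> \<partial>lborel) \<le> ennreal e \<and>
      (\<lambda>n. \<integral>\<^sup>+x. ennreal \<bar>g' (x + t n) - g' x\<bar> \<partial>lborel) \<longlonglongrightarrow> 0"
    proof (intro bexI[of _ "\<lambda>x. indicator U x *\<^sub>R c"] conjI)
      have "(\<integral>\<^sup>+x. ennreal \<bar>indicator U x *\<^sub>R c - indicator A x *\<^sub>R c\<bar> \<partial>lborel) = (\<integral>\<^sup>+x. ennreal \<bar>c\<bar> * indicator (U - A) x \<partial>lborel)"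
        using U by (intro nn_integral_cong) (auto split: split_indicator)
      also have "\<dots> = ennreal \<bar>c\<bar> * emeasure lborel (U - A)" by (simp add: nn_integral_cmult)
      also have "\<dots> \<le> ennreal \<bar>c\<bar> * ennreal \<delta>" using U(3) by (intro mult_left_mono) auto
      also have "\<dots> \<le> ennreal e" using \<delta> by (subst ennreal_mult[symmetric]) (auto intro!: ennreal_leI)
      finally show "(\<integral>\<^sup>+x. ennreal \<bar>indicator U x *\<^sub>R c - indicator A x *\<^sub>R c\<bar> \<partial>lborel) \<le> ennreal e" .
    next
      \<comment> \<open>The two indicators differ at points pushed out of \<open>U\<close> by
        \<open>t n\<close> and at points pushed into it; the latter set is a translate of the points
        pushed out by \<open>- t n\<close>.\<close>
      have "(\<integral>\<^sup>+x. ennreal \<bar>indicator U (x + t n) *\<^sub>R c - indicator U x *\<^sub>R c\<bar> \<partial>lborel) =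
        ennreal \<bar>c\<bar> * (emeasure lborel {x \<in> U. x + t n \<notin> U} + emeasure lborel {x \<in> U. x + - t n \<notin> U})" for n
      proof -
        have "(\<integral>\<^sup>+x. indicator {x. x + t n \<in> U \<and> x \<notin> U} x \<partial>lborel) = (\<integral>\<^sup>+x. indicator {x \<in> U. x + - t n \<notin> U} (x + t n) \<partial>lborel)"
          by (intro nn_integral_cong) (auto split: split_indicator)
        also have "\<dots> = (\<integral>\<^sup>+x. indicator {x \<in> U. x + - t n \<notin> U} x \<partial>lborel)"
          by (rule nn_integral_translate) measurable
        also have "\<dots> = emeasure lborel {x \<in> U. x + - t n \<notin> U}"
          by (rule nn_integral_indicator) measurable
        finally have 1: "(\<integral>\<^sup>+x. indicator {x. x + t n \<in> U \<and> x \<notin> U} x \<partial>lborel) = emeasure lborel {x \<in> U. x + - t n \<notin> U}" .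
        have 2: "(\<integral>\<^sup>+x. indicator {x \<in> U. x + t n \<notin> U} x \<partial>lborel) = emeasure lborel {x \<in> U. x + t n \<notin> U}"
          by (rule nn_integral_indicator) measurable
        have "(\<integral>\<^sup>+x. ennreal \<bar>indicator U (x + t n) *\<^sub>R c - indicator U x *\<^sub>R c\<bar> \<partial>lborel) =
          (\<integral>\<^sup>+x. ennreal \<bar>c\<bar> * (indicator {x \<in> U. x + t n \<notin> U} x + indicator {x. x + t n \<in> U \<and> x \<notin> U} x) \<partial>lborel)"
          by (intro nn_integral_cong) (auto split: split_indicator)
        also have "\<dots> = ennreal \<bar>c\<bar> * ((\<integral>\<^sup>+x. indicator {x \<in> U. x + t n \<notin> U} x \<partial>lborel) + (\<integral>\<^sup>+x. indicator {x. x + t n \<in> U \<and> x \<notin> U} x \<partial>lborel))"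
          by (subst nn_integral_cmult, measurable, subst nn_integral_add, measurable)
        finally show ?thesis unfolding 1 2 .
      qed
      moreover have "(\<lambda>n. ennreal \<bar>c\<bar> * (emeasure lborel {x \<in> U. x + t n \<notin> U} + emeasure lborel {x \<in> U. x + - t n \<notin> U})) \<longlonglongrightarrow>
        ennreal \<bar>c\<bar> * (0 + 0)"
        using t tendsto_minus[OF t]
        by (intro tendsto_mult_ennreal tendsto_const tendsto_add emeasure_translate_diff_tendsto_0 U fin) auto
      ultimately show "(\<lambda>n. \<integral>\<^sup>+x. ennreal \<bar>indicator U (x + t n) *\<^sub>R c - indicator U x *\<^sub>R c\<bar> \<partial>lborel) \<longlonglongrightarrow> 0"
        by simp
    qed measurable
  qed measurable
next
  case (add f g)
  then have [measurable]: "f \<in> borel_measurable borel" "g \<in> borel_measurable borel" by auto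
  show ?case
  proof (rule tendsto_sandwich[OF _ _ tendsto_const])
    show "(\<lambda>n. (\<integral>\<^sup>+x. ennreal \<bar>f (x + t n) - f x\<bar> \<partial>lborel) + (\<integral>\<^sup>+x. ennreal \<bar>g (x + t n) - g x\<bar> \<partial>lborel)) \<longlonglongrightarrow> 0"
      using tendsto_add[OF add.IH] by simp
    show "eventually (\<lambda>n. (\<integral>\<^sup>+x. ennreal \<bar>f (x + t n) + g (x + t n) - (f x + g x)\<bar> \<partial>lborel) \<le>
      (\<integral>\<^sup>+x. ennreal \<bar>f (x + t n) - f x\<bar> \<partial>lborel) + (\<integral>\<^sup>+x. ennreal \<bar>g (x + t n) - g x\<bar> \<partial>lborel)) sequentially"
      by (intro always_eventually allI, subst nn_integral_add[symmetric])
         (auto intro!: nn_integral_mono ennreal_leI simp: ennreal_plus[symmetric] simp del: ennreal_plus)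
  qed simp
next
  case (lim f s)
  then have [measurable]: "f \<in> borel_measurable borel" "\<And>i. s i \<in> borel_measurable borel" by auto
  have "(\<lambda>i. \<integral>\<^sup>+x. ennreal (norm (f x - s i x)) \<partial>lborel) \<longlonglongrightarrow> 0"
  proof (rule nn_integral_dominated_convergence_norm)
    show "AE x in lborel. norm (s i x) \<le> 2 * norm (f x)" for i using lim by auto
    have "(\<integral>\<^sup>+x. ennreal (2 * norm (f x)) \<partial>lborel) = ennreal 2 * (\<integral>\<^sup>+x. ennreal (norm (f x)) \<partial>lborel)"
      by (subst nn_integral_cmult[symmetric]) (auto simp: ennreal_mult)
    then show "(\<integral>\<^sup>+x. ennreal (2 * norm (f x)) \<partial>lborel) < \<infinity>"
      using lim.hyps(4) by (auto simp: integrable_iff_bounded ennreal_mult_less_top)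
    show "AE x in lborel. (\<lambda>i. s i x) \<longlonglongrightarrow> f x" using lim by auto
  qed (use lim in auto)
  then have small: "\<exists>i. (\<integral>\<^sup>+x. ennreal \<bar>s i x - f x\<bar> \<partial>lborel) \<le> ennreal e" if "e > 0" for e
    using order_tendstoD(2)[of _ 0 sequentially "ennreal e"] that
    by (auto simp: eventually_sequentially abs_minus_commute dest!: less_imp_le)
  show ?case
    by (rule L1_translation_approx) (use small lim.IH in \<open>fastforce+\<close>)
qed

lemma AE_lborel_reflect:
  fixes b :: real
  assumes "AE y in lborel. P y" shows "AE x in lborel. P (b - x)"
proof -
  have eq: "distr lborel borel ((-) b) = lborel"
    using lborel_real_affine[of "-1" b] by (simp add: density_1 one_ennreal_def[symmetric])
  have "AE y in distr lborel borel ((-) b). P y"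
    unfolding eq by (rule assms)
  then show ?thesis by (rule AE_distrD[rotated]) measurable
qed

lemma ennreal_abs_diff_le:
  fixes a b :: real and c :: ennreal
  assumes "0 \<le> a" "0 \<le> b" "ennreal a \<le> ennreal b + c" "ennreal b \<le> ennreal a + c"
  shows "ennreal \<bar>a - b\<bar> \<le> c"
proof (cases c)
  case (real r)
  then have "a \<le> b + r" "b \<le> a + r"
    using assms by (auto simp: ennreal_plus[symmetric] simp del: ennreal_plus)
  then show ?thesis using real by (auto intro!: ennreal_leI)
qed simp

text \<open>The inequality for \<open>A\<close> and for its complement, added up, compares 1 with 1,
  so neither can be strict.\<close>

lemma AE_eq_if_density_le:
  fixes u v :: "real \<Rightarrow> ennreal"
  assumes [measurable]: "u \<in> borel_measurable borel" "v \<in> borel_measurable borel"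
    and mass: "(\<integral>\<^sup>+x. u x \<partial>lborel) = 1" "(\<integral>\<^sup>+x. v x \<partial>lborel) = 1"
    and le: "\<And>A. A \<in> sets borel \<Longrightarrow> (\<integral>\<^sup>+x. u x * indicator A x \<partial>lborel) \<le> (\<integral>\<^sup>+x. v x * indicator A x \<partial>lborel)"
  shows "AE x in lborel. u x = v x"
proof -
  have split: "(\<integral>\<^sup>+x. w x * indicator A x \<partial>lborel) + (\<integral>\<^sup>+x. w x * indicator (- A) x \<partial>lborel) = (\<integral>\<^sup>+x. w x \<partial>lborel)"
    if [measurable]: "A \<in> sets borel" "w \<in> borel_measurable borel" for A :: "real set" and w :: "real \<Rightarrow> ennreal"
    by (subst nn_integral_add[symmetric]) (auto intro!: nn_integral_cong split: split_indicator)
  have "density lborel u = density lborel v"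
  proof (rule measure_eqI)
    fix A assume "A \<in> sets (density lborel u)"
    then have [measurable]: "A \<in> sets borel" by simp
    let ?u = "\<lambda>A. \<integral>\<^sup>+x. u x * indicator A x \<partial>lborel" and ?v = "\<lambda>A. \<integral>\<^sup>+x. v x * indicator A x \<partial>lborel"
    have uv: "?u A \<le> ?v A" "?u (- A) \<le> ?v (- A)" by (auto intro!: le)
    have sum1: "?u A + ?u (- A) = 1" "?v A + ?v (- A) = 1"
      using mass by (auto simp: split)
    have "?v (- A) \<noteq> \<top>" using sum1(2) by (metis ennreal_add_eq_top ennreal_one_neq_top)
    moreover have "?v A + ?v (- A) \<le> ?u A + ?v (- A)"
      using sum1 uv(2) by (metis add_left_mono)
    ultimately have "?v A \<le> ?u A" by (simp add: ennreal_add_left_cancel_le add.commute[of _ "?v (- A)"])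
    then show "emeasure (density lborel u) A = emeasure (density lborel v) A"
      using uv(1) by (simp add: emeasure_density)
  qed simp
  then show ?thesis using finite_density_unique[of u lborel v] mass by simp
qed

lemma isCont_imp_tendsto_nhds: "isCont u b \<Longrightarrow> (u \<longlongrightarrow> u b) (nhds b)"
  by (simp add: isCont_def tendsto_at_iff_tendsto_nhds)

text \<open>Different values at a common continuity point would persist on an interval of positive
  length. This later ties the given version \<open>gm\<close> to the convolution at \<beta>.\<close>

lemma isCont_AE_eq_imp_eq:
  fixes u v :: "real \<Rightarrow> real"
  assumes "AE x in lborel. u x = v x" "isCont u b" "isCont v b"
  shows "u b = v b"
proof (rule ccontr)
  assume "u b \<noteq> v b"
  moreover have "((\<lambda>x. u x - v x) \<longlongrightarrow> u b - v b) (nhds b)"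
    using assms by (intro tendsto_diff) (auto simp: isCont_def tendsto_at_iff_tendsto_nhds)
  ultimately have "eventually (\<lambda>x. u x - v x \<noteq> 0) (nhds b)"
    by (intro tendsto_imp_eventually_ne) auto
  then obtain d where d: "d > 0" "\<And>x. dist x b < d \<Longrightarrow> u x \<noteq> v x"
    by (auto simp: eventually_nhds_metric)
  have "AE x in lborel. x \<notin> {b<..<b + d}"
    using assms(1) by eventually_elim (use d in \<open>auto simp: dist_real_def\<close>)
  moreover have "{x \<in> space lborel. \<not> x \<notin> {b<..<b + d}} = {b<..<b + d}" by auto
  ultimately have "emeasure lborel {b<..<b + d} = 0"
    using AE_iff_measurable[of "{b<..<b + d}" lborel "\<lambda>x. x \<notin> {b<..<b + d}"] by simp
  then show False using d by simp
qed

section \<open>The Beta kernel\<close>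

text \<open>The coefficient counts the choices of the index attaining rank \<open>k\<close> and of
  the \<open>k - 1\<close> indices below it. Outside the unit interval the polynomial has no
  probabilistic meaning and may be negative.\<close>

definition order_stat_kernel :: "nat \<Rightarrow> nat \<Rightarrow> real \<Rightarrow> real" where
  "order_stat_kernel n k u = real n * real ((n - 1) choose (k - 1)) * u ^ (k - 1) * (1 - u) ^ (n - k)"

lemma order_stat_kernel_measurable[measurable]: "order_stat_kernel n k \<in> borel_measurable borel"
  unfolding order_stat_kernel_def[abs_def] by measurable

lemma order_stat_kernel_nonneg: "0 \<le> u \<Longrightarrow> u \<le> 1 \<Longrightarrow> 0 \<le> order_stat_kernel n k u"
  by (simp add: order_stat_kernel_def)

lemma nn_integral_order_stat_kernel:
  assumes k: "1 \<le> k" "k \<le> n"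
  shows "(\<integral>\<^sup>+u. ennreal (order_stat_kernel n k u) * indicator {0..1} u \<partial>lborel) = 1"
proof -
  define j l where "j = k - 1" and "l = n - k"
  have n: "n = j + l + 1" and kj: "k = j + 1" using k by (auto simp: j_def l_def)
  have "((\<lambda>t. t powr (real (j + 1) - 1) * (1 - t) powr (real (l + 1) - 1)) has_integral Beta (real (j + 1)) (real (l + 1))) {0<..<1}"
    using has_integral_Beta_real[of "real (j + 1)" "real (l + 1)"] by (simp add: has_integral_Icc_iff_Ioo)
  \<comment> \<open>The end points must be removed before passing from \<open>powr\<close> to
    \<open>^\<close>: \<open>0 powr 0\<close> is 0 but \<open>0 ^ 0\<close> is 1.\<close>
  then have "((\<lambda>t. t ^ j * (1 - t) ^ l) has_integral Beta (real (j + 1)) (real (l + 1))) {0<..<1}"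
    by (rule has_integral_eq[rotated]) (auto simp: powr_realpow)
  then have I: "((\<lambda>t. t ^ j * (1 - t) ^ l) has_integral Beta (real (j + 1)) (real (l + 1))) {0..1}"
    by (simp add: has_integral_Icc_iff_Ioo)
  have B: "Beta (real (j + 1)) (real (l + 1)) = fact j * fact l / fact (j + l + 1)"
    using Gamma_fact[of j, where 'a = real] Gamma_fact[of l, where 'a = real] Gamma_fact[of "j + l + 1", where 'a = real]
    by (simp add: Beta_def add_ac)
  have C: "real n * real ((n - 1) choose (k - 1)) * (fact j * fact l / fact (j + l + 1)) = 1"
  proof -
    have "fact j * fact l * real (j + l choose j) = fact (j + l)"
      using binomial_fact_lemma[of j "j + l"] by (metis add_diff_cancel_left' le_add1 of_nat_fact of_nat_mult)
    moreover have "real n * real ((n - 1) choose (k - 1)) * (fact j * fact l / fact (j + l + 1)) =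
      real (Suc (j + l)) * (fact j * fact l * real (j + l choose j)) / fact (Suc (j + l))"
      by (simp add: n kj del: of_nat_Suc fact_Suc)
    ultimately have "real n * real ((n - 1) choose (k - 1)) * (fact j * fact l / fact (j + l + 1)) =
      real (Suc (j + l)) * fact (j + l) / fact (Suc (j + l))" by metis
    also have "\<dots> = 1" by (simp add: fact_Suc del: of_nat_Suc)
    finally show ?thesis .
  qed
  have "((\<lambda>u. order_stat_kernel n k u) has_integral 1) {0..1}"
    using has_integral_mult_right[OF I, of "real n * real ((n - 1) choose (k - 1))"]
    unfolding B C order_stat_kernel_def by (simp add: n kj mult.assoc)
  then have "(\<integral>\<^sup>+u. ennreal (indicator {0..1} u * order_stat_kernel n k u) \<partial>lborel) = 1"
    using nn_integral_has_integral_lebesgue[of "{0..1}" "order_stat_kernel n k" 1]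
    by (simp add: order_stat_kernel_nonneg nn_integral_completion)
  moreover have "(\<integral>\<^sup>+u. ennreal (indicator {0..1} u * order_stat_kernel n k u) \<partial>lborel) =
    (\<integral>\<^sup>+u. ennreal (order_stat_kernel n k u) * indicator {0..1} u \<partial>lborel)"
    by (intro nn_integral_cong) (auto split: split_indicator)
  ultimately show ?thesis by simp
qed

text \<open>The log-likelihood ratio of \<open>u\<close> against the maximiser \<open>p\<close>, per observation: minus a Kullback--Leibler divergence.\<close>

definition relative_log_likelihood :: "real \<Rightarrow> real \<Rightarrow> real" where
  "relative_log_likelihood p u = p * (ln u - ln p) + (1 - p) * (ln (1 - u) - ln (1 - p))"

text \<open>The factor \<open>p - u\<close> splits off, so monotonicity on each side of
  \<open>p\<close> is decided by comparing \<open>1 / (u * (1 - u))\<close> with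
  \<open>2 * c\<close>. The choice \<open>c = 2\<close> yields the upper quadratic bound and
  \<open>c = 1 / (2 * d)\<close> the lower one.\<close>

lemma relative_log_likelihood_plus_square_deriv:
  assumes p: "0 < p" "p < 1" and u: "0 < u" "u < 1"
  shows "((\<lambda>u. relative_log_likelihood p u + c * (u - p)\<^sup>2) has_real_derivative
    (p - u) * (1 / (u * (1 - u)) - 2 * c)) (at u)"
proof -
  have "p / u - (1 - p) / (1 - u) = (p - u) / (u * (1 - u))" using u by (simp add: field_simps)
  then have "p * (1 / u) + (1 - p) * (- 1 / (1 - u)) + c * (2 * (u - p)) = (p - u) * (1 / (u * (1 - u)) - 2 * c)"
    by (simp add: algebra_simps)
  then show ?thesis
    unfolding relative_log_likelihood_def using u by (auto intro!: derivative_eq_intros simp: mult.commute[of c])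
qed

text \<open>Pinsker's inequality for Bernoulli laws. As \<open>u * (1 - u)\<close> is at most 1/4,
  the sum \<open>?H\<close> increases up to \<open>p\<close>, where it is 0, and decreases
  afterwards.\<close>

lemma relative_log_likelihood_le:
  assumes p: "0 < p" "p < 1" and u: "0 < u" "u < 1"
  shows "relative_log_likelihood p u \<le> - 2 * (u - p)\<^sup>2"
proof -
  let ?H = "\<lambda>u. relative_log_likelihood p u + 2 * (u - p)\<^sup>2"
  have sq: "1 / (v * (1 - v)) - 2 * 2 \<ge> 0" if "0 < v" "v < 1" for v :: real
  proof -
    have "0 \<le> (2 * v - 1)\<^sup>2" by simp
    then have "4 * (v * (1 - v)) \<le> 1" by (simp add: power2_eq_square algebra_simps)
    then show ?thesis using that by (simp add: pos_le_divide_eq)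
  qed
  have "?H u \<le> ?H p"
  proof (cases "u \<le> p")
    case True
    show ?thesis
    proof (rule DERIV_nonneg_imp_nondecreasing[OF True])
      fix v assume "u \<le> v" "v \<le> p"
      then show "\<exists>y. (?H has_real_derivative y) (at v) \<and> 0 \<le> y"
        using relative_log_likelihood_plus_square_deriv[OF p, of v 2] sq[of v] u p
        by (intro exI[of _ "(p - v) * (1 / (v * (1 - v)) - 2 * 2)"]) (auto intro!: mult_nonneg_nonneg)
    qed
  next
    case False
    then have "p \<le> u" by simp
    then show ?thesis
    proof (rule DERIV_nonpos_imp_nonincreasing)
      fix v assume "p \<le> v" "v \<le> u"
      then show "\<exists>y. (?H has_real_derivative y) (at v) \<and> y \<le> 0"
        using relative_log_likelihood_plus_square_deriv[OF p, of v 2] sq[of v] u p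
        by (intro exI[of _ "(p - v) * (1 / (v * (1 - v)) - 2 * 2)"]) (auto intro!: mult_nonpos_nonneg)
    qed
  qed
  then show ?thesis using p by (simp add: relative_log_likelihood_def)
qed

text \<open>A converse to Pinsker's inequality on a short interval to the right of \<open>p\<close>,
  enough to show that the kernel stays comparable to its peak there.\<close>

lemma relative_log_likelihood_ge:
  assumes d: "0 < d" "d \<le> 1/4" and p: "3 * d \<le> p" "p \<le> 1 - 3 * d" and u: "p \<le> u" "u \<le> p + d"
  shows "relative_log_likelihood p u \<ge> - (u - p)\<^sup>2 / (2 * d)"
proof -
  let ?H = "\<lambda>u. relative_log_likelihood p u + (1 / (2 * d)) * (u - p)\<^sup>2"
  have p01: "0 < p" "p < 1" using d p by auto
  have "?H p \<le> ?H u" using u(1)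
  proof (rule DERIV_nonneg_imp_nondecreasing)
    fix v assume v: "p \<le> v" "v \<le> u"
    then have v': "2 * d \<le> v" "v \<le> 1 - 2 * d" "0 < v" "v < 1" using p u d by auto
    \<comment> \<open>\<open>d \<le> 1/4\<close> gives \<open>1 - 2 * d \<ge> 1/2\<close>. Hence
      \<open>v * (1 - v) \<ge> d\<close>, which is the origin of the constant
      \<open>1 / (2 * d)\<close>.\<close>
    have "d \<le> 2 * d * (1 - 2 * d)" using d by (simp add: field_simps)
    also have "\<dots> \<le> v * (1 - v)"
    proof -
      have "0 \<le> (v - 2 * d) * (1 - 2 * d - v)" using v' by (intro mult_nonneg_nonneg) auto
      then show ?thesis by (simp add: algebra_simps)
    qed
    finally have "1 / (v * (1 - v)) \<le> 2 * (1 / (2 * d))" using d by (simp add: field_simps)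
    then show "\<exists>y. (?H has_real_derivative y) (at v) \<and> 0 \<le> y"
      using relative_log_likelihood_plus_square_deriv[OF p01 v'(3,4), of "1 / (2 * d)"] v(1)
      by (intro exI[of _ "(p - v) * (1 / (v * (1 - v)) - 2 * (1 / (2 * d)))"]) (auto intro!: mult_nonpos_nonpos)
  qed
  then show ?thesis using p01 by (simp add: relative_log_likelihood_def)
qed

text \<open>\<open>p\<close> is the mode: the exponents of the kernel are \<open>(n - 1) * p\<close>
  and \<open>(n - 1) * (1 - p)\<close>, so the ratio to the peak is a likelihood ratio of
  \<open>n - 1\<close> observations.\<close>

lemma order_stat_kernel_eq_exp:
  assumes k: "1 < k" "k < n" and u: "0 < u" "u < 1"
    and p_def: "p = real (k - 1) / real (n - 1)"
  shows "order_stat_kernel n k u = order_stat_kernel n k p * exp (real (n - 1) * relative_log_likelihood p u)"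
proof -
  have p: "0 < p" "p < 1" using k by (auto simp: p_def field_simps)
  have np: "real (n - 1) * p = real (k - 1)" using k by (simp add: p_def)
  then have nq: "real (n - 1) * (1 - p) = real (n - k)" using k by (simp add: algebra_simps of_nat_diff)
  have "real (n - 1) * relative_log_likelihood p u = (real (n - 1) * p) * ln (u / p) + (real (n - 1) * (1 - p)) * ln ((1 - u) / (1 - p))"
    using p u by (simp add: relative_log_likelihood_def algebra_simps ln_div)
  then have "exp (real (n - 1) * relative_log_likelihood p u) = (u / p) ^ (k - 1) * ((1 - u) / (1 - p)) ^ (n - k)"
    unfolding np nq using p u by (simp add: exp_add exp_of_nat_mult)
  then show ?thesis using p by (simp add: order_stat_kernel_def power_divide)
qed

text \<open>The height of the peak is read off from the total mass 1 instead of from Stirling's formula.\<close>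

lemma order_stat_kernel_peak:
  assumes k: "1 < k" "k < n" and d: "0 < d" "d \<le> 1/4" and p: "3 * d \<le> p" "p \<le> 1 - 3 * d"
    and p_def: "p = real (k - 1) / real (n - 1)" and n: "1 / sqrt (real (n - 1)) \<le> d"
  shows "order_stat_kernel n k p \<le> exp (1 / (2 * d)) * sqrt (real (n - 1))"
proof -
  define N where "N = real (n - 1)"
  have N: "N > 0" using k by (simp add: N_def)
  define P where "P = order_stat_kernel n k p"
  have p01: "0 < p" "p < 1" using d p by auto
  have P: "P \<ge> 0" unfolding P_def using p01 by (intro order_stat_kernel_nonneg) auto
  \<comment> \<open>For \<open>u\<close> within \<open>w\<close> to the right of \<open>p\<close>,
    \<open>N * (u - p)\<^sup>2 \<le> 1\<close>, so the kernel loses at most the factor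
    \<open>exp (- 1 / (2 * d))\<close>. Total mass 1 then bounds
    \<open>P * exp (- 1 / (2 * d)) * w\<close> by 1; \<open>w \<le> d\<close> keeps the window
    inside the range of the lower bound.\<close>
  define w where "w = 1 / sqrt N"
  have w: "0 < w" "w \<le> d" using n N by (auto simp: w_def N_def)
  have lower: "P * exp (- 1 / (2 * d)) \<le> order_stat_kernel n k u" if u: "p \<le> u" "u \<le> p + w" for u
  proof -
    have u01: "0 < u" "u < 1" using u p w d by auto
    have "(u - p)\<^sup>2 \<le> w\<^sup>2" using u by (intro power_mono) auto
    also have "w\<^sup>2 = 1 / N" using N by (simp add: w_def power_divide)
    finally have "N * (u - p)\<^sup>2 \<le> 1" using N by (simp add: field_simps)
    then have "- 1 / (2 * d) \<le> N * (- (u - p)\<^sup>2 / (2 * d))" using d by (simp add: field_simps)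
    also have "\<dots> \<le> N * relative_log_likelihood p u"
      using N relative_log_likelihood_ge[OF d p, of u] u w by (intro mult_left_mono) auto
    finally show ?thesis
      unfolding order_stat_kernel_eq_exp[OF k u01 p_def] P_def[symmetric] N_def[symmetric]
      using P by (intro mult_left_mono) auto
  qed
  have "ennreal (P * exp (- 1 / (2 * d)) * w) = (\<integral>\<^sup>+u. ennreal (P * exp (- 1 / (2 * d))) * indicator {p..p + w} u \<partial>lborel)"
    using w P by (simp add: nn_integral_cmult ennreal_mult)
  also have "\<dots> \<le> (\<integral>\<^sup>+u. ennreal (order_stat_kernel n k u) * indicator {0..1} u \<partial>lborel)"
    using lower p w d by (intro nn_integral_mono) (auto split: split_indicator intro!: ennreal_leI)
  also have "\<dots> = 1" using k by (intro nn_integral_order_stat_kernel) auto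
  finally have "P * exp (- 1 / (2 * d)) * w \<le> 1" by simp
  then have "P \<le> exp (1 / (2 * d)) * sqrt N"
    using N by (simp add: w_def field_simps exp_minus)
  then show ?thesis by (simp add: P_def N_def)
qed

lemma order_stat_kernel_gaussian_bound:
  assumes k: "1 < k" "k < n" and d: "0 < d" "d \<le> 1/4" and p: "3 * d \<le> p" "p \<le> 1 - 3 * d"
    and p_def: "p = real (k - 1) / real (n - 1)" and n: "1 / sqrt (real (n - 1)) \<le> d"
    and u: "0 \<le> u" "u \<le> 1"
  shows "order_stat_kernel n k u \<le> exp (1 / (2 * d)) * sqrt (real (n - 1)) * exp (- 2 * real (n - 1) * (u - p)\<^sup>2)"
\<comment> \<open>The exponential form holds only in the open interval; at the end points the kernel
  is 0, both exponents being positive for \<open>1 < k < n\<close>.\<close>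
proof (cases "u = 0 \<or> u = 1")
  case True
  then have "order_stat_kernel n k u = 0" using k by (auto simp: order_stat_kernel_def)
  then show ?thesis by simp
next
  case False
  then have u01: "0 < u" "u < 1" using u by auto
  have p01: "0 < p" "p < 1" using d p by auto
  have "real (n - 1) * relative_log_likelihood p u \<le> real (n - 1) * (- 2 * (u - p)\<^sup>2)"
    using relative_log_likelihood_le[OF p01 u01] by (intro mult_left_mono) auto
  then have "exp (real (n - 1) * relative_log_likelihood p u) \<le> exp (- 2 * real (n - 1) * (u - p)\<^sup>2)"
    by (simp add: mult_ac)
  then show ?thesis
    unfolding order_stat_kernel_eq_exp[OF k u01 p_def]
    using order_stat_kernel_peak[OF k d p p_def n] by (intro mult_mono) auto
qed

lemma tendsto_relative_rank:
  fixes k :: "nat \<Rightarrow> nat"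
  assumes k: "\<And>n. n \<ge> 1 \<Longrightarrow> 1 \<le> k n \<and> k n \<le> n"
    and lim: "(\<lambda>n. real (k n) / real n) \<longlonglongrightarrow> \<eta>"
  shows "(\<lambda>n. real (k n - 1) / real (n - 1)) \<longlonglongrightarrow> \<eta>"
proof -
  have "(\<lambda>n. (real (k n) / real n - 1 / real n) / (1 - 1 / real n)) \<longlonglongrightarrow> (\<eta> - 0) / (1 - 0)"
    by (intro tendsto_intros lim lim_1_over_n) auto
  moreover have "eventually (\<lambda>n. (real (k n) / real n - 1 / real n) / (1 - 1 / real n) = real (k n - 1) / real (n - 1)) sequentially"
    using eventually_ge_at_top[of 2]
  proof eventually_elim
    case (elim n)
    then show ?case using k[of n] by (simp add: of_nat_diff field_simps)
  qed
  ultimately show ?thesis using Lim_transform_eventually by force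
qed

text \<open>The Gaussian is centred at the mode and not at \<eta>, because \<open>k n / n\<close>
  may approach \<eta> at any speed.\<close>

lemma eventually_order_stat_kernel_bound:
  fixes k :: "nat \<Rightarrow> nat"
  assumes \<eta>: "0 < \<eta>" "\<eta> < 1" and k: "\<And>n. n \<ge> 1 \<Longrightarrow> 1 \<le> k n \<and> k n \<le> n"
    and lim: "(\<lambda>n. real (k n) / real n) \<longlonglongrightarrow> \<eta>"
  shows "\<exists>C>0. eventually (\<lambda>n. \<forall>u\<in>{0..1}. order_stat_kernel n (k n) u \<le>
    C * sqrt (real n) * exp (- real n * (u - real (k n - 1) / real (n - 1))\<^sup>2)) sequentially"
proof -
  define p where "p = (\<lambda>n. real (k n - 1) / real (n - 1))"
  have p: "p \<longlonglongrightarrow> \<eta>" unfolding p_def using k lim by (rule tendsto_relative_rank)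
  \<comment> \<open>A quarter of the distance from \<eta> to 0 and 1, so that
    \<open>3 * d < \<eta> < 1 - 3 * d\<close> is strict and passes to \<open>p n\<close> eventually;
    the 1/4 is the bound required by the peak estimate.\<close>
  define d where "d = min (1/4) (min (\<eta> / 4) ((1 - \<eta>) / 4))"
  have d: "0 < d" "d \<le> 1/4" "3 * d < \<eta>" "\<eta> < 1 - 3 * d" using \<eta> by (auto simp: d_def min_def field_simps)
  have "eventually (\<lambda>n. 3 * d < p n) sequentially" "eventually (\<lambda>n. p n < 1 - 3 * d) sequentially"
    using p d by (auto intro: order_tendstoD)
  moreover have "(\<lambda>n. 1 / sqrt (real (n - 1))) \<longlonglongrightarrow> 0" by real_asymp
  then have "eventually (\<lambda>n. 1 / sqrt (real (n - 1)) < d) sequentially" using d by (intro order_tendstoD)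
  ultimately have "eventually (\<lambda>n. \<forall>u\<in>{0..1}. order_stat_kernel n (k n) u \<le> exp (1 / (2 * d)) * sqrt (real n) * exp (- real n * (u - p n)\<^sup>2)) sequentially"
    using eventually_ge_at_top[of 2]
  proof eventually_elim
    case (elim n)
    have k1: "1 < k n" using elim k[of n] d by (cases "k n - 1") (auto simp: p_def)
    have "k n \<noteq> n" using elim d by (auto simp: p_def)
    with k[of n] elim have kn: "k n < n" by simp
    show ?case
    proof
      fix u :: real assume u: "u \<in> {0..1}"
      have "order_stat_kernel n (k n) u \<le> exp (1 / (2 * d)) * sqrt (real (n - 1)) * exp (- 2 * real (n - 1) * (u - p n)\<^sup>2)"
        by (rule order_stat_kernel_gaussian_bound[OF k1 kn d(1,2) _ _ p_def[THEN fun_cong]])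
           (use elim u in auto)
      also have "\<dots> \<le> exp (1 / (2 * d)) * sqrt (real n) * exp (- real n * (u - p n)\<^sup>2)"
      proof -
        \<comment> \<open>The constant 2 of Pinsker's inequality pays for replacing
          \<open>n - 1\<close> by \<open>n\<close> in the exponent.\<close>
        have "real n \<le> 2 * real (n - 1)" using elim by simp
        then have "real n * (u - p n)\<^sup>2 \<le> 2 * real (n - 1) * (u - p n)\<^sup>2" by (intro mult_right_mono) auto
        then show ?thesis by (intro mult_mono) auto
      qed
      finally show "order_stat_kernel n (k n) u \<le> \<dots>" .
    qed
  qed
  then show ?thesis unfolding p_def by (intro exI[of _ "exp (1 / (2 * d))"]) auto
qed

text \<open>Once \<open>p n\<close> is within \<open>e / 2\<close> of \<eta>, the Gaussian is
  evaluated at distance at least \<open>e / 2\<close> from its centre, and its exponential decay in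
  \<open>n\<close> beats the height \<open>sqrt n\<close>.\<close>

lemma order_stat_kernel_tendsto_0_away:
  fixes k :: "nat \<Rightarrow> nat"
  assumes \<eta>: "0 < \<eta>" "\<eta> < 1" and k: "\<And>n. n \<ge> 1 \<Longrightarrow> 1 \<le> k n \<and> k n \<le> n"
    and lim: "(\<lambda>n. real (k n) / real n) \<longlonglongrightarrow> \<eta>" and e: "e > 0" and a: "a > 0"
  shows "eventually (\<lambda>n. \<forall>u\<in>{0..1}. \<bar>u - \<eta>\<bar> \<ge> e \<longrightarrow> order_stat_kernel n (k n) u \<le> a) sequentially"
proof -
  define p where "p = (\<lambda>n. real (k n - 1) / real (n - 1))"
  have p: "p \<longlonglongrightarrow> \<eta>" unfolding p_def using k lim by (rule tendsto_relative_rank)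
  obtain C where C: "C > 0"
    and bound: "eventually (\<lambda>n. \<forall>u\<in>{0..1}. order_stat_kernel n (k n) u \<le> C * sqrt (real n) * exp (- real n * (u - p n)\<^sup>2)) sequentially"
    using eventually_order_stat_kernel_bound[OF \<eta> k lim] unfolding p_def by blast
  have "eventually (\<lambda>n. dist (p n) \<eta> < e / 2) sequentially" using p e by (intro tendstoD) auto
  moreover have "(\<lambda>n. C * sqrt (real n) * exp (- real n * (e / 2)\<^sup>2)) \<longlonglongrightarrow> 0" using C e by real_asymp
  then have "eventually (\<lambda>n. C * sqrt (real n) * exp (- real n * (e / 2)\<^sup>2) < a) sequentially"
    using a by (intro order_tendstoD)
  ultimately show ?thesis using bound
  proof eventually_elim
    case (elim n)
    show ?case
    proof (intro ballI impI)
      fix u :: real assume u: "u \<in> {0..1}" "\<bar>u - \<eta>\<bar> \<ge> e"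
      have "e / 2 \<le> \<bar>u - p n\<bar>" using u(2) elim(1) unfolding dist_real_def by linarith
      then have "(e / 2)\<^sup>2 \<le> \<bar>u - p n\<bar>\<^sup>2" using e by (intro power_mono) auto
      then have "real n * (e / 2)\<^sup>2 \<le> real n * (u - p n)\<^sup>2" by (intro mult_left_mono) auto
      then have "C * sqrt (real n) * exp (- real n * (u - p n)\<^sup>2) \<le> C * sqrt (real n) * exp (- real n * (e / 2)\<^sup>2)"
        using C by (intro mult_left_mono) auto
      with elim u show "order_stat_kernel n (k n) u \<le> a" by fastforce
    qed
  qed
qed

text \<open>The rate of \<open>k\<close> makes \<open>n * (p n - \<eta>)\<^sup>2\<close> bounded, so
  the centre can be moved from the mode to \<eta>. Weakening the Gaussian to
  \<open>1 / (1 + w\<^sup>2)\<close> first makes the move cost only a constant factor.\<close>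

lemma order_stat_kernel_bell_bound:
  fixes k :: "nat \<Rightarrow> nat"
  assumes \<eta>: "0 < \<eta>" "\<eta> < 1" and k: "\<And>n. n \<ge> 1 \<Longrightarrow> 1 \<le> k n \<and> k n \<le> n"
    and lim: "(\<lambda>n. real (k n) / real n) \<longlonglongrightarrow> \<eta>"
    and bigo: "(\<lambda>n. real (k n) - \<eta> * real n) \<in> O(\<lambda>n. sqrt (real n))"
  obtains C where "C > 0"
    "eventually (\<lambda>n. \<forall>u\<in>{0..1}. order_stat_kernel n (k n) u \<le> C * sqrt (real n) / (1 + real n * (u - \<eta>)\<^sup>2)) sequentially"
proof -
  define p where "p = (\<lambda>n. real (k n - 1) / real (n - 1))"
  have p: "p \<longlonglongrightarrow> \<eta>" unfolding p_def using k lim by (rule tendsto_relative_rank)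
  obtain C where C: "C > 0"
    and bound: "eventually (\<lambda>n. \<forall>u\<in>{0..1}. order_stat_kernel n (k n) u \<le> C * sqrt (real n) * exp (- real n * (u - p n)\<^sup>2)) sequentially"
    using eventually_order_stat_kernel_bound[OF \<eta> k lim] unfolding p_def by blast
  obtain K where K: "K > 0" and kK: "eventually (\<lambda>n. \<bar>real (k n) - \<eta> * real n\<bar> \<le> K * sqrt (real n)) sequentially"
    using bigo by (auto elim!: landau_o.bigE)
  \<comment> \<open>The \<open>+ 1\<close> absorbs the shift \<open>1 - \<eta>\<close> caused by
    \<open>k - 1\<close> and \<open>n - 1\<close>; the factor 2 comes from
    \<open>n \<le> 2 * (n - 1)\<close>.\<close>
  define D where "D = 2 * (K + 1)"
  have D: "D > 0" using K by (simp add: D_def)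
  have "eventually (\<lambda>n. \<forall>u\<in>{0..1}. order_stat_kernel n (k n) u \<le> (C * (2 + 2 * D\<^sup>2)) * sqrt (real n) / (1 + real n * (u - \<eta>)\<^sup>2)) sequentially"
    using bound kK eventually_ge_at_top[of 2]
  proof eventually_elim
    case (elim n)
    have n: "real n / 2 \<le> real (n - 1)" "real n \<ge> 2" "sqrt (real n) \<ge> 1" using elim by auto
    have "real (n - 1) * (p n - \<eta>) = real (k n) - \<eta> * real n - (1 - \<eta>)"
      using k[of n] elim by (simp add: p_def of_nat_diff field_simps)
    then have "real (n - 1) * \<bar>p n - \<eta>\<bar> = \<bar>real (k n) - \<eta> * real n - (1 - \<eta>)\<bar>"
      by (metis abs_mult abs_of_nat)
    also have "\<dots> \<le> K * sqrt (real n) + 1 * sqrt (real n)" using elim \<eta> n by linarith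
    finally have "real (n - 1) * \<bar>p n - \<eta>\<bar> \<le> (K + 1) * sqrt (real n)" by (simp add: algebra_simps)
    moreover have "real n / 2 * \<bar>p n - \<eta>\<bar> \<le> real (n - 1) * \<bar>p n - \<eta>\<bar>"
      using n by (intro mult_right_mono) auto
    ultimately have "real n * \<bar>p n - \<eta>\<bar> \<le> D * sqrt (real n)" by (simp add: D_def algebra_simps)
    then have "sqrt (real n) * (sqrt (real n) * \<bar>p n - \<eta>\<bar>) \<le> sqrt (real n) * D"
      by (simp add: mult.assoc[symmetric] mult.commute)
    then have "sqrt (real n) * \<bar>p n - \<eta>\<bar> \<le> D" using n by (subst (asm) mult_le_cancel_left_pos) auto
    then have "(sqrt (real n) * \<bar>p n - \<eta>\<bar>)\<^sup>2 \<le> D\<^sup>2" by (intro power_mono) auto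
    then have pD: "real n * (p n - \<eta>)\<^sup>2 \<le> D\<^sup>2" by (simp add: power_mult_distrib)
    show ?case
    proof
      fix u :: real assume u: "u \<in> {0..1}"
      define a where "a = real n * (u - p n)\<^sup>2"
      have a: "a \<ge> 0" by (simp add: a_def)
      have "(u - \<eta>)\<^sup>2 \<le> 2 * (u - p n)\<^sup>2 + 2 * (p n - \<eta>)\<^sup>2"
        using zero_le_power2[of "(u - p n) - (p n - \<eta>)"] by (simp add: power2_eq_square algebra_simps)
      then have "real n * (u - \<eta>)\<^sup>2 \<le> real n * (2 * (u - p n)\<^sup>2 + 2 * (p n - \<eta>)\<^sup>2)" by (intro mult_left_mono) auto
      then have "1 + real n * (u - \<eta>)\<^sup>2 \<le> 1 + 2 * a + 2 * D\<^sup>2"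
        using pD by (simp add: a_def algebra_simps)
      also have "\<dots> \<le> (2 + 2 * D\<^sup>2) * (1 + a)" using a by (simp add: algebra_simps)
      finally have le: "1 + real n * (u - \<eta>)\<^sup>2 \<le> (2 + 2 * D\<^sup>2) * (1 + a)" .
      have pos: "1 + real n * (u - \<eta>)\<^sup>2 > 0" by (simp add: add_pos_nonneg)
      have "exp (- a) \<le> 1 / (1 + a)"
        using exp_ge_add_one_self[of a] a by (simp add: exp_minus field_simps)
      also have "\<dots> \<le> (2 + 2 * D\<^sup>2) / (1 + real n * (u - \<eta>)\<^sup>2)"
        using le pos a by (simp add: divide_simps mult_ac)
      finally have "C * sqrt (real n) * exp (- a) \<le> C * sqrt (real n) * ((2 + 2 * D\<^sup>2) / (1 + real n * (u - \<eta>)\<^sup>2))"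
        using C by (intro mult_left_mono) auto
      then show "order_stat_kernel n (k n) u \<le> (C * (2 + 2 * D\<^sup>2)) * sqrt (real n) / (1 + real n * (u - \<eta>)\<^sup>2)"
        using bspec[OF elim(1) u] by (simp add: a_def mult_ac)
    qed
  qed
  moreover have "C * (2 + 2 * D\<^sup>2) > 0" using C by (intro mult_pos_pos add_pos_nonneg) auto
  ultimately show ?thesis using that by blast
qed

section \<open>Integrals against a concentrating kernel\<close>

lemma ennreal_tendsto_0I:
  fixes f :: "'a \<Rightarrow> ennreal"
  assumes "\<And>e::real. e > 0 \<Longrightarrow> eventually (\<lambda>x. f x \<le> ennreal e) F"
  shows "(f \<longlongrightarrow> 0) F"
proof (rule order_tendstoI)
  fix a :: ennreal assume "0 < a"
  then obtain e where "e > 0" "ennreal e < a"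
  proof (cases a)
    case (real r)
    with \<open>0 < a\<close> show ?thesis by (intro that[of "r / 2"]) (auto intro!: ennreal_lessI)
  qed (auto intro: that[of 1])
  with assms[of e] show "eventually (\<lambda>x. f x < a) F" by (auto elim: eventually_mono)
qed simp

text \<open>Away from \<beta> the kernel is uniformly small and \<open>a\<close> is integrable, so
  only a neighbourhood of \<beta> matters. The two ways of controlling it, continuity and Lebesgue
  points, share this reduction.\<close>

lemma kernel_integral_tendsto_0:
  fixes a :: "real \<Rightarrow> ennreal" and K :: "nat \<Rightarrow> real \<Rightarrow> real"
  assumes [measurable]: "a \<in> borel_measurable borel" and K[measurable]: "\<And>n. K n \<in> borel_measurable borel"
    and fin: "(\<integral>\<^sup>+s. a s \<partial>lborel) < \<infinity>"
    and far: "\<And>\<delta> e. \<delta> > 0 \<Longrightarrow> e > 0 \<Longrightarrow> eventually (\<lambda>n. \<forall>s. \<bar>s - \<beta>\<bar> \<ge> \<delta> \<longrightarrow> K n s \<le> e) sequentially"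
    and near: "\<And>e. e > 0 \<Longrightarrow> \<exists>\<delta>>0. eventually (\<lambda>n. (\<integral>\<^sup>+s. a s * ennreal (K n s) * indicator (cball \<beta> \<delta>) s \<partial>lborel) \<le> ennreal e) sequentially"
  shows "(\<lambda>n. \<integral>\<^sup>+s. a s * ennreal (K n s) \<partial>lborel) \<longlonglongrightarrow> 0"
proof (rule ennreal_tendsto_0I)
  fix e :: real assume e: "e > 0"
  obtain A where A: "A \<ge> 0" "(\<integral>\<^sup>+s. a s \<partial>lborel) = ennreal A"
    using fin by (cases "\<integral>\<^sup>+s. a s \<partial>lborel") auto
  obtain \<delta> where \<delta>: "\<delta> > 0"
    "eventually (\<lambda>n. (\<integral>\<^sup>+s. a s * ennreal (K n s) * indicator (cball \<beta> \<delta>) s \<partial>lborel) \<le> ennreal (e / 2)) sequentially"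
    using near[of "e / 2"] e by auto
  \<comment> \<open>The \<open>+ 1\<close> covers an integral \<open>A\<close> equal to 0.\<close>
  define c where "c = e / 2 / (A + 1)"
  have c: "c > 0" "c * A \<le> e / 2" using e A by (auto simp: c_def field_simps)
  show "eventually (\<lambda>n. (\<integral>\<^sup>+s. a s * ennreal (K n s) \<partial>lborel) \<le> ennreal e) sequentially"
    using \<delta>(2) far[OF \<delta>(1) c(1)]
  proof eventually_elim
    case (elim n)
    have "(\<integral>\<^sup>+s. a s * ennreal (K n s) \<partial>lborel) \<le>
      (\<integral>\<^sup>+s. a s * ennreal (K n s) * indicator (cball \<beta> \<delta>) s + ennreal c * a s \<partial>lborel)"
    proof (rule nn_integral_mono)
      fix s
      show "a s * ennreal (K n s) \<le> a s * ennreal (K n s) * indicator (cball \<beta> \<delta>) s + ennreal c * a s"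
      proof (cases "s \<in> cball \<beta> \<delta>")
        case False
        then have "K n s \<le> c" using elim(2) by (auto simp: dist_real_def abs_minus_commute)
        then have "a s * ennreal (K n s) \<le> a s * ennreal c" by (intro mult_left_mono ennreal_leI) auto
        then show ?thesis using False by (simp add: mult.commute)
      qed (simp add: add_increasing2)
    qed
    also have "\<dots> = (\<integral>\<^sup>+s. a s * ennreal (K n s) * indicator (cball \<beta> \<delta>) s \<partial>lborel) + ennreal c * ennreal A"
      by (subst nn_integral_add) (auto simp: nn_integral_cmult A)
    also have "\<dots> \<le> ennreal (e / 2) + ennreal (e / 2)"
      using elim(1) c A by (intro add_mono) (auto simp: ennreal_mult[symmetric] intro!: ennreal_leI)
    also have "\<dots> = ennreal e" using e by (simp add: ennreal_plus[symmetric] del: ennreal_plus)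
    finally show ?case .
  qed
qed

text \<open>The kernel is normalised against \<open>h\<close>, not against Lebesgue measure. Near
  \<beta>, \<open>h\<close> stays above half its positive value there, so a small \<open>a\<close>
  is at most \<open>e * h\<close>, and the integral of \<open>e * h\<close> against the kernel is at
  most \<open>e\<close>.\<close>

lemma kernel_integral_tendsto_0_continuous:
  fixes a :: "real \<Rightarrow> ennreal" and K :: "nat \<Rightarrow> real \<Rightarrow> real" and h :: "real \<Rightarrow> real"
  assumes [measurable]: "a \<in> borel_measurable borel" and K[measurable]: "\<And>n. K n \<in> borel_measurable borel"
    and fin: "(\<integral>\<^sup>+s. a s \<partial>lborel) < \<infinity>"
    and far: "\<And>\<delta> e. \<delta> > 0 \<Longrightarrow> e > 0 \<Longrightarrow> eventually (\<lambda>n. \<forall>s. \<bar>s - \<beta>\<bar> \<ge> \<delta> \<longrightarrow> K n s \<le> e) sequentially"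
    and [measurable]: "h \<in> borel_measurable borel" and h: "0 < h \<beta>" "isCont h \<beta>"
    and mass: "eventually (\<lambda>n. (\<integral>\<^sup>+s. ennreal (h s) * ennreal (K n s) \<partial>lborel) \<le> 1) sequentially"
    and a: "(a \<longlongrightarrow> 0) (nhds \<beta>)"
  shows "(\<lambda>n. \<integral>\<^sup>+s. a s * ennreal (K n s) \<partial>lborel) \<longlonglongrightarrow> 0"
proof (rule kernel_integral_tendsto_0[OF _ _ fin far])
  fix e :: real assume e: "e > 0"
  have "eventually (\<lambda>s. h s > h \<beta> / 2) (nhds \<beta>)"
    using h by (intro order_tendstoD(1)[of h "h \<beta>"]) (auto simp: isCont_def tendsto_at_iff_tendsto_nhds)
  moreover have "eventually (\<lambda>s. a s < ennreal (e * (h \<beta> / 2))) (nhds \<beta>)"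
    using a e h by (intro order_tendstoD(2)[of a 0]) auto
  ultimately have "eventually (\<lambda>s. a s \<le> ennreal e * ennreal (h s)) (nhds \<beta>)"
  proof eventually_elim
    case (elim s)
    have "a s \<le> ennreal (e * h s)"
      using elim e by (intro order_trans[OF less_imp_le[OF elim(2)]] ennreal_leI mult_left_mono) auto
    then show ?case using e elim h by (simp add: ennreal_mult)
  qed
  then obtain d where d: "d > 0" "\<And>s. dist s \<beta> < d \<Longrightarrow> a s \<le> ennreal e * ennreal (h s)"
    by (auto simp: eventually_nhds_metric)
  show "\<exists>\<delta>>0. eventually (\<lambda>n. (\<integral>\<^sup>+s. a s * ennreal (K n s) * indicator (cball \<beta> \<delta>) s \<partial>lborel) \<le> ennreal e) sequentially"
  proof (intro exI[of _ "d / 2"] conjI)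
    show "eventually (\<lambda>n. (\<integral>\<^sup>+s. a s * ennreal (K n s) * indicator (cball \<beta> (d / 2)) s \<partial>lborel) \<le> ennreal e) sequentially"
      using mass
    proof eventually_elim
      case (elim n)
      have "(\<integral>\<^sup>+s. a s * ennreal (K n s) * indicator (cball \<beta> (d / 2)) s \<partial>lborel) \<le>
        (\<integral>\<^sup>+s. ennreal e * (ennreal (h s) * ennreal (K n s)) \<partial>lborel)"
      proof (intro nn_integral_mono)
        fix s
        show "a s * ennreal (K n s) * indicator (cball \<beta> (d / 2)) s \<le> ennreal e * (ennreal (h s) * ennreal (K n s))"
        proof (cases "s \<in> cball \<beta> (d / 2)")
          case True
          then have "a s \<le> ennreal e * ennreal (h s)" using d by (auto simp: dist_commute)
          then show ?thesis using True by (simp add: mult.assoc[symmetric] mult_right_mono)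
        qed simp
      qed
      also have "\<dots> = ennreal e * (\<integral>\<^sup>+s. ennreal (h s) * ennreal (K n s) \<partial>lborel)"
        by (rule nn_integral_cmult) measurable
      also have "\<dots> \<le> ennreal e * 1" using elim by (intro mult_left_mono) auto
      finally show ?case by simp
    qed
  qed (use d in auto)
qed measurable

text \<open>Dyadic domination of the bell by indicators of intervals, on which a Lebesgue point gives control.\<close>

lemma bell_le_dyadic_sum:
  fixes w :: real assumes w: "w \<ge> 0"
  shows "ennreal (1 / (1 + w\<^sup>2)) \<le> (\<Sum>j. ennreal (4 * (1 / 4) ^ j) * indicator {..2 ^ j} w)"
proof -
  obtain j0 :: nat where "w \<le> 2 ^ j0"
    using real_arch_pow[of 2 w] by (auto intro: less_imp_le)
  define j where "j = (LEAST j. w \<le> 2 ^ j)"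
  have j: "w \<le> 2 ^ j" unfolding j_def by (rule LeastI) fact
  have "1 / (1 + w\<^sup>2) \<le> 4 * (1 / 4) ^ j"
  proof (cases j)
    case 0
    have "1 / (1 + w\<^sup>2) \<le> 1" by (simp add: add_pos_nonneg)
    then show ?thesis using 0 by simp
  next
    case (Suc i)
    then have "\<not> w \<le> 2 ^ i" unfolding j_def by (intro not_less_Least) auto
    then have "(2 ^ i)\<^sup>2 \<le> w\<^sup>2" by (intro power_mono) auto
    then have "4 ^ i \<le> 1 + w\<^sup>2" by (simp add: power2_eq_square power_mult_distrib[symmetric])
    then have "1 / (1 + w\<^sup>2) \<le> 1 / 4 ^ i" by (intro divide_left_mono mult_pos_pos add_pos_nonneg) auto
    then show ?thesis using Suc by (simp add: power_divide)
  qed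
  then have "ennreal (1 / (1 + w\<^sup>2)) \<le> (\<Sum>j\<in>{j}. ennreal (4 * (1 / 4) ^ j) * indicator {..2 ^ j} w)"
    using j by (simp add: ennreal_leI)
  also have "\<dots> \<le> (\<Sum>j. ennreal (4 * (1 / 4) ^ j) * indicator {..2 ^ j} w)"
    by (intro sum_le_suminf) auto
  finally show ?thesis .
qed

text \<open>The interval of radius \<open>2 ^ j / t\<close> has weight \<open>4 * t / 4 ^ j\<close>
  and mass at most \<open>e * 2 ^ j / t\<close>; the products \<open>4 * e / 2 ^ j\<close> add up to
  \<open>8 * e\<close>, independently of the scale \<open>t\<close>.\<close>

lemma bell_kernel_integral_le:
  fixes a :: "real \<Rightarrow> ennreal"
  assumes [measurable]: "a \<in> borel_measurable borel" and t: "t > 0" and e: "e \<ge> 0"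
    and small: "\<And>r. 0 < r \<Longrightarrow> r \<le> \<delta> \<Longrightarrow> (\<integral>\<^sup>+s. a s * indicator (cball \<beta> r) s \<partial>lborel) \<le> ennreal (e * r)"
    and \<delta>: "\<delta> > 0"
  shows "(\<integral>\<^sup>+s. a s * ennreal (t / (1 + (t * (s - \<beta>))\<^sup>2)) * indicator (cball \<beta> \<delta>) s \<partial>lborel) \<le> ennreal (8 * e)"
proof -
  \<comment> \<open>Small means are known only for radii up to \<delta>. Truncating there does not
    change the indicators at points of \<open>cball \<beta> \<delta>\<close>.\<close>
  define r where "r j = min \<delta> (2 ^ j / t)" for j :: nat
  have r: "0 < r j" "r j \<le> \<delta>" "r j \<le> 2 ^ j / t" for j using \<delta> t by (auto simp: r_def)
  have "(\<integral>\<^sup>+s. a s * ennreal (t / (1 + (t * (s - \<beta>))\<^sup>2)) * indicator (cball \<beta> \<delta>) s \<partial>lborel) \<le>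
    (\<integral>\<^sup>+s. (\<Sum>j. ennreal (4 * t * (1 / 4) ^ j) * (a s * indicator (cball \<beta> (r j)) s)) \<partial>lborel)"
  proof (intro nn_integral_mono)
    fix s
    show "a s * ennreal (t / (1 + (t * (s - \<beta>))\<^sup>2)) * indicator (cball \<beta> \<delta>) s \<le>
      (\<Sum>j. ennreal (4 * t * (1 / 4) ^ j) * (a s * indicator (cball \<beta> (r j)) s))"
    proof (cases "s \<in> cball \<beta> \<delta>")
      case True
      define w where "w = t * \<bar>s - \<beta>\<bar>"
      have w: "w \<ge> 0" "(t * (s - \<beta>))\<^sup>2 = w\<^sup>2" using t by (auto simp: w_def power_mult_distrib)
      have ind: "indicator (cball \<beta> (r j)) s = (indicator {..2 ^ j} w :: ennreal)" for j
        using True t by (auto simp: w_def r_def dist_real_def abs_minus_commute field_simps split: split_indicator)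
      have "a s * ennreal (t / (1 + (t * (s - \<beta>))\<^sup>2)) = a s * ennreal t * ennreal (1 / (1 + w\<^sup>2))"
        using t unfolding w(2) by (simp add: ennreal_mult[symmetric] mult.assoc)
      also have "\<dots> \<le> a s * ennreal t * (\<Sum>j. ennreal (4 * (1 / 4) ^ j) * indicator {..2 ^ j} w)"
        using w by (intro mult_left_mono bell_le_dyadic_sum) auto
      also have "\<dots> = (\<Sum>j. a s * ennreal t * (ennreal (4 * (1 / 4) ^ j) * indicator {..2 ^ j} w))"
        by (rule ennreal_suminf_cmult[symmetric])
      also have "\<dots> = (\<Sum>j. ennreal (4 * t * (1 / 4) ^ j) * (a s * indicator (cball \<beta> (r j)) s))"
      proof (rule suminf_cong)
        fix j
        have "ennreal (4 * t * (1 / 4) ^ j) = ennreal t * ennreal (4 * (1 / 4) ^ j)"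
          using t by (subst ennreal_mult[symmetric]) (auto simp: mult_ac)
        then show "a s * ennreal t * (ennreal (4 * (1 / 4) ^ j) * indicator {..2 ^ j} w) =
          ennreal (4 * t * (1 / 4) ^ j) * (a s * indicator (cball \<beta> (r j)) s)"
          unfolding ind by (simp add: mult_ac)
      qed
      finally show ?thesis using True by simp
    qed simp
  qed
  also have "\<dots> = (\<Sum>j. ennreal (4 * t * (1 / 4) ^ j) * (\<integral>\<^sup>+s. a s * indicator (cball \<beta> (r j)) s \<partial>lborel))"
    by (subst nn_integral_suminf) (auto simp: nn_integral_cmult)
  also have "\<dots> \<le> (\<Sum>j. ennreal (4 * e * (1 / 2) ^ j))"
  proof (rule suminf_le)
    fix j
    have "ennreal (4 * t * (1 / 4) ^ j) * (\<integral>\<^sup>+s. a s * indicator (cball \<beta> (r j)) s \<partial>lborel) \<le>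
      ennreal (4 * t * (1 / 4) ^ j) * ennreal (e * (2 ^ j / t))"
      by (rule mult_left_mono[OF order_trans[OF small[OF r(1,2)] ennreal_leI[OF mult_left_mono[OF r(3) e]]]]) simp
    also have "\<dots> = ennreal (4 * e * (1 / 2) ^ j)"
    proof -
      have "(1 / 4) ^ j * 2 ^ j = ((1 / 2) ^ j :: real)" by (simp add: power_mult_distrib[symmetric])
      then have "4 * t * (1 / 4) ^ j * (e * (2 ^ j / t)) = 4 * e * (1 / 2) ^ j" using t by simp
      then show ?thesis using t e by (subst ennreal_mult[symmetric]) auto
    qed
    finally show "ennreal (4 * t * (1 / 4) ^ j) * (\<integral>\<^sup>+s. a s * indicator (cball \<beta> (r j)) s \<partial>lborel) \<le>
      ennreal (4 * e * (1 / 2) ^ j)" .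
  qed auto
  also have "\<dots> = ennreal (8 * e)"
  proof (rule suminf_ennreal_eq)
    show "(\<lambda>j. 4 * e * (1 / 2) ^ j) sums (8 * e)"
      using sums_mult[OF geometric_sums[of "1 / 2 :: real"], of "4 * e"] by simp
  qed (use e in auto)
  finally show ?thesis .
qed

text \<open>With \<open>t = c * sqrt n\<close> the assumed bound is \<open>C / c\<close> times the
  bell \<open>t / (1 + (t * (s - \<beta>))\<^sup>2)\<close>, so the scale-free dyadic estimate
  applies for every positive \<open>n\<close> at which the bound holds.\<close>

lemma kernel_integral_tendsto_0_lebesgue_point:
  fixes a :: "real \<Rightarrow> ennreal" and K :: "nat \<Rightarrow> real \<Rightarrow> real"
  assumes [measurable]: "a \<in> borel_measurable borel" and K[measurable]: "\<And>n. K n \<in> borel_measurable borel"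
    and fin: "(\<integral>\<^sup>+s. a s \<partial>lborel) < \<infinity>"
    and far: "\<And>\<delta> e. \<delta> > 0 \<Longrightarrow> e > 0 \<Longrightarrow> eventually (\<lambda>n. \<forall>s. \<bar>s - \<beta>\<bar> \<ge> \<delta> \<longrightarrow> K n s \<le> e) sequentially"
    and C: "C > 0" and c: "c > 0" and d: "d > 0"
    and bell: "eventually (\<lambda>n. \<forall>s. \<bar>s - \<beta>\<bar> \<le> d \<longrightarrow> K n s \<le> C * sqrt (real n) / (1 + real n * (c * (s - \<beta>))\<^sup>2)) sequentially"
    and a: "\<And>e. e > 0 \<Longrightarrow> \<exists>\<delta>>0. \<forall>r. 0 < r \<and> r < \<delta> \<longrightarrow> (\<integral>\<^sup>+s. a s * indicator (cball \<beta> r) s \<partial>lborel) \<le> ennreal (e * r)"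
  shows "(\<lambda>n. \<integral>\<^sup>+s. a s * ennreal (K n s) \<partial>lborel) \<longlonglongrightarrow> 0"
proof (rule kernel_integral_tendsto_0[OF _ _ fin far])
  fix e :: real assume e: "e > 0"
  \<comment> \<open>Compensates the factor 8 of the dyadic sum and the factor \<open>C / c\<close>
    of the rescaling.\<close>
  define e' where "e' = e * c / (8 * C)"
  have e': "e' > 0" "C / c * (8 * e') = e" using e c C by (auto simp: e'_def)
  obtain \<delta> where \<delta>: "\<delta> > 0" "\<And>r. 0 < r \<Longrightarrow> r < \<delta> \<Longrightarrow> (\<integral>\<^sup>+s. a s * indicator (cball \<beta> r) s \<partial>lborel) \<le> ennreal (e' * r)"
    using a[OF e'(1)] by auto
  define \<rho> where "\<rho> = min (\<delta> / 2) d"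
  have \<rho>: "\<rho> > 0" "\<rho> < \<delta>" "\<rho> \<le> d" using \<delta> d by (auto simp: \<rho>_def)
  show "\<exists>\<delta>>0. eventually (\<lambda>n. (\<integral>\<^sup>+s. a s * ennreal (K n s) * indicator (cball \<beta> \<delta>) s \<partial>lborel) \<le> ennreal e) sequentially"
  proof (intro exI[of _ \<rho>] conjI \<rho>)
    show "eventually (\<lambda>n. (\<integral>\<^sup>+s. a s * ennreal (K n s) * indicator (cball \<beta> \<rho>) s \<partial>lborel) \<le> ennreal e) sequentially"
      using bell eventually_gt_at_top[of 0]
    proof eventually_elim
      case (elim n)
      define t where "t = c * sqrt (real n)"
      have t: "t > 0" using c elim by (simp add: t_def)
      have "(\<integral>\<^sup>+s. a s * ennreal (K n s) * indicator (cball \<beta> \<rho>) s \<partial>lborel) \<le>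
        (\<integral>\<^sup>+s. ennreal (C / c) * (a s * ennreal (t / (1 + (t * (s - \<beta>))\<^sup>2)) * indicator (cball \<beta> \<rho>) s) \<partial>lborel)"
      proof (intro nn_integral_mono)
        fix s
        show "a s * ennreal (K n s) * indicator (cball \<beta> \<rho>) s \<le>
          ennreal (C / c) * (a s * ennreal (t / (1 + (t * (s - \<beta>))\<^sup>2)) * indicator (cball \<beta> \<rho>) s)"
        proof (cases "s \<in> cball \<beta> \<rho>")
          case True
          then have "K n s \<le> C * sqrt (real n) / (1 + real n * (c * (s - \<beta>))\<^sup>2)"
            using elim(1) \<rho>(3) by (auto simp: dist_real_def abs_minus_commute)
          also have "\<dots> = C / c * (t / (1 + (t * (s - \<beta>))\<^sup>2))"
            using c by (simp add: t_def power_mult_distrib mult_ac)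
          finally have "ennreal (K n s) \<le> ennreal (C / c) * ennreal (t / (1 + (t * (s - \<beta>))\<^sup>2))"
            using c C t by (subst ennreal_mult[symmetric]) (auto intro!: ennreal_leI)
          then have "a s * ennreal (K n s) \<le> a s * (ennreal (C / c) * ennreal (t / (1 + (t * (s - \<beta>))\<^sup>2)))"
            by (rule mult_left_mono) simp
          then show ?thesis using True by (simp add: mult_ac)
        qed simp
      qed
      also have "\<dots> = ennreal (C / c) * (\<integral>\<^sup>+s. a s * ennreal (t / (1 + (t * (s - \<beta>))\<^sup>2)) * indicator (cball \<beta> \<rho>) s \<partial>lborel)"
        by (rule nn_integral_cmult) measurable
      also have "\<dots> \<le> ennreal (C / c) * ennreal (8 * e')"
        using \<delta> \<rho> t e' by (intro mult_left_mono bell_kernel_integral_le) auto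
      also have "\<dots> = ennreal e"
        using e' c C by (subst ennreal_mult[symmetric]) auto
      finally show ?case .
    qed
  qed
qed measurable

section \<open>Ranks in an independent sample\<close>

text \<open>In a sorted list the elements below \<open>v\<close> form the initial segment, so
  counting them locates \<open>v\<close> (positions start at 0); repetitions of \<open>v\<close>
  come after that position.\<close>

lemma nth_sorted_eq:
  fixes xs :: "'a :: linorder list"
  assumes "sorted xs" "v \<in> set xs" "length (filter (\<lambda>x. x < v) xs) = j"
  shows "xs ! j = v"
  using assms
proof (induction xs arbitrary: j)
  case (Cons x xs)
  show ?case
  proof (cases "x < v")
    case True
    then show ?thesis using Cons by auto
  next
    case False
    then have "x = v" using Cons.prems by auto
    moreover have "filter (\<lambda>y. y < v) xs = []"
      using Cons.prems(1) \<open>x = v\<close> by (auto simp: filter_empty_conv)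
    ultimately show ?thesis using Cons.prems by auto
  qed
qed simp

text \<open>All comparisons with \<open>s j\<close> are strict, so \<open>j\<close> is the only
  index attaining the order statistic and the choice made by \<open>LEAST\<close> is forced. Exactly
  \<open>k - 1\<close> values lie below, matching the zero-based position
  \<open>k - 1\<close>.\<close>

lemma order_stat_index_eqI:
  assumes j: "j \<in> {1..n}" and I: "I \<subseteq> {1..n} - {j}" "card I = k - 1"
    and less: "\<And>i. i \<in> I \<Longrightarrow> s i < s j"
    and greater: "\<And>i. i \<in> {1..n} - {j} - I \<Longrightarrow> s j < s i"
  shows "order_stat_index k n s = j"
proof -
  let ?xs = "map s [1..<Suc n]"
  have "length (filter (\<lambda>x. x < s j) (sort ?xs)) = length (filter (\<lambda>x. x < s j) ?xs)"
    by (metis mset_filter mset_sort size_mset)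
  also have "\<dots> = length (filter (\<lambda>i. s i < s j) [1..<Suc n])"
    by (simp add: filter_map o_def del: upt_Suc)
  also have "\<dots> = card (set (filter (\<lambda>i. s i < s j) [1..<Suc n]))"
    by (rule distinct_card[symmetric]) simp
  also have "set (filter (\<lambda>i. s i < s j) [1..<Suc n]) = I"
    using I less greater by (fastforce simp: order_less_imp_not_less)
  finally have "order_stat k n s = s j"
    unfolding order_stat_def using j I(2) by (intro nth_sorted_eq) (auto simp del: upt_Suc)
  moreover have "i = j" if "i \<in> {1..n}" "s i = s j" for i
    using that less[of i] greater[of i] by (cases "i \<in> I") auto
  ultimately show ?thesis
    unfolding order_stat_index_def using j by (intro Least_equality) auto
qed

text \<open>Conditionally on the pair with index \<open>j\<close>, the other pairs are independent
  and each faces a single one-sided comparison, so the probability is a product of two powers. No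
  relation between the two components of a pair is used.\<close>

lemma emeasure_indep_rank_event:
  fixes V :: "nat \<Rightarrow> 'b \<Rightarrow> real \<times> real"
  assumes N: "prob_space N" and indep: "prob_space.indep_vars N (\<lambda>_. borel) V J"
    and distr: "\<And>i. i \<in> J \<Longrightarrow> distr N borel (V i) = \<mu>"
    and fin: "finite J" and j: "j \<in> J" and I: "I \<subseteq> J - {j}" and A[measurable]: "A \<in> sets borel"
  shows "emeasure N {\<omega>\<in>space N. fst (V j \<omega>) \<in> A \<and> (\<forall>i\<in>I. snd (V i \<omega>) < snd (V j \<omega>)) \<and>
      (\<forall>i\<in>J - {j} - I. snd (V j \<omega>) < snd (V i \<omega>))} =
    (\<integral>\<^sup>+v. indicator A (fst v) * (emeasure \<mu> {w. snd w < snd v} ^ card I *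
      emeasure \<mu> {w. snd v < snd w} ^ card (J - {j} - I)) \<partial>\<mu>)"
proof -
  interpret N: prob_space N by fact
  have V[measurable]: "V i \<in> borel_measurable N" if "i \<in> J" for i
    using indep that by (auto simp: N.indep_vars_def)
  have sets_\<mu>[measurable_cong, simp]: "sets \<mu> = sets borel" and \<mu>: "prob_space \<mu>"
    using distr[OF j] N.prob_space_distr[OF V[OF j]] by auto
  interpret \<mu>: prob_space \<mu> by (rule \<mu>)
  interpret P: product_prob_space "\<lambda>_. \<mu>" J by standard
  define R where "R = J - {j}"
  have J: "J = insert j R" and jR: "j \<notin> R" "finite R" "R \<subseteq> J" using j fin by (auto simp: R_def)
  have IR: "I \<subseteq> R" and finI: "finite I" using I fin by (auto simp: R_def intro: finite_subset)
  have [simp]: "space \<mu> = UNIV" using sets_eq_imp_space_eq[OF sets_\<mu>] by simp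
  have joint: "distr N (\<Pi>\<^sub>M i\<in>J. borel) (\<lambda>\<omega>. \<lambda>i\<in>J. V i \<omega>) = (\<Pi>\<^sub>M i\<in>J. \<mu>)"
  proof -
    have "distr N (\<Pi>\<^sub>M i\<in>J. borel) (\<lambda>\<omega>. \<lambda>i\<in>J. V i \<omega>) = (\<Pi>\<^sub>M i\<in>J. distr N borel (V i))"
      using N.indep_vars_iff_distr_eq_PiM'[of J V "\<lambda>_. borel"] j V indep by auto
    also have "\<dots> = (\<Pi>\<^sub>M i\<in>J. \<mu>)" using distr by (intro PiM_cong) auto
    finally show ?thesis .
  qed
  define E where "E = {v\<in>space (\<Pi>\<^sub>M i\<in>J. \<mu>). fst (v j) \<in> A \<and> (\<forall>i\<in>I. snd (v i) < snd (v j)) \<and> (\<forall>i\<in>R - I. snd (v j) < snd (v i))}"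
  have jJ: "j \<in> J" "\<And>i. i \<in> I \<Longrightarrow> i \<in> J" "\<And>i. i \<in> R - I \<Longrightarrow> i \<in> J" using J IR by auto
  have comp: "(\<lambda>v. v i) \<in> measurable (\<Pi>\<^sub>M i\<in>J. \<mu>) borel" if "i \<in> J" for i
    using measurable_component_singleton[OF that, of "\<lambda>_. \<mu>"] measurable_cong_sets[OF refl sets_\<mu>] by blast
  have fst_m: "(\<lambda>v. fst (v i)) \<in> borel_measurable (\<Pi>\<^sub>M i\<in>J. \<mu>)"
    and snd_m: "(\<lambda>v. snd (v i)) \<in> borel_measurable (\<Pi>\<^sub>M i\<in>J. \<mu>)" if "i \<in> J" for i
    by (auto intro!: measurable_compose[OF comp[OF that]] borel_measurable_continuous_onI continuous_intros)
  have "{v\<in>space (\<Pi>\<^sub>M i\<in>J. \<mu>). fst (v j) \<in> A} \<in> sets (\<Pi>\<^sub>M i\<in>J. \<mu>)"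
    using measurable_sets[OF fst_m[OF jJ(1)] A] by (simp add: vimage_def Int_def conj_commute)
  moreover have "{v\<in>space (\<Pi>\<^sub>M i\<in>J. \<mu>). snd (v i) < snd (v l)} \<in> sets (\<Pi>\<^sub>M i\<in>J. \<mu>)" if "i \<in> J" "l \<in> J" for i l
    using snd_m[OF that(1)] snd_m[OF that(2)] by (rule borel_measurable_less)
  ultimately have E[measurable]: "E \<in> sets (\<Pi>\<^sub>M i\<in>J. \<mu>)"
    unfolding E_def using jJ finI jR by (intro sets.sets_Collect_conj sets.sets_Collect_finite_All) auto
  have "{\<omega>\<in>space N. fst (V j \<omega>) \<in> A \<and> (\<forall>i\<in>I. snd (V i \<omega>) < snd (V j \<omega>)) \<and>
      (\<forall>i\<in>J - {j} - I. snd (V j \<omega>) < snd (V i \<omega>))} = (\<lambda>\<omega>. \<lambda>i\<in>J. V i \<omega>) -` E \<inter> space N"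
  proof (rule set_eqI)
    fix \<omega>
    have "(\<lambda>i\<in>J. V i \<omega>) \<in> space (\<Pi>\<^sub>M i\<in>J. \<mu>)" by (simp add: space_PiM)
    moreover have "(\<forall>i\<in>I. snd ((\<lambda>i\<in>J. V i \<omega>) i) < snd (V j \<omega>)) \<longleftrightarrow> (\<forall>i\<in>I. snd (V i \<omega>) < snd (V j \<omega>))"
      using jJ by (intro ball_cong) auto
    moreover have "(\<forall>i\<in>R - I. snd (V j \<omega>) < snd ((\<lambda>i\<in>J. V i \<omega>) i)) \<longleftrightarrow> (\<forall>i\<in>R - I. snd (V j \<omega>) < snd (V i \<omega>))"
      using jJ by (intro ball_cong) auto
    moreover have "(\<lambda>i\<in>J. V i \<omega>) j = V j \<omega>" using jJ by simp
    ultimately show "\<omega> \<in> {\<omega>\<in>space N. fst (V j \<omega>) \<in> A \<and> (\<forall>i\<in>I. snd (V i \<omega>) < snd (V j \<omega>)) \<and>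
      (\<forall>i\<in>J - {j} - I. snd (V j \<omega>) < snd (V i \<omega>))} \<longleftrightarrow> \<omega> \<in> (\<lambda>\<omega>. \<lambda>i\<in>J. V i \<omega>) -` E \<inter> space N"
      unfolding E_def R_def[symmetric] by (simp only: vimage_eq Int_iff mem_Collect_eq) blast
  qed
  moreover have "emeasure N ((\<lambda>\<omega>. \<lambda>i\<in>J. V i \<omega>) -` E \<inter> space N) = emeasure (\<Pi>\<^sub>M i\<in>J. \<mu>) E"
  proof -
    have "sets (\<Pi>\<^sub>M i\<in>J. \<mu>) = sets (\<Pi>\<^sub>M i\<in>J. borel :: (real \<times> real) measure)" by (intro sets_PiM_cong) auto
    then have "E \<in> sets (\<Pi>\<^sub>M i\<in>J. borel :: (real \<times> real) measure)" using E by simp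
    then show ?thesis unfolding joint[symmetric] by (subst emeasure_distr) auto
  qed
  moreover have "emeasure (\<Pi>\<^sub>M i\<in>J. \<mu>) E = (\<integral>\<^sup>+v. indicator E v \<partial>(\<Pi>\<^sub>M i\<in>J. \<mu>))"
    using E by simp
  \<comment> \<open>Coordinate \<open>j\<close> becomes the outer integral, so that with its value
    \<open>y\<close> fixed the remaining condition is the box \<open>Pi\<^sub>E R B\<close>.\<close>
  moreover have "\<dots> = (\<integral>\<^sup>+y. (\<integral>\<^sup>+x. indicator E (x(j := y)) \<partial>(\<Pi>\<^sub>M i\<in>R. \<mu>)) \<partial>\<mu>)"
    using jR E unfolding J by (intro P.product_nn_integral_insert_rev) auto
  moreover have "(\<integral>\<^sup>+x. indicator E (x(j := y)) \<partial>(\<Pi>\<^sub>M i\<in>R. \<mu>)) =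
     indicator A (fst y) * (emeasure \<mu> {w. snd w < snd y} ^ card I * emeasure \<mu> {w. snd y < snd w} ^ card (R - I))" for y
  proof -
    define B where "B i = (if i \<in> I then {w. snd w < snd y} else {w. snd y < snd (w :: real \<times> real)})" for i :: nat
    have [measurable]: "{w :: real \<times> real. snd w < snd y} \<in> sets borel" "{w :: real \<times> real. snd y < snd w} \<in> sets borel"
      by (intro borel_open open_Collect_less continuous_intros)+
    then have B: "B i \<in> sets \<mu>" for i by (simp add: B_def)
    have PB: "Pi\<^sub>E R B \<in> sets (\<Pi>\<^sub>M i\<in>R. \<mu>)" using jR B by (intro sets_PiM_I_finite) auto
    have "(\<integral>\<^sup>+x. indicator E (x(j := y)) \<partial>(\<Pi>\<^sub>M i\<in>R. \<mu>)) = (\<integral>\<^sup>+x. indicator A (fst y) * indicator (Pi\<^sub>E R B) x \<partial>(\<Pi>\<^sub>M i\<in>R. \<mu>))"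
    proof (intro nn_integral_cong)
      fix x assume "x \<in> space (\<Pi>\<^sub>M i\<in>R. \<mu>)"
      then have x: "x \<in> extensional R" by (auto simp: space_PiM PiE_def)
      then have "x(j := y) \<in> space (\<Pi>\<^sub>M i\<in>J. \<mu>)" by (auto simp: space_PiM J PiE_def extensional_def)
      moreover have "(x(j := y)) i = x i" if "i \<in> R" for i using that jR by auto
      ultimately have "x(j := y) \<in> E \<longleftrightarrow> fst y \<in> A \<and> x \<in> Pi\<^sub>E R B"
        using IR jR x unfolding E_def PiE_def Pi_def B_def by (auto split: if_splits)
      then show "indicator E (x(j := y)) = (indicator A (fst y) * indicator (Pi\<^sub>E R B) x :: ennreal)"
        by (auto split: split_indicator)
    qed
    also have "\<dots> = indicator A (fst y) * emeasure (\<Pi>\<^sub>M i\<in>R. \<mu>) (Pi\<^sub>E R B)"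
      using PB by (simp add: nn_integral_cmult)
    also have "emeasure (\<Pi>\<^sub>M i\<in>R. \<mu>) (Pi\<^sub>E R B) = (\<Prod>i\<in>R. emeasure \<mu> (B i))"
      using jR B by (intro P.emeasure_PiM) auto
    also have "\<dots> = (\<Prod>i\<in>I. emeasure \<mu> (B i)) * (\<Prod>i\<in>R - I. emeasure \<mu> (B i))"
      using jR IR by (metis mult.commute prod.subset_diff)
    also have "(\<Prod>i\<in>I. emeasure \<mu> (B i)) = emeasure \<mu> {w. snd w < snd y} ^ card I" by (simp add: B_def)
    also have "(\<Prod>i\<in>R - I. emeasure \<mu> (B i)) = emeasure \<mu> {w. snd y < snd w} ^ card (R - I)" by (simp add: B_def)
    finally show ?thesis .
  qed
  ultimately show ?thesis by (simp add: R_def)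
qed

text \<open>All events with fixed index \<open>j\<close> and fixed set \<open>I\<close> have the
  same probability, and there are as many of them as the coefficient of the kernel says; on each the
  first addend is that of sample \<open>j\<close>.\<close>

lemma emeasure_first_addend_ge:
  fixes Y :: "nat \<Rightarrow> nat \<Rightarrow> 'b \<Rightarrow> real" and G :: "real \<Rightarrow> real"
  assumes N: "prob_space N"
    and indep: "prob_space.indep_vars N (\<lambda>_. borel) (\<lambda>j \<omega>. (Y j 1 \<omega>, \<Sum>i=1..m. Y j i \<omega>)) {1..n}"
    and distr: "\<And>j. j \<in> {1..n} \<Longrightarrow> distr N borel (\<lambda>\<omega>. (Y j 1 \<omega>, \<Sum>i=1..m. Y j i \<omega>)) = \<mu>"
    and G01: "\<And>s. 0 \<le> G s \<and> G s \<le> 1"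
    and below: "\<And>s. emeasure \<mu> {w. snd w < s} = ennreal (G s)"
    and above: "\<And>s. emeasure \<mu> {w. s < snd w} = ennreal (1 - G s)"
    and k: "1 \<le> k" "k \<le> n"
    and first[measurable]: "first_addend k n m Y \<in> borel_measurable N" and A[measurable]: "A \<in> sets borel"
  shows "(\<integral>\<^sup>+v. indicator A (fst v) * ennreal (order_stat_kernel n k (G (snd v))) \<partial>\<mu>)
    \<le> emeasure N {\<omega>\<in>space N. first_addend k n m Y \<omega> \<in> A}"
proof -
  interpret N: prob_space N by fact
  define V where "V j \<omega> = (Y j 1 \<omega>, \<Sum>i=1..m. Y j i \<omega>)" for j \<omega>
  have V[measurable]: "V i \<in> borel_measurable N" if "i \<in> {1..n}" for i
    using indep that by (auto simp: N.indep_vars_def V_def[abs_def])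
  have fst_m: "(\<lambda>\<omega>. fst (V i \<omega>)) \<in> borel_measurable N"
    and snd_m: "(\<lambda>\<omega>. snd (V i \<omega>)) \<in> borel_measurable N" if "i \<in> {1..n}" for i
    by (auto intro!: measurable_compose[OF V[OF that]] borel_measurable_continuous_onI continuous_intros)
  define E where "E = (\<lambda>(j, I). {\<omega>\<in>space N. fst (V j \<omega>) \<in> A \<and> (\<forall>i\<in>I. snd (V i \<omega>) < snd (V j \<omega>)) \<and>
      (\<forall>i\<in>{1..n} - {j} - I. snd (V j \<omega>) < snd (V i \<omega>))})"
  define P where "P = (SIGMA j:{1..n}. {I. I \<subseteq> {1..n} - {j} \<and> card I = k - 1})"
  have finP: "finite P" unfolding P_def by (intro finite_SigmaI) auto
  have cardP: "card P = n * ((n - 1) choose (k - 1))"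
    unfolding P_def by (subst card_SigmaI) (auto simp: n_subsets)
  \<comment> \<open>Both \<open>j\<close> and \<open>I\<close> can be read off from any outcome in
    the event; this is what makes events for different pairs disjoint.\<close>
  have index: "order_stat_index k n (\<lambda>j. \<Sum>i=1..m. Y j i \<omega>) = j \<and> I = {i\<in>{1..n}. snd (V i \<omega>) < snd (V j \<omega>)}"
    if "(j, I) \<in> P" "\<omega> \<in> E (j, I)" for j I \<omega>
  proof
    have *: "j \<in> {1..n}" "I \<subseteq> {1..n} - {j}" "card I = k - 1"
      "\<And>i. i \<in> I \<Longrightarrow> snd (V i \<omega>) < snd (V j \<omega>)" "\<And>i. i \<in> {1..n} - {j} - I \<Longrightarrow> snd (V j \<omega>) < snd (V i \<omega>)"
      using that by (auto simp: P_def E_def)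
    show "order_stat_index k n (\<lambda>j. \<Sum>i=1..m. Y j i \<omega>) = j"
      using * by (intro order_stat_index_eqI[of j n I]) (auto simp: V_def)
    show "I = {i\<in>{1..n}. snd (V i \<omega>) < snd (V j \<omega>)}"
      using * by (fastforce simp: order_less_imp_not_less)
  qed
  have disj: "disjoint_family_on E P"
    unfolding disjoint_family_on_def
  proof (intro ballI impI)
    fix a b assume ab: "a \<in> P" "b \<in> P" "a \<noteq> b"
    show "E a \<inter> E b = {}"
    proof (rule ccontr)
      assume "E a \<inter> E b \<noteq> {}"
      then obtain \<omega> where "\<omega> \<in> E a" "\<omega> \<in> E b" by blast
      with ab index[of "fst a" "snd a" \<omega>] index[of "fst b" "snd b" \<omega>] have "fst a = fst b \<and> snd a = snd b" by auto
      with ab show False by (simp add: prod_eq_iff)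
    qed
  qed
  have E_sets: "E a \<in> sets N" if "a \<in> P" for a
  proof -
    obtain j I where a: "a = (j, I)" and j: "j \<in> {1..n}" and I: "I \<subseteq> {1..n} - {j}"
      using \<open>a \<in> P\<close> by (auto simp: P_def)
    have "finite I" using I finite_subset by blast
    have "{\<omega>\<in>space N. fst (V j \<omega>) \<in> A} \<in> sets N"
      using measurable_sets[OF fst_m[OF j] A] by (simp add: vimage_def Int_def conj_commute)
    moreover have "{\<omega>\<in>space N. snd (V i \<omega>) < snd (V l \<omega>)} \<in> sets N" if "i \<in> {1..n}" "l \<in> {1..n}" for i l
      using snd_m[OF that(1)] snd_m[OF that(2)] by (rule borel_measurable_less)
    ultimately show ?thesis
      unfolding a E_def prod.case using j I \<open>finite I\<close>
      by (intro sets.sets_Collect_conj sets.sets_Collect_finite_All) auto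
  qed
  have "(\<integral>\<^sup>+v. indicator A (fst v) * ennreal (order_stat_kernel n k (G (snd v))) \<partial>\<mu>) =
    (\<integral>\<^sup>+v. of_nat (card P) * (indicator A (fst v) * ennreal (G (snd v) ^ (k - 1) * (1 - G (snd v)) ^ (n - k))) \<partial>\<mu>)"
    unfolding cardP using G01 
    by (intro nn_integral_cong) (auto simp: order_stat_kernel_def mult.assoc ennreal_mult ennreal_of_nat_eq_real_of_nat[symmetric] split: split_indicator)
  also have "\<dots> = of_nat (card P) * (\<integral>\<^sup>+v. indicator A (fst v) * ennreal (G (snd v) ^ (k - 1) * (1 - G (snd v)) ^ (n - k)) \<partial>\<mu>)"
  proof (rule nn_integral_cmult)
    have "1 \<in> {1..n}" using k by simp
    from distr[OF this] have "sets \<mu> = sets borel" by (metis sets_distr)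
    \<comment> \<open>Measurability of \<open>G\<close> is not assumed; it follows from
      monotonicity, which \<open>below\<close> supplies.\<close>
    have "mono G"
    proof
      fix s t :: real assume "s \<le> t"
      then have "emeasure \<mu> {w. snd w < s} \<le> emeasure \<mu> {w. snd w < t}"
        by (intro emeasure_mono) (auto simp: \<open>sets \<mu> = sets borel\<close> intro!: borel_open open_Collect_less continuous_intros)
      then show "G s \<le> G t" using G01 by (simp add: below)
    qed
    then have G[measurable]: "G \<in> borel_measurable borel" by (rule borel_measurable_mono)
    have "(\<lambda>v. indicator A (fst v) * ennreal (G (snd v) ^ (k - 1) * (1 - G (snd v)) ^ (n - k))) \<in> borel_measurable (borel \<Otimes>\<^sub>M borel)"
      by measurable
    then show "(\<lambda>v. indicator A (fst v) * ennreal (G (snd v) ^ (k - 1) * (1 - G (snd v)) ^ (n - k))) \<in> borel_measurable \<mu>"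
      unfolding borel_prod using measurable_cong_sets[OF \<open>sets \<mu> = sets borel\<close> refl] by blast
  qed
  also have "\<dots> = (\<Sum>a\<in>P. emeasure N (E a))"
  proof -
    have "emeasure N (E a) = (\<integral>\<^sup>+v. indicator A (fst v) * ennreal (G (snd v) ^ (k - 1) * (1 - G (snd v)) ^ (n - k)) \<partial>\<mu>)" if "a \<in> P" for a
    proof -
      obtain j I where a: "a = (j, I)" and j: "j \<in> {1..n}" and I: "I \<subseteq> {1..n} - {j}" and c: "card I = k - 1"
        using \<open>a \<in> P\<close> by (auto simp: P_def)
      have "card ({1..n} - {j} - I) = n - 1 - (k - 1)" using I j c by (subst card_Diff_subset) (auto intro: finite_subset)
      also have "\<dots> = n - k" using k by simp
      finally have c': "card ({1..n} - {j} - I) = n - k" .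
      have "emeasure N (E a) = (\<integral>\<^sup>+v. indicator A (fst v) * (emeasure \<mu> {w. snd w < snd v} ^ card I *
        emeasure \<mu> {w. snd v < snd w} ^ card ({1..n} - {j} - I)) \<partial>\<mu>)"
        unfolding a E_def prod.case
        using N indep distr by (intro emeasure_indep_rank_event j I A) (auto simp: V_def[abs_def])
      then show ?thesis
        unfolding c c' below above using G01 by (simp add: ennreal_mult ennreal_power)
    qed
    then show ?thesis by simp
  qed
  also have "\<dots> = emeasure N (\<Union>a\<in>P. E a)"
    using E_sets by (intro sum_emeasure finP disj) auto
  also have "\<dots> \<le> emeasure N {\<omega>\<in>space N. first_addend k n m Y \<omega> \<in> A}"
  proof (rule emeasure_mono)
    have "\<omega> \<in> space N \<and> first_addend k n m Y \<omega> \<in> A" if "(j, I) \<in> P" "\<omega> \<in> E (j, I)" for j I \<omega>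
      using that index[OF that] by (auto simp: first_addend_def E_def V_def)
    then show "(\<Union>a\<in>P. E a) \<subseteq> {\<omega>\<in>space N. first_addend k n m Y \<omega> \<in> A}" by auto
  qed measurable
  finally show ?thesis .
qed

section \<open>The density of the first addend and its limit\<close>

text \<open>The \<open>m\<close> addends enter only through the first one, with density
  \<open>f\<close>, and the sum of the others, with density \<open>g\<close>.\<close>

locale addend_densities =
  fixes f g :: "real \<Rightarrow> real" and B :: real
  assumes f_measurable[measurable]: "f \<in> borel_measurable borel"
    and g_measurable[measurable]: "g \<in> borel_measurable borel"
    and f_pos: "0 < f x" and f_le: "f x \<le> B" and g_nonneg: "0 \<le> g x"
    and f_mass: "(\<integral>\<^sup>+x. ennreal (f x) \<partial>lborel) = 1" and g_mass: "(\<integral>\<^sup>+x. ennreal (g x) \<partial>lborel) = 1"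
begin

definition sum_density :: "real \<Rightarrow> real" where
  "sum_density s = (\<integral>x. f x * g (s - x) \<partial>lborel)"

definition sum_law :: "real measure" where
  "sum_law = density lborel (\<lambda>s. ennreal (sum_density s))"

definition sum_cdf :: "real \<Rightarrow> real" where
  "sum_cdf = cdf sum_law"

lemma B_pos: "0 < B"
  using f_pos[of 0] f_le[of 0] by simp

lemma integrable_g: "integrable lborel g"
  using g_mass g_nonneg by (intro integrableI_nonneg) auto

text \<open>Domination by \<open>B * g (s - x)\<close>: boundedness of \<open>f\<close> makes the
  convolution finite at every \<open>s\<close>, not just almost everywhere.\<close>

lemma integrable_sum_density: "integrable lborel (\<lambda>x. f x * g (s - x))"
proof (rule Bochner_Integration.integrable_bound)
  show "integrable lborel (\<lambda>x. B * g (s - x))"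
    using lborel_integrable_real_affine[OF integrable_g, of "-1" s] by simp
  show "AE x in lborel. norm (f x * g (s - x)) \<le> norm (B * g (s - x))"
    using mult_right_mono[OF f_le g_nonneg] f_pos g_nonneg B_pos by (intro AE_I2) (simp add: abs_mult less_imp_le)
qed measurable

lemma sum_density_nonneg: "0 \<le> sum_density s"
  unfolding sum_density_def using f_pos g_nonneg by (intro integral_nonneg_AE) (auto simp: less_imp_le)

lemma nn_integral_sum_density: "(\<integral>\<^sup>+x. ennreal (f x * g (s - x)) \<partial>lborel) = ennreal (sum_density s)"
  unfolding sum_density_def using f_pos g_nonneg
  by (intro nn_integral_eq_integral integrable_sum_density) (auto simp: less_imp_le)

text \<open>As \<open>f\<close> vanishes nowhere, a zero of the convolution at \<open>s\<close>
  would force \<open>g (s - x) = 0\<close> for almost all \<open>x\<close>, contradicting the mass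
  of \<open>g\<close>.\<close>

lemma sum_density_pos: "0 < sum_density s"
proof (rule ccontr)
  assume "\<not> 0 < sum_density s"
  then have "(\<integral>\<^sup>+x. ennreal (f x * g (s - x)) \<partial>lborel) = 0"
    unfolding nn_integral_sum_density by (simp add: ennreal_neg)
  then have "AE x in lborel. ennreal (f x * g (s - x)) = 0"
    by (subst (asm) nn_integral_0_iff_AE) auto
  moreover have "ennreal (g (s - x)) = 0" if "ennreal (f x * g (s - x)) = 0" for x
    using that f_pos[of x] by (simp add: ennreal_eq_0_iff mult_le_0_iff)
  ultimately have "AE x in lborel. ennreal (g (s - x)) = 0" by (auto elim: eventually_mono)
  then have "(\<integral>\<^sup>+x. ennreal (g (s - x)) \<partial>lborel) = 0"
    by (subst nn_integral_0_iff_AE) auto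
  then show False using nn_integral_reflect[of "\<lambda>x. ennreal (g x)" s] g_mass by simp
qed

lemma L1_shift_tendsto_0:
  "((\<lambda>s. \<integral>\<^sup>+x. ennreal \<bar>g (s - x) - g (t - x)\<bar> \<partial>lborel) \<longlongrightarrow> 0) (nhds t)"
proof (rule order_tendstoI)
  fix a :: ennreal assume a: "0 < a"
  show "eventually (\<lambda>s. (\<integral>\<^sup>+x. ennreal \<bar>g (s - x) - g (t - x)\<bar> \<partial>lborel) < a) (nhds t)"
    unfolding eventually_nhds_iff_sequentially
  proof (intro allI impI)
    fix S assume "S \<longlonglongrightarrow> t"
    then have "(\<lambda>n. S n - t) \<longlonglongrightarrow> 0" by (simp add: LIM_zero)
    from L1_translation_continuous[OF integrable_g this]
    have "eventually (\<lambda>n. (\<integral>\<^sup>+x. ennreal \<bar>g (x + (S n - t)) - g x\<bar> \<partial>lborel) < a) sequentially"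
      using a by (intro order_tendstoD)
    moreover have "(\<integral>\<^sup>+x. ennreal \<bar>g (x + (s - t)) - g x\<bar> \<partial>lborel) = (\<integral>\<^sup>+x. ennreal \<bar>g (s - x) - g (t - x)\<bar> \<partial>lborel)" for s
      using nn_integral_reflect[of "\<lambda>x. ennreal \<bar>g (x + (s - t)) - g x\<bar>" t] by (simp add: algebra_simps)
    ultimately show "eventually (\<lambda>n. (\<integral>\<^sup>+x. ennreal \<bar>g (S n - x) - g (t - x)\<bar> \<partial>lborel) < a) sequentially" by simp
  qed
qed simp

lemma L1_diff_bound:
  "(\<integral>\<^sup>+x. ennreal \<bar>f x * g (s - x) - f x * g (t - x)\<bar> \<partial>lborel) \<le>
    ennreal B * (\<integral>\<^sup>+x. ennreal \<bar>g (s - x) - g (t - x)\<bar> \<partial>lborel)"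
proof -
  have "(\<integral>\<^sup>+x. ennreal \<bar>f x * g (s - x) - f x * g (t - x)\<bar> \<partial>lborel) \<le>
    (\<integral>\<^sup>+x. ennreal B * ennreal \<bar>g (s - x) - g (t - x)\<bar> \<partial>lborel)"
  proof (intro nn_integral_mono)
    fix x
    have "\<bar>f x * g (s - x) - f x * g (t - x)\<bar> = f x * \<bar>g (s - x) - g (t - x)\<bar>"
      using f_pos[of x] by (simp add: right_diff_distrib[symmetric] abs_mult)
    also have "\<dots> \<le> B * \<bar>g (s - x) - g (t - x)\<bar>" using f_le by (intro mult_right_mono) auto
    finally show "ennreal \<bar>f x * g (s - x) - f x * g (t - x)\<bar> \<le> ennreal B * ennreal \<bar>g (s - x) - g (t - x)\<bar>"
      using B_pos by (subst ennreal_mult[symmetric]) (auto intro!: ennreal_leI)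
  qed
  also have "\<dots> = ennreal B * (\<integral>\<^sup>+x. ennreal \<bar>g (s - x) - g (t - x)\<bar> \<partial>lborel)"
    by (rule nn_integral_cmult) measurable
  finally show ?thesis .
qed

text \<open>The increment is at most \<open>B\<close> times the L1 distance of two reflected
  translates of \<open>g\<close>, which is small by continuity of translations.\<close>

lemma isCont_sum_density: "isCont sum_density t"
proof -
  have bound: "ennreal \<bar>sum_density s - sum_density t\<bar> \<le>
    ennreal B * (\<integral>\<^sup>+x. ennreal \<bar>g (s - x) - g (t - x)\<bar> \<partial>lborel)" for s
  proof -
    have "sum_density s - sum_density t = (\<integral>x. f x * g (s - x) - f x * g (t - x) \<partial>lborel)"
      unfolding sum_density_def by (rule Bochner_Integration.integral_diff[symmetric]) (rule integrable_sum_density)+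
    then have "ennreal \<bar>sum_density s - sum_density t\<bar> \<le> (\<integral>\<^sup>+x. ennreal (norm (f x * g (s - x) - f x * g (t - x))) \<partial>lborel)"
      using integral_norm_bound_ennreal[OF Bochner_Integration.integrable_diff[OF integrable_sum_density[of s] integrable_sum_density[of t]]] by simp
    also have "\<dots> \<le> ennreal B * (\<integral>\<^sup>+x. ennreal \<bar>g (s - x) - g (t - x)\<bar> \<partial>lborel)"
      using L1_diff_bound by simp
    finally show ?thesis .
  qed
  have "((\<lambda>s. ennreal B * (\<integral>\<^sup>+x. ennreal \<bar>g (s - x) - g (t - x)\<bar> \<partial>lborel)) \<longlongrightarrow> ennreal B * 0) (nhds t)"
    by (intro tendsto_mult_ennreal L1_shift_tendsto_0 tendsto_const) auto
  then have upper: "((\<lambda>s. ennreal B * (\<integral>\<^sup>+x. ennreal \<bar>g (s - x) - g (t - x)\<bar> \<partial>lborel)) \<longlongrightarrow> 0) (nhds t)"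
    by simp
  have "((\<lambda>s. ennreal \<bar>sum_density s - sum_density t\<bar>) \<longlongrightarrow> 0) (nhds t)"
    by (rule tendsto_sandwich[OF _ _ tendsto_const upper]) (use bound in \<open>simp_all add: always_eventually\<close>)
  then have "((\<lambda>s. \<bar>sum_density s - sum_density t\<bar>) \<longlongrightarrow> 0) (nhds t)"
    using tendsto_ennrealD[of "\<lambda>s. \<bar>sum_density s - sum_density t\<bar>" 0] by simp
  then have "(sum_density \<longlongrightarrow> sum_density t) (nhds t)"
    using LIM_zero_cancel tendsto_rabs_zero_iff by blast
  then show ?thesis by (simp add: isCont_def tendsto_at_iff_tendsto_nhds)
qed

lemma sum_density_measurable[measurable]: "sum_density \<in> borel_measurable borel"
  using isCont_sum_density by (intro borel_measurable_continuous_onI continuous_at_imp_continuous_on) auto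

lemma sum_density_mass: "(\<integral>\<^sup>+s. ennreal (sum_density s) \<partial>lborel) = 1"
proof -
  have "(\<integral>\<^sup>+s. ennreal (sum_density s) \<partial>lborel) = (\<integral>\<^sup>+x. (\<integral>\<^sup>+s. ennreal (f x * g (s - x)) \<partial>lborel) \<partial>lborel)"
    unfolding nn_integral_sum_density[symmetric] by (rule nn_integral_joint_swap) measurable
  also have "\<dots> = (\<integral>\<^sup>+x. ennreal (f x) \<partial>lborel)"
  proof (intro nn_integral_cong)
    fix x
    have "(\<integral>\<^sup>+s. ennreal (f x * g (s - x)) \<partial>lborel) = (\<integral>\<^sup>+s. ennreal (f x) * ennreal (g (s - x)) \<partial>lborel)"
      using f_pos g_nonneg by (simp add: ennreal_mult less_imp_le)
    also have "\<dots> = ennreal (f x)"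
      using g_mass nn_integral_shift[of "\<lambda>s. ennreal (g s)" x] by (simp add: nn_integral_cmult)
    finally show "(\<integral>\<^sup>+s. ennreal (f x * g (s - x)) \<partial>lborel) = ennreal (f x)" .
  qed
  finally show ?thesis using f_mass by simp
qed

sublocale sum: real_distribution sum_law
proof (intro real_distribution.intro real_distribution_axioms.intro prob_spaceI)
  show "emeasure sum_law (space sum_law) = 1"
    by (simp add: sum_law_def emeasure_density sum_density_mass)
qed (simp_all add: sum_law_def)

lemma emeasure_sum_law: "A \<in> sets borel \<Longrightarrow> emeasure sum_law A = (\<integral>\<^sup>+s. ennreal (sum_density s) * indicator A s \<partial>lborel)"
  by (simp add: sum_law_def emeasure_density)

lemma sum_law_singleton: "measure sum_law {x} = 0"
proof -
  have "emeasure sum_law {x} = 0"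
    unfolding emeasure_sum_law[OF borel_singleton[OF sets.empty_sets]]
    by (rule nn_integral_0_iff_AE[THEN iffD2]) (auto intro!: eventually_mono[OF AE_lborel_singleton[of x]])
  then show ?thesis by (simp add: measure_def)
qed

lemma isCont_sum_cdf: "isCont sum_cdf x"
  unfolding sum_cdf_def by (simp add: sum.isCont_cdf sum_law_singleton)

lemma sum_cdf_nonneg: "0 \<le> sum_cdf s" and sum_cdf_le_1: "sum_cdf s \<le> 1" and sum_cdf_mono: "s \<le> t \<Longrightarrow> sum_cdf s \<le> sum_cdf t"
  unfolding sum_cdf_def by (auto intro: sum.cdf_nonneg sum.cdf_bounded_prob sum.cdf_nondecreasing)

lemma sum_cdf_measurable[measurable]: "sum_cdf \<in> borel_measurable borel"
  using isCont_sum_cdf by (intro borel_measurable_continuous_onI continuous_at_imp_continuous_on) auto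

text \<open>Serves twice: with the minimum of the density on an interval for strict monotonicity,
  and with half the density at \<beta> to transport the bell from \<open>u = sum_cdf s\<close> to
  \<open>s\<close>.\<close>

lemma sum_cdf_diff_ge:
  assumes "a \<le> b" "c \<ge> 0" "\<And>s. a \<le> s \<Longrightarrow> s \<le> b \<Longrightarrow> c \<le> sum_density s"
  shows "c * (b - a) \<le> sum_cdf b - sum_cdf a"
proof (cases "a = b")
  case False
  then have "a < b" using assms by simp
  have "ennreal (c * (b - a)) = (\<integral>\<^sup>+s. ennreal c * indicator {a<..b} s \<partial>lborel)"
    using assms by (simp add: nn_integral_cmult ennreal_mult)
  also have "\<dots> \<le> (\<integral>\<^sup>+s. ennreal (sum_density s) * indicator {a<..b} s \<partial>lborel)"
    using assms by (intro nn_integral_mono) (auto split: split_indicator intro!: ennreal_leI)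
  also have "\<dots> = emeasure sum_law {a<..b}" by (simp add: emeasure_sum_law)
  also have "\<dots> = ennreal (sum_cdf b - sum_cdf a)"
    unfolding sum_cdf_def sum.cdf_diff_eq[OF \<open>a < b\<close>] by (rule sum.emeasure_eq_measure)
  finally show ?thesis using assms(1) sum_cdf_mono by (subst (asm) ennreal_le_iff) auto
qed simp

lemma sum_cdf_strict_mono: "strict_mono sum_cdf"
proof
  fix a b :: real assume ab: "a < b"
  have "continuous_on {a..b} sum_density"
    using isCont_sum_density by (intro continuous_at_imp_continuous_on) auto
  then obtain z where "z \<in> {a..b}" "\<And>s. s \<in> {a..b} \<Longrightarrow> sum_density z \<le> sum_density s"
    using continuous_attains_inf[of "{a..b}" sum_density] ab by auto
  then have "sum_density z * (b - a) \<le> sum_cdf b - sum_cdf a"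
    using ab sum_density_nonneg by (intro sum_cdf_diff_ge) auto
  moreover have "0 < sum_density z * (b - a)" using ab sum_density_pos by simp
  ultimately show "sum_cdf a < sum_cdf b" by simp
qed

lemma sum_cdf_surj:
  assumes "0 < \<eta>" "\<eta> < 1" shows "\<exists>s. sum_cdf s = \<eta>"
proof -
  have "eventually (\<lambda>s. sum_cdf s < \<eta>) at_bot"
    using sum.cdf_lim_at_bot assms unfolding sum_cdf_def by (intro order_tendstoD)
  then obtain a where a: "sum_cdf a < \<eta>" by (metis eventually_happens trivial_limit_at_bot_linorder)
  have "eventually (\<lambda>s. \<eta> < sum_cdf s) at_top"
    using sum.cdf_lim_at_top_prob assms unfolding sum_cdf_def by (intro order_tendstoD)
  then obtain b where b: "\<eta> < sum_cdf b" by (metis eventually_happens trivial_limit_at_top_linorder)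
  have "a \<le> b" using a b sum_cdf_mono[of b a] by linarith
  then show ?thesis
    using IVT[of sum_cdf a \<eta> b] a b isCont_sum_cdf by auto
qed

text \<open>The probability integral transform, by comparison of distribution functions. It replaces
  a change of variables when the mass of the order statistic density is reduced to the Beta
  integral.\<close>

lemma distr_sum_cdf_uniform: "distr sum_law borel sum_cdf = uniform_measure lborel {0..1}"
proof (rule cdf_unique)
  show 1: "real_distribution (distr sum_law borel sum_cdf)"
    by (intro sum.real_distribution_distr) (simp add: sum_law_def)
  show 2: "real_distribution (uniform_measure lborel {0..1})"
    by (intro real_distribution.intro real_distribution_axioms.intro prob_space_uniform_measure) auto
  show "cdf (distr sum_law borel sum_cdf) = cdf (uniform_measure lborel {0..1})"
  proof
    fix u :: real
    have L: "cdf (distr sum_law borel sum_cdf) u = measure sum_law {s. sum_cdf s \<le> u}"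
      unfolding cdf_def by (subst measure_distr) (auto simp: vimage_def sum_law_def)
    have R: "cdf (uniform_measure lborel {0..1}) u = measure lborel ({0..1} \<inter> {..u})"
      unfolding cdf_def by (subst measure_uniform_measure) auto
    consider "u \<le> 0" | "0 < u" "u < 1" | "1 \<le> u" by linarith
    then show "cdf (distr sum_law borel sum_cdf) u = cdf (uniform_measure lborel {0..1}) u"
    proof cases
      case 1
      \<comment> \<open>The value 0 is not attained either: at \<open>s - 1\<close> the function is
        nonnegative and strictly smaller than at \<open>s\<close>.\<close>
      have "u < sum_cdf s" for s
        using 1 strict_monoD[OF sum_cdf_strict_mono, of "s - 1" s] sum_cdf_nonneg[of "s - 1"] by simp
      then have "{s. sum_cdf s \<le> u} = {}" by (auto simp: not_le)
      moreover have "{0..1} \<inter> {..u} = (if u = 0 then {0} else {})" using 1 by auto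
      ultimately show ?thesis unfolding L R by simp
    next
      case 2
      then obtain t where t: "sum_cdf t = u" using sum_cdf_surj by blast
      then have "{s. sum_cdf s \<le> u} = {..t}"
        using strict_mono_less_eq[OF sum_cdf_strict_mono] by auto
      moreover have "{0..1} \<inter> {..u} = {0..u}" using 2 by auto
      ultimately show ?thesis unfolding L R using t 2 by (simp add: sum_cdf_def cdf_def)
    next
      case 3
      then have "{s. sum_cdf s \<le> u} = space sum_law" using sum_cdf_le_1 order_trans by (auto simp: sum_law_def)
      moreover have "{0..1} \<inter> {..u} = {0..1}" using 3 by auto
      ultimately show ?thesis unfolding L R using sum.prob_space by simp
    qed
  qed
qed

lemma order_stat_density_mass:
  assumes "1 \<le> k" "k \<le> n"
  shows "(\<integral>\<^sup>+s. ennreal (sum_density s) * ennreal (order_stat_kernel n k (sum_cdf s)) \<partial>lborel) = 1"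
proof -
  have "(\<integral>\<^sup>+s. ennreal (sum_density s) * ennreal (order_stat_kernel n k (sum_cdf s)) \<partial>lborel) =
    (\<integral>\<^sup>+s. ennreal (order_stat_kernel n k (sum_cdf s)) \<partial>sum_law)"
    unfolding sum_law_def by (subst nn_integral_density) auto
  also have "\<dots> = (\<integral>\<^sup>+u. ennreal (order_stat_kernel n k u) \<partial>distr sum_law borel sum_cdf)"
    by (subst nn_integral_distr) (auto simp: sum_law_def)
  also have "\<dots> = (\<integral>\<^sup>+u. ennreal (order_stat_kernel n k u) * indicator {0..1} u \<partial>lborel)"
    unfolding distr_sum_cdf_uniform by (subst nn_integral_uniform_measure) (auto simp: divide_ennreal_def)
  finally show ?thesis using nn_integral_order_stat_kernel[OF assms] by simp
qed

end

section \<open>Passage to the limit\<close>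

locale order_stat_limit = addend_densities +
  fixes \<eta> \<beta> :: real and k :: "nat \<Rightarrow> nat"
  assumes \<eta>_pos: "0 < \<eta>" and \<eta>_less_1: "\<eta> < 1" and k_bounds: "n \<ge> 1 \<Longrightarrow> 1 \<le> k n \<and> k n \<le> n"
    and k_lim: "(\<lambda>n. real (k n) / real n) \<longlonglongrightarrow> \<eta>" and \<beta>: "sum_cdf \<beta> = \<eta>"
begin

text \<open>The density of the \<open>k n\<close>-th smallest sum relative to the law of a single
  sum: it is \<open>sum_density s * K n s\<close> that has mass 1.\<close>

definition K :: "nat \<Rightarrow> real \<Rightarrow> real" where
  "K n s = order_stat_kernel n (k n) (sum_cdf s)"

definition limit_density :: "real \<Rightarrow> real" where
  "limit_density x = g (\<beta> - x) / sum_density \<beta> * f x"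

lemma K_measurable[measurable]: "K n \<in> borel_measurable borel"
  unfolding K_def[abs_def] by measurable

lemma limit_density_measurable[measurable]: "limit_density \<in> borel_measurable borel"
  unfolding limit_density_def[abs_def] by measurable

lemma limit_density_nonneg: "0 \<le> limit_density x"
  using g_nonneg f_pos[of x] sum_density_pos[of \<beta>] by (simp add: limit_density_def less_imp_le)

lemma limit_density_mult: "limit_density x * sum_density \<beta> = f x * g (\<beta> - x)"
  using sum_density_pos[of \<beta>] by (simp add: limit_density_def)

lemma limit_density_mass: "(\<integral>\<^sup>+x. ennreal (limit_density x) \<partial>lborel) = 1"
proof -
  have "ennreal (sum_density \<beta>) * (\<integral>\<^sup>+x. ennreal (limit_density x) \<partial>lborel) = (\<integral>\<^sup>+x. ennreal (f x * g (\<beta> - x)) \<partial>lborel)"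
    unfolding limit_density_mult[symmetric] using limit_density_nonneg sum_density_nonneg
    by (subst nn_integral_cmult[symmetric]) (auto simp: ennreal_mult mult.commute)
  then have "ennreal (sum_density \<beta>) * (\<integral>\<^sup>+x. ennreal (limit_density x) \<partial>lborel) = ennreal (sum_density \<beta>) * 1"
    by (simp add: nn_integral_sum_density)
  then show ?thesis using sum_density_pos[of \<beta>] by (subst (asm) ennreal_mult_cancel_left) auto
qed

lemma K_mass: "n \<ge> 1 \<Longrightarrow> (\<integral>\<^sup>+s. ennreal (sum_density s) * ennreal (K n s) \<partial>lborel) = 1"
  unfolding K_def using order_stat_density_mass k_bounds by blast

text \<open>Strict monotonicity of the distribution function turns distance from \<beta> into a
  uniform distance of \<open>sum_cdf s\<close> from \<eta>.\<close>

lemma K_small_away: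
  assumes "\<delta> > 0" "e > 0"
  shows "eventually (\<lambda>n. \<forall>s. \<bar>s - \<beta>\<bar> \<ge> \<delta> \<longrightarrow> K n s \<le> e) sequentially"
proof -
  define e' where "e' = min (sum_cdf (\<beta> + \<delta>) - \<eta>) (\<eta> - sum_cdf (\<beta> - \<delta>))"
  have "e' > 0"
    using assms strict_monoD[OF sum_cdf_strict_mono, of \<beta> "\<beta> + \<delta>"] strict_monoD[OF sum_cdf_strict_mono, of "\<beta> - \<delta>" \<beta>]
    by (simp add: e'_def \<beta>)
  have sep: "e' \<le> \<bar>sum_cdf s - \<eta>\<bar>" if "\<bar>s - \<beta>\<bar> \<ge> \<delta>" for s
  proof (cases "s \<ge> \<beta>")
    case True
    then have "sum_cdf (\<beta> + \<delta>) \<le> sum_cdf s" using that by (intro sum_cdf_mono) auto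
    then show ?thesis by (simp add: e'_def)
  next
    case False
    then have "sum_cdf s \<le> sum_cdf (\<beta> - \<delta>)" using that by (intro sum_cdf_mono) auto
    then show ?thesis by (simp add: e'_def)
  qed
  have "eventually (\<lambda>n. \<forall>u\<in>{0..1}. \<bar>u - \<eta>\<bar> \<ge> e' \<longrightarrow> order_stat_kernel n (k n) u \<le> e) sequentially"
    by (rule order_stat_kernel_tendsto_0_away[OF \<eta>_pos \<eta>_less_1 _ k_lim \<open>e' > 0\<close> assms(2)]) (rule k_bounds)
  then show ?thesis
    by eventually_elim (use sep sum_cdf_nonneg sum_cdf_le_1 in \<open>auto simp: K_def\<close>)
qed

lemma K_integral_tendsto_0_continuous:
  fixes a :: "real \<Rightarrow> ennreal"
  assumes "a \<in> borel_measurable borel" "(\<integral>\<^sup>+s. a s \<partial>lborel) < \<infinity>" "(a \<longlongrightarrow> 0) (nhds \<beta>)"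
  shows "(\<lambda>n. \<integral>\<^sup>+s. a s * ennreal (K n s) \<partial>lborel) \<longlonglongrightarrow> 0"
proof (rule kernel_integral_tendsto_0_continuous[OF assms(1) K_measurable assms(2) K_small_away sum_density_measurable
    sum_density_pos isCont_sum_density _ assms(3)])
  show "eventually (\<lambda>n. (\<integral>\<^sup>+s. ennreal (sum_density s) * ennreal (K n s) \<partial>lborel) \<le> 1) sequentially"
    using eventually_ge_at_top[of 1] by eventually_elim (simp add: K_mass)
qed

text \<open>Near \<beta> the density stays above half its value there, so \<open>sum_cdf\<close>
  moves away from \<eta> at least linearly, and the bell in \<open>u\<close> around \<eta> becomes a
  bell in \<open>s\<close> around \<beta>.\<close>

lemma K_integral_tendsto_0_lebesgue_point:
  fixes a :: "real \<Rightarrow> ennreal"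
  assumes "a \<in> borel_measurable borel" "(\<integral>\<^sup>+s. a s \<partial>lborel) < \<infinity>"
    and a: "\<And>e. e > 0 \<Longrightarrow> \<exists>\<delta>>0. \<forall>r. 0 < r \<and> r < \<delta> \<longrightarrow> (\<integral>\<^sup>+s. a s * indicator (cball \<beta> r) s \<partial>lborel) \<le> ennreal (e * r)"
    and bigo: "(\<lambda>n. real (k n) - \<eta> * real n) \<in> O(\<lambda>n. sqrt (real n))"
  shows "(\<lambda>n. \<integral>\<^sup>+s. a s * ennreal (K n s) \<partial>lborel) \<longlonglongrightarrow> 0"
proof -
  obtain C where C: "C > 0"
    "eventually (\<lambda>n. \<forall>u\<in>{0..1}. order_stat_kernel n (k n) u \<le> C * sqrt (real n) / (1 + real n * (u - \<eta>)\<^sup>2)) sequentially"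
    using order_stat_kernel_bell_bound[OF \<eta>_pos \<eta>_less_1 k_bounds k_lim bigo] by blast
  define c where "c = sum_density \<beta> / 2"
  have c: "c > 0" using sum_density_pos by (simp add: c_def)
  have "eventually (\<lambda>s. sum_density s > c) (nhds \<beta>)"
    using isCont_sum_density[of \<beta>] sum_density_pos[of \<beta>]
    by (intro order_tendstoD(1)[of sum_density "sum_density \<beta>"]) (auto simp: c_def isCont_def tendsto_at_iff_tendsto_nhds)
  then obtain d where d: "d > 0" "\<And>s. dist s \<beta> < d \<Longrightarrow> c < sum_density s"
    by (auto simp: eventually_nhds_metric)
  have c_le: "c \<le> sum_density t" if "\<bar>t - \<beta>\<bar> \<le> d / 2" for t
    using d(2)[of t] that d(1) by (simp add: dist_real_def less_imp_le)
  have sep: "c * \<bar>s - \<beta>\<bar> \<le> \<bar>sum_cdf s - \<eta>\<bar>" if "\<bar>s - \<beta>\<bar> \<le> d / 2" for s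
  proof (cases "s \<ge> \<beta>")
    case True
    then have "c * (s - \<beta>) \<le> sum_cdf s - sum_cdf \<beta>"
      using that c by (intro sum_cdf_diff_ge c_le) auto
    then show ?thesis using True \<beta> by simp
  next
    case False
    then have "c * (\<beta> - s) \<le> sum_cdf \<beta> - sum_cdf s"
      using that c by (intro sum_cdf_diff_ge c_le) auto
    then show ?thesis using False \<beta> by simp
  qed
  show ?thesis
  proof (rule kernel_integral_tendsto_0_lebesgue_point[OF assms(1) K_measurable assms(2) K_small_away C(1) c _ _ a])
    show "eventually (\<lambda>n. \<forall>s. \<bar>s - \<beta>\<bar> \<le> d / 2 \<longrightarrow> K n s \<le> C * sqrt (real n) / (1 + real n * (c * (s - \<beta>))\<^sup>2)) sequentially"
      using C(2)
    proof eventually_elim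
      case (elim n)
      show ?case
      proof (intro allI impI)
        fix s assume s: "\<bar>s - \<beta>\<bar> \<le> d / 2"
        have "\<bar>c * (s - \<beta>)\<bar> \<le> \<bar>sum_cdf s - \<eta>\<bar>" using sep[OF s] c by (simp add: abs_mult)
        then have "(c * (s - \<beta>))\<^sup>2 \<le> (sum_cdf s - \<eta>)\<^sup>2" by (rule abs_le_square_iff[THEN iffD1])
        then have le: "1 + real n * (c * (s - \<beta>))\<^sup>2 \<le> 1 + real n * (sum_cdf s - \<eta>)\<^sup>2" by (simp add: mult_left_mono)
        have "K n s \<le> C * sqrt (real n) / (1 + real n * (sum_cdf s - \<eta>)\<^sup>2)"
          using elim sum_cdf_nonneg sum_cdf_le_1 by (auto simp: K_def)
        also have "\<dots> \<le> C * sqrt (real n) / (1 + real n * (c * (s - \<beta>))\<^sup>2)"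
          using le C(1) by (intro divide_left_mono) (auto intro!: mult_pos_pos add_pos_nonneg)
        finally show "K n s \<le> C * sqrt (real n) / (1 + real n * (c * (s - \<beta>))\<^sup>2)" .
      qed
    qed
  qed (use d in auto)
qed

text \<open>Because \<open>sum_density * K n\<close> has mass 1, the constant
  \<open>limit_density x\<close> can be written as an integral against the same kernel and
  subtracted under the integral. The resulting integrand vanishes at \<open>s = \<beta>\<close> by
  the choice of \<open>limit_density\<close>.\<close>

lemma density_minus_limit_le:
  assumes n: "n \<ge> 1" and y: "0 \<le> y" "ennreal y = (\<integral>\<^sup>+s. ennreal (f x * g (s - x)) * ennreal (K n s) \<partial>lborel)"
  shows "ennreal \<bar>y - limit_density x\<bar> \<le>
    (\<integral>\<^sup>+s. ennreal \<bar>f x * g (s - x) - limit_density x * sum_density s\<bar> * ennreal (K n s) \<partial>lborel)"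
proof -
  let ?p = "limit_density x"
  let ?D = "\<integral>\<^sup>+s. ennreal \<bar>f x * g (s - x) - ?p * sum_density s\<bar> * ennreal (K n s) \<partial>lborel"
  have p: "ennreal ?p = (\<integral>\<^sup>+s. ennreal (?p * sum_density s) * ennreal (K n s) \<partial>lborel)"
  proof -
    have "(\<integral>\<^sup>+s. ennreal (?p * sum_density s) * ennreal (K n s) \<partial>lborel) =
      (\<integral>\<^sup>+s. ennreal ?p * (ennreal (sum_density s) * ennreal (K n s)) \<partial>lborel)"
      using limit_density_nonneg sum_density_nonneg by (simp add: ennreal_mult mult.assoc)
    also have "\<dots> = ennreal ?p * 1"
      using K_mass[OF n] by (subst nn_integral_cmult) auto
    finally show ?thesis by simp
  qed
  have tri: "(\<integral>\<^sup>+s. ennreal (u s) * ennreal (K n s) \<partial>lborel) \<le>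
      (\<integral>\<^sup>+s. ennreal (v s) * ennreal (K n s) \<partial>lborel) + (\<integral>\<^sup>+s. ennreal \<bar>u s - v s\<bar> * ennreal (K n s) \<partial>lborel)"
    if [measurable]: "u \<in> borel_measurable borel" "v \<in> borel_measurable borel" and v: "\<And>s. 0 \<le> v s" for u v
  proof -
    have "ennreal (u s) * ennreal (K n s) \<le> ennreal (v s) * ennreal (K n s) + ennreal \<bar>u s - v s\<bar> * ennreal (K n s)" for s
    proof -
      have "ennreal (u s) \<le> ennreal (v s) + ennreal \<bar>u s - v s\<bar>"
        using v[of s] by (subst ennreal_plus[symmetric]) (auto intro!: ennreal_leI simp del: ennreal_plus)
      then show ?thesis unfolding distrib_right[symmetric] by (intro mult_right_mono) auto
    qed
    then show ?thesis by (subst nn_integral_add[symmetric]) (auto intro!: nn_integral_mono)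
  qed
  have nonneg: "0 \<le> f x * g (s - x)" "0 \<le> ?p * sum_density s" for s
    using f_pos[of x] g_nonneg limit_density_nonneg sum_density_nonneg by (auto simp: less_imp_le)
  show ?thesis
  proof (rule ennreal_abs_diff_le[OF y(1) limit_density_nonneg])
    show "ennreal y \<le> ennreal ?p + ?D"
      unfolding y(2) p by (rule tri) (use nonneg in auto)
    show "ennreal ?p \<le> ennreal y + ?D"
      unfolding y(2) p using tri[of "\<lambda>s. ?p * sum_density s" "\<lambda>s. f x * g (s - x)"] nonneg
      by (simp add: abs_minus_commute)
  qed
qed

lemma pointwise_deviation_finite:
  "(\<integral>\<^sup>+s. ennreal \<bar>f x * g (s - x) - limit_density x * sum_density s\<bar> \<partial>lborel) < \<infinity>"
proof -
  have "(\<integral>\<^sup>+s. ennreal \<bar>f x * g (s - x) - limit_density x * sum_density s\<bar> \<partial>lborel) \<le>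
    (\<integral>\<^sup>+s. ennreal (f x) * ennreal (g (s - x)) + ennreal (limit_density x) * ennreal (sum_density s) \<partial>lborel)"
  proof (intro nn_integral_mono)
    fix s
    have "0 \<le> f x * g (s - x)" "0 \<le> limit_density x * sum_density s"
      using f_pos[of x] g_nonneg limit_density_nonneg sum_density_nonneg by (auto simp: less_imp_le)
    then have "ennreal \<bar>f x * g (s - x) - limit_density x * sum_density s\<bar> \<le> ennreal (f x * g (s - x)) + ennreal (limit_density x * sum_density s)"
      by (subst ennreal_plus[symmetric]) (auto intro!: ennreal_leI simp del: ennreal_plus)
    then show "ennreal \<bar>f x * g (s - x) - limit_density x * sum_density s\<bar> \<le>
      ennreal (f x) * ennreal (g (s - x)) + ennreal (limit_density x) * ennreal (sum_density s)"
      using f_pos[of x] g_nonneg limit_density_nonneg sum_density_nonneg by (simp add: ennreal_mult less_imp_le)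
  qed
  also have "\<dots> = ennreal (f x) * 1 + ennreal (limit_density x) * 1"
    using nn_integral_shift[of "\<lambda>s. ennreal (g s)" x]
    by (subst nn_integral_add) (auto simp: nn_integral_cmult g_mass sum_density_mass)
  also have "\<dots> < \<infinity>" by (simp add: less_top[symmetric])
  finally show ?thesis .
qed

lemma pointwise_limit_continuous:
  assumes "isCont g (\<beta> - x)"
  shows "(\<lambda>n. \<integral>\<^sup>+s. ennreal \<bar>f x * g (s - x) - limit_density x * sum_density s\<bar> * ennreal (K n s) \<partial>lborel) \<longlonglongrightarrow> 0"
proof (rule K_integral_tendsto_0_continuous[OF _ pointwise_deviation_finite])
  have "isCont (\<lambda>s. g (s - x)) \<beta>"
    by (rule isCont_o2[where f = "\<lambda>s. s - x"]) (use assms in auto)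
  then have "isCont (\<lambda>s. \<bar>f x * g (s - x) - limit_density x * sum_density s\<bar>) \<beta>"
    using isCont_sum_density by (intro continuous_intros)
  then have "((\<lambda>s. ennreal \<bar>f x * g (s - x) - limit_density x * sum_density s\<bar>) \<longlongrightarrow>
    ennreal \<bar>f x * g (\<beta> - x) - limit_density x * sum_density \<beta>\<bar>) (nhds \<beta>)"
    by (intro tendsto_ennrealI) (rule isCont_imp_tendsto_nhds)
  then show "((\<lambda>s. ennreal \<bar>f x * g (s - x) - limit_density x * sum_density s\<bar>) \<longlongrightarrow> 0) (nhds \<beta>)"
    by (simp add: limit_density_mult)
qed measurable

lemma pointwise_limit_lebesgue_point:
  assumes bigo: "(\<lambda>n. real (k n) - \<eta> * real n) \<in> O(\<lambda>n. sqrt (real n))"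
    and leb: "\<And>e. e > 0 \<Longrightarrow> \<exists>d>0. \<forall>r. 0 < r \<and> r < d \<longrightarrow>
      (\<integral>\<^sup>+s. ennreal \<bar>g s - g (\<beta> - x)\<bar> * indicator (cball (\<beta> - x) r) s \<partial>lborel) \<le> ennreal (e * r)"
  shows "(\<lambda>n. \<integral>\<^sup>+s. ennreal \<bar>f x * g (s - x) - limit_density x * sum_density s\<bar> * ennreal (K n s) \<partial>lborel) \<longlonglongrightarrow> 0"
proof (rule K_integral_tendsto_0_lebesgue_point[OF _ pointwise_deviation_finite _ bigo])
  fix e :: real assume e: "e > 0"
  let ?p = "limit_density x"
  have p: "?p \<ge> 0" by (rule limit_density_nonneg)
  \<comment> \<open>Each source of error gets half of \<open>e * r\<close>: the oscillation of
    \<open>g\<close> contributes \<open>f x * e1 * r\<close>, and that of the sum density at most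
    \<open>e / 4\<close> on an interval of length \<open>2 * r\<close>.\<close>
  define e1 where "e1 = e / (2 * f x)"
  define e2 where "e2 = e / (4 * (?p + 1))"
  have e12: "e1 > 0" "e2 > 0" "f x * e1 = e / 2" using e f_pos[of x] p by (auto simp: e1_def e2_def)
  have pe2: "?p * e2 \<le> e / 4" using e p by (simp add: e2_def field_simps)
  obtain d1 where d1: "d1 > 0" "\<And>r. 0 < r \<Longrightarrow> r < d1 \<Longrightarrow>
      (\<integral>\<^sup>+s. ennreal \<bar>g s - g (\<beta> - x)\<bar> * indicator (cball (\<beta> - x) r) s \<partial>lborel) \<le> ennreal (e1 * r)"
    using leb[OF e12(1)] by auto
  have "eventually (\<lambda>s. dist (sum_density s) (sum_density \<beta>) < e2) (nhds \<beta>)"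
    using isCont_sum_density[of \<beta>] e12 by (intro tendstoD) (auto simp: isCont_def tendsto_at_iff_tendsto_nhds)
  then obtain d2 where d2: "d2 > 0" "\<And>s. dist s \<beta> < d2 \<Longrightarrow> \<bar>sum_density s - sum_density \<beta>\<bar> < e2"
    by (auto simp: eventually_nhds_metric dist_real_def)
  show "\<exists>\<delta>>0. \<forall>r. 0 < r \<and> r < \<delta> \<longrightarrow>
    (\<integral>\<^sup>+s. ennreal \<bar>f x * g (s - x) - ?p * sum_density s\<bar> * indicator (cball \<beta> r) s \<partial>lborel) \<le> ennreal (e * r)"
  proof (intro exI[of _ "min d1 d2"] conjI allI impI)
    fix r assume r: "0 < r \<and> r < min d1 d2"
    define u where "u s = ennreal \<bar>g s - g (\<beta> - x)\<bar> * indicator (cball (\<beta> - x) r) s" for s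
    have [measurable]: "u \<in> borel_measurable borel" unfolding u_def[abs_def] by measurable
    have "(\<integral>\<^sup>+s. ennreal \<bar>f x * g (s - x) - ?p * sum_density s\<bar> * indicator (cball \<beta> r) s \<partial>lborel) \<le>
      (\<integral>\<^sup>+s. ennreal (f x) * u (s - x) + ennreal (e / 4) * indicator (cball \<beta> r) s \<partial>lborel)"
    proof (intro nn_integral_mono)
      fix s
      show "ennreal \<bar>f x * g (s - x) - ?p * sum_density s\<bar> * indicator (cball \<beta> r) s \<le>
        ennreal (f x) * u (s - x) + ennreal (e / 4) * indicator (cball \<beta> r) s"
      proof (cases "s \<in> cball \<beta> r")
        case True
        then have sx: "s - x \<in> cball (\<beta> - x) r" by (simp add: dist_real_def)
        have "dist s \<beta> < d2" using True r by (simp add: dist_commute)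
        then have "\<bar>sum_density s - sum_density \<beta>\<bar> \<le> e2" using d2 less_imp_le by blast
        then have "?p * \<bar>sum_density s - sum_density \<beta>\<bar> \<le> ?p * e2" using p by (rule mult_left_mono)
        then have 1: "\<bar>?p * sum_density s - ?p * sum_density \<beta>\<bar> \<le> e / 4"
          using pe2 p by (simp add: right_diff_distrib[symmetric] abs_mult)
        have 2: "\<bar>f x * g (s - x) - f x * g (\<beta> - x)\<bar> = f x * \<bar>g (s - x) - g (\<beta> - x)\<bar>"
          using f_pos[of x] by (simp add: right_diff_distrib[symmetric] abs_mult)
        have "\<bar>f x * g (s - x) - ?p * sum_density s\<bar> \<le> f x * \<bar>g (s - x) - g (\<beta> - x)\<bar> + e / 4"
          using 1 2 limit_density_mult[of x] by linarith
        then have "ennreal \<bar>f x * g (s - x) - ?p * sum_density s\<bar> \<le> ennreal (f x * \<bar>g (s - x) - g (\<beta> - x)\<bar>) + ennreal (e / 4)"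
          using e f_pos[of x] by (subst ennreal_plus[symmetric]) (auto intro!: ennreal_leI simp: less_imp_le simp del: ennreal_plus)
        then show ?thesis using True sx f_pos[of x] by (simp add: u_def ennreal_mult less_imp_le)
      qed simp
    qed
    also have "\<dots> = ennreal (f x) * (\<integral>\<^sup>+s. u s \<partial>lborel) + ennreal (e / 4) * ennreal (2 * r)"
      using r nn_integral_shift[of u x]
      by (subst nn_integral_add) (auto simp: nn_integral_cmult cball_eq_atLeastAtMost)
    also have "\<dots> \<le> ennreal (f x) * ennreal (e1 * r) + ennreal (e / 4) * ennreal (2 * r)"
      using d1(2)[of r] r by (intro add_mono mult_left_mono) (auto simp: u_def)
    also have "\<dots> = ennreal (f x * e1 * r + e / 4 * (2 * r))"
      using e e12 r f_pos[of x] by (simp add: ennreal_mult[symmetric] ennreal_plus[symmetric] less_imp_le mult.assoc del: ennreal_plus)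
    also have "f x * e1 * r + e / 4 * (2 * r) = e * r" unfolding e12(3) by simp
    finally show "(\<integral>\<^sup>+s. ennreal \<bar>f x * g (s - x) - ?p * sum_density s\<bar> * indicator (cball \<beta> r) s \<partial>lborel) \<le> ennreal (e * r)" .
  qed (use d1 d2 in auto)
qed measurable

text \<open>By Fubini the L1 error is bounded by the kernel integral of this function. It tends to 0
  at \<beta> even where \<open>g\<close> is discontinuous, so the continuous version of the kernel
  lemma applies.\<close>

definition L1_deviation :: "real \<Rightarrow> ennreal" where
  "L1_deviation s = (\<integral>\<^sup>+x. ennreal \<bar>f x * g (s - x) - limit_density x * sum_density s\<bar> \<partial>lborel)"

lemma L1_deviation_measurable[measurable]: "L1_deviation \<in> borel_measurable borel"
  unfolding L1_deviation_def[abs_def] by measurable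

lemma L1_deviation_finite: "(\<integral>\<^sup>+s. L1_deviation s \<partial>lborel) < \<infinity>"
proof -
  have "L1_deviation s \<le> ennreal (2 * sum_density s)" for s
  proof -
    have "L1_deviation s \<le> (\<integral>\<^sup>+x. ennreal (f x * g (s - x)) + ennreal (sum_density s) * ennreal (limit_density x) \<partial>lborel)"
      unfolding L1_deviation_def
    proof (intro nn_integral_mono)
      fix x
      have "0 \<le> f x * g (s - x)" "0 \<le> limit_density x * sum_density s"
        using f_pos[of x] g_nonneg limit_density_nonneg sum_density_nonneg by (auto simp: less_imp_le)
      then have "ennreal \<bar>f x * g (s - x) - limit_density x * sum_density s\<bar> \<le> ennreal (f x * g (s - x)) + ennreal (limit_density x * sum_density s)"
        by (subst ennreal_plus[symmetric]) (auto intro!: ennreal_leI simp del: ennreal_plus)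
      then show "ennreal \<bar>f x * g (s - x) - limit_density x * sum_density s\<bar> \<le>
        ennreal (f x * g (s - x)) + ennreal (sum_density s) * ennreal (limit_density x)"
        using limit_density_nonneg sum_density_nonneg by (simp add: ennreal_mult mult.commute)
    qed
    also have "\<dots> = ennreal (sum_density s) + ennreal (sum_density s) * 1"
      by (subst nn_integral_add) (auto simp: nn_integral_cmult limit_density_mass nn_integral_sum_density)
    also have "\<dots> = ennreal (2 * sum_density s)"
      using sum_density_nonneg[of s] by (simp add: ennreal_plus[symmetric] del: ennreal_plus)
    finally show ?thesis .
  qed
  then have "(\<integral>\<^sup>+s. L1_deviation s \<partial>lborel) \<le> (\<integral>\<^sup>+s. ennreal 2 * ennreal (sum_density s) \<partial>lborel)"
    using sum_density_nonneg by (intro nn_integral_mono) (simp add: ennreal_mult)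
  also have "\<dots> = ennreal 2 * 1" by (subst nn_integral_cmult) (auto simp: sum_density_mass)
  also have "\<dots> < \<infinity>" by (simp add: less_top[symmetric])
  finally show ?thesis .
qed

lemma L1_deviation_tendsto_0: "(L1_deviation \<longlongrightarrow> 0) (nhds \<beta>)"
proof -
  have bound: "L1_deviation s \<le> ennreal B * (\<integral>\<^sup>+x. ennreal \<bar>g (s - x) - g (\<beta> - x)\<bar> \<partial>lborel) + ennreal \<bar>sum_density \<beta> - sum_density s\<bar>" for s
  proof -
    \<comment> \<open>The intermediate term \<open>f x * g (\<beta> - x)\<close> equals
      \<open>limit_density x * sum_density \<beta>\<close>: one difference is then a translation
      error, the other a multiple of \<open>limit_density\<close>, which has mass 1.\<close>
    have "L1_deviation s \<le> (\<integral>\<^sup>+x. ennreal \<bar>f x * g (s - x) - f x * g (\<beta> - x)\<bar> \<partial>lborel) +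
      (\<integral>\<^sup>+x. ennreal \<bar>f x * g (\<beta> - x) - limit_density x * sum_density s\<bar> \<partial>lborel)"
      unfolding L1_deviation_def by (rule nn_integral_diff_triangle) measurable
    also have "(\<integral>\<^sup>+x. ennreal \<bar>f x * g (\<beta> - x) - limit_density x * sum_density s\<bar> \<partial>lborel) =
      (\<integral>\<^sup>+x. ennreal \<bar>sum_density \<beta> - sum_density s\<bar> * ennreal (limit_density x) \<partial>lborel)"
    proof (intro nn_integral_cong)
      fix x
      have "\<bar>f x * g (\<beta> - x) - limit_density x * sum_density s\<bar> = \<bar>sum_density \<beta> - sum_density s\<bar> * limit_density x"
        unfolding limit_density_mult[symmetric] right_diff_distrib[symmetric]
        using limit_density_nonneg[of x] by (simp add: abs_mult mult.commute)
      then show "ennreal \<bar>f x * g (\<beta> - x) - limit_density x * sum_density s\<bar> = ennreal \<bar>sum_density \<beta> - sum_density s\<bar> * ennreal (limit_density x)"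
        using limit_density_nonneg by (simp add: ennreal_mult)
    qed
    also have "\<dots> = ennreal \<bar>sum_density \<beta> - sum_density s\<bar>"
      by (simp add: nn_integral_cmult limit_density_mass)
    finally show ?thesis using L1_diff_bound[of s \<beta>] by (meson add_right_mono order_trans)
  qed
  have "((\<lambda>s. \<bar>sum_density \<beta> - sum_density s\<bar>) \<longlongrightarrow> \<bar>sum_density \<beta> - sum_density \<beta>\<bar>) (nhds \<beta>)"
    using isCont_sum_density[of \<beta>] by (intro tendsto_intros) (simp add: isCont_def tendsto_at_iff_tendsto_nhds)
  then have "((\<lambda>s. ennreal B * (\<integral>\<^sup>+x. ennreal \<bar>g (s - x) - g (\<beta> - x)\<bar> \<partial>lborel) + ennreal \<bar>sum_density \<beta> - sum_density s\<bar>) \<longlongrightarrow>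
    ennreal B * 0 + ennreal \<bar>sum_density \<beta> - sum_density \<beta>\<bar>) (nhds \<beta>)"
    by (intro tendsto_add tendsto_mult_ennreal L1_shift_tendsto_0 tendsto_const tendsto_ennrealI) auto
  then have upper: "((\<lambda>s. ennreal B * (\<integral>\<^sup>+x. ennreal \<bar>g (s - x) - g (\<beta> - x)\<bar> \<partial>lborel) + ennreal \<bar>sum_density \<beta> - sum_density s\<bar>) \<longlongrightarrow> 0) (nhds \<beta>)"
    by simp
  show ?thesis
    by (rule tendsto_sandwich[OF _ _ tendsto_const upper]) (use bound in \<open>simp_all add: always_eventually\<close>)
qed

lemma L1_limit:
  assumes F_nonneg: "\<And>n x. n \<ge> 1 \<Longrightarrow> 0 \<le> F n x"
    and F: "\<And>n. n \<ge> 1 \<Longrightarrow> AE x in lborel. ennreal (F n x) = (\<integral>\<^sup>+s. ennreal (f x * g (s - x)) * ennreal (K n s) \<partial>lborel)"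
  shows "(\<lambda>n. \<integral>\<^sup>+x. ennreal \<bar>F n x - limit_density x\<bar> \<partial>lborel) \<longlonglongrightarrow> 0"
proof (rule tendsto_sandwich[OF _ _ tendsto_const])
  show "(\<lambda>n. \<integral>\<^sup>+s. L1_deviation s * ennreal (K n s) \<partial>lborel) \<longlonglongrightarrow> 0"
    by (rule K_integral_tendsto_0_continuous[OF L1_deviation_measurable L1_deviation_finite L1_deviation_tendsto_0])
  show "eventually (\<lambda>n. (\<integral>\<^sup>+x. ennreal \<bar>F n x - limit_density x\<bar> \<partial>lborel) \<le> (\<integral>\<^sup>+s. L1_deviation s * ennreal (K n s) \<partial>lborel)) sequentially"
    using eventually_ge_at_top[of 1]
  proof eventually_elim
    case (elim n)
    have "(\<integral>\<^sup>+x. ennreal \<bar>F n x - limit_density x\<bar> \<partial>lborel) \<le>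
      (\<integral>\<^sup>+x. (\<integral>\<^sup>+s. ennreal \<bar>f x * g (s - x) - limit_density x * sum_density s\<bar> * ennreal (K n s) \<partial>lborel) \<partial>lborel)"
    proof (rule nn_integral_mono_AE)
      show "AE x in lborel. ennreal \<bar>F n x - limit_density x\<bar> \<le>
        (\<integral>\<^sup>+s. ennreal \<bar>f x * g (s - x) - limit_density x * sum_density s\<bar> * ennreal (K n s) \<partial>lborel)"
        using F[OF elim] by eventually_elim (rule density_minus_limit_le[OF elim F_nonneg[OF elim]])
    qed
    also have "\<dots> = (\<integral>\<^sup>+s. (\<integral>\<^sup>+x. ennreal \<bar>f x * g (s - x) - limit_density x * sum_density s\<bar> * ennreal (K n s) \<partial>lborel) \<partial>lborel)"
      by (rule nn_integral_joint_swap[symmetric]) measurable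
    also have "\<dots> = (\<integral>\<^sup>+s. L1_deviation s * ennreal (K n s) \<partial>lborel)"
      unfolding L1_deviation_def by (intro nn_integral_cong nn_integral_multc) measurable
    finally show ?case .
  qed
qed simp

text \<open>The exceptional set is chosen before the case distinction: countably many null sets, one
  for each density \<open>F n\<close>, and the reflected set of points that are not Lebesgue points
  of \<open>g\<close>.\<close>

lemma AE_limit:
  assumes F_nonneg: "\<And>n x. n \<ge> 1 \<Longrightarrow> 0 \<le> F n x"
    and F: "\<And>n. n \<ge> 1 \<Longrightarrow> AE x in lborel. ennreal (F n x) = (\<integral>\<^sup>+s. ennreal (f x * g (s - x)) * ennreal (K n s) \<partial>lborel)"
  shows "AE x in lborel. isCont g (\<beta> - x) \<or> (\<lambda>n. real (k n) - \<eta> * real n) \<in> O(\<lambda>n. sqrt (real n)) \<longrightarrow>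
    (\<lambda>n. F n x) \<longlonglongrightarrow> limit_density x"
proof -
  have "AE x in lborel. \<forall>n. n \<ge> 1 \<longrightarrow> ennreal (F n x) = (\<integral>\<^sup>+s. ennreal (f x * g (s - x)) * ennreal (K n s) \<partial>lborel)"
    unfolding AE_all_countable using F by auto
  moreover have "AE x in lborel. \<forall>e>0. \<exists>d>0. \<forall>r. 0 < r \<and> r < d \<longrightarrow>
      (\<integral>\<^sup>+s. ennreal \<bar>g s - g (\<beta> - x)\<bar> * indicator (cball (\<beta> - x) r) s \<partial>lborel) \<le> ennreal (e * r)"
    by (rule AE_lborel_reflect[OF AE_lebesgue_point[OF integrable_g]])
  ultimately show ?thesis
  proof eventually_elim
    case (elim x)
    show ?case
    proof
      assume "isCont g (\<beta> - x) \<or> (\<lambda>n. real (k n) - \<eta> * real n) \<in> O(\<lambda>n. sqrt (real n))"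
      then have lim: "(\<lambda>n. \<integral>\<^sup>+s. ennreal \<bar>f x * g (s - x) - limit_density x * sum_density s\<bar> * ennreal (K n s) \<partial>lborel) \<longlonglongrightarrow> 0"
        using pointwise_limit_continuous[of x] pointwise_limit_lebesgue_point[of x] elim(2) by blast
      have "eventually (\<lambda>n. ennreal \<bar>F n x - limit_density x\<bar> \<le>
        (\<integral>\<^sup>+s. ennreal \<bar>f x * g (s - x) - limit_density x * sum_density s\<bar> * ennreal (K n s) \<partial>lborel)) sequentially"
        using eventually_ge_at_top[of 1] by eventually_elim (use density_minus_limit_le F_nonneg elim(1) in auto)
      then have "(\<lambda>n. ennreal \<bar>F n x - limit_density x\<bar>) \<longlonglongrightarrow> 0"
        by (intro tendsto_sandwich[OF _ _ tendsto_const lim]) auto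
      then have "(\<lambda>n. \<bar>F n x - limit_density x\<bar>) \<longlonglongrightarrow> 0"
        using tendsto_ennrealD[of "\<lambda>n. \<bar>F n x - limit_density x\<bar>" 0] by simp
      then show "(\<lambda>n. F n x) \<longlonglongrightarrow> limit_density x"
        using LIM_zero_cancel tendsto_rabs_zero_iff by blast
    qed
  qed
qed

end

section \<open>Densities of the given variables and of the first addend\<close>

lemma has_density_measurable: "has_density M X f \<Longrightarrow> X \<in> borel_measurable M"
  and has_density_density_measurable: "has_density M X f \<Longrightarrow> f \<in> borel_measurable borel"
  and has_density_nonneg: "has_density M X f \<Longrightarrow> 0 \<le> f x"
  by (auto simp: has_density_def distributed_real_measurable dest: distributed_measurable distributed_real_measurable[rotated])

lemma has_density_emeasure:
  assumes "has_density M X f" "A \<in> sets borel"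
  shows "emeasure M {\<omega>\<in>space M. X \<omega> \<in> A} = (\<integral>\<^sup>+x. ennreal (f x) * indicator A x \<partial>lborel)"
proof -
  have "{\<omega>\<in>space M. X \<omega> \<in> A} = X -` A \<inter> space M" by auto
  then show ?thesis using assms by (simp add: has_density_def distributed_emeasure)
qed

lemma has_density_mass:
  assumes "prob_space M" "has_density M X f"
  shows "(\<integral>\<^sup>+x. ennreal (f x) \<partial>lborel) = 1"
  using has_density_emeasure[OF assms(2), of UNIV] prob_space.emeasure_space_1[OF assms(1)] by simp

context addend_densities
begin

text \<open>The pair of first addend and full sum has joint density \<open>f x * g (s - x)\<close>:
  the product density of \<open>U\<close> and \<open>T\<close> after the substitution
  \<open>s = x + y\<close>.\<close>

lemma nn_integral_addend_and_sum:
  assumes M: "prob_space M" and U: "has_density M U f" and T: "has_density M T g"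
    and indep: "prob_space.indep_var M borel U borel T"
    and u[measurable]: "u \<in> borel_measurable (borel \<Otimes>\<^sub>M borel)"
  shows "(\<integral>\<^sup>+\<omega>. u (U \<omega>, U \<omega> + T \<omega>) \<partial>M) = (\<integral>\<^sup>+x. (\<integral>\<^sup>+s. ennreal (f x * g (s - x)) * u (x, s) \<partial>lborel) \<partial>lborel)"
proof -
  interpret M: prob_space M by fact
  have UT: "distributed M lborel U (\<lambda>x. ennreal (f x))" "distributed M lborel T (\<lambda>x. ennreal (g x))"
    using U T by (auto simp: has_density_def)
  \<comment> \<open>\<open>lborel\<close> and \<open>borel\<close> have the same measurable sets,
    which is all that matters for the target of \<open>distr\<close>; independence is phrased with
    one and joint densities with the other.\<close>
  have eq: "distr M lborel V = distr M borel V" for V :: "'a \<Rightarrow> real"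
    by (rule distr_cong) auto
  have eq2: "distr M (lborel \<Otimes>\<^sub>M lborel) V = distr M (borel \<Otimes>\<^sub>M borel) V" for V :: "'a \<Rightarrow> real \<times> real"
    by (rule distr_cong) (auto intro: sets_pair_measure_cong)
  have "distr M lborel U \<Otimes>\<^sub>M distr M lborel T = distr M (lborel \<Otimes>\<^sub>M lborel) (\<lambda>x. (U x, T x))"
    unfolding eq eq2 using indep by (simp add: M.indep_var_distribution_eq)
  then have "distributed M (lborel \<Otimes>\<^sub>M lborel) (\<lambda>x. (U x, T x)) (\<lambda>(x, y). ennreal (f x) * ennreal (g y))"
    by (intro M.distributed_joint_indep' UT) (auto intro: lborel.sigma_finite_measure_axioms)
  moreover have "(\<lambda>(x, y). u (x, x + y)) \<in> borel_measurable (lborel \<Otimes>\<^sub>M lborel)" by measurable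
  ultimately have "(\<integral>\<^sup>+\<omega>. u (U \<omega>, U \<omega> + T \<omega>) \<partial>M) =
    (\<integral>\<^sup>+z. (case z of (x, y) \<Rightarrow> ennreal (f x) * ennreal (g y)) * (case z of (x, y) \<Rightarrow> u (x, x + y)) \<partial>(lborel \<Otimes>\<^sub>M lborel))"
    by (subst distributed_nn_integral) auto
  also have "\<dots> = (\<integral>\<^sup>+x. (\<integral>\<^sup>+y. ennreal (f x * g y) * u (x, x + y) \<partial>lborel) \<partial>lborel)"
    using f_pos g_nonneg by (subst lborel.nn_integral_fst[symmetric]) (auto simp: ennreal_mult less_imp_le)
  also have "\<dots> = (\<integral>\<^sup>+x. (\<integral>\<^sup>+s. ennreal (f x * g (s - x)) * u (x, s) \<partial>lborel) \<partial>lborel)"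
  proof (rule nn_integral_cong)
    fix x
    show "(\<integral>\<^sup>+y. ennreal (f x * g y) * u (x, x + y) \<partial>lborel) = (\<integral>\<^sup>+s. ennreal (f x * g (s - x)) * u (x, s) \<partial>lborel)"
      using nn_integral_shift[of "\<lambda>y. ennreal (f x * g y) * u (x, x + y)" x] by simp
  qed
  finally show ?thesis .
qed

lemma distr_sum_eq_sum_law:
  assumes M: "prob_space M" and U: "has_density M U f" and T: "has_density M T g"
    and indep: "prob_space.indep_var M borel U borel T"
  shows "distr M borel (\<lambda>\<omega>. U \<omega> + T \<omega>) = sum_law"
proof (rule measure_eqI)
  have [measurable]: "U \<in> borel_measurable M" "T \<in> borel_measurable M" using U T by (auto dest: has_density_measurable)
  fix A assume "A \<in> sets (distr M borel (\<lambda>\<omega>. U \<omega> + T \<omega>))"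
  then have [measurable]: "A \<in> sets borel" by simp
  have "emeasure (distr M borel (\<lambda>\<omega>. U \<omega> + T \<omega>)) A = (\<integral>\<^sup>+y. indicator A y \<partial>distr M borel (\<lambda>\<omega>. U \<omega> + T \<omega>))"
    by simp
  also have "\<dots> = (\<integral>\<^sup>+\<omega>. indicator A (U \<omega> + T \<omega>) \<partial>M)"
    by (rule nn_integral_distr) measurable
  also have "\<dots> = (\<integral>\<^sup>+x. (\<integral>\<^sup>+s. ennreal (f x * g (s - x)) * indicator A s \<partial>lborel) \<partial>lborel)"
    using nn_integral_addend_and_sum[OF M U T indep, of "\<lambda>(x, s). indicator A s"] by simp
  also have "\<dots> = (\<integral>\<^sup>+s. (\<integral>\<^sup>+x. ennreal (f x * g (s - x)) * indicator A s \<partial>lborel) \<partial>lborel)"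
    by (rule nn_integral_joint_swap[symmetric]) measurable
  also have "\<dots> = emeasure sum_law A"
    by (simp add: nn_integral_multc nn_integral_sum_density emeasure_sum_law)
  finally show "emeasure (distr M borel (\<lambda>\<omega>. U \<omega> + T \<omega>)) A = emeasure sum_law A" .
qed (simp add: sum_law_def)

lemma emeasure_sum_law_less: "emeasure sum_law {..<s} = ennreal (sum_cdf s)"
  and emeasure_sum_law_greater: "emeasure sum_law {s<..} = ennreal (1 - sum_cdf s)"
proof -
  have "measure sum_law {..s} = measure sum_law {..<s} + measure sum_law {s}"
    by (subst sum.finite_measure_Union[symmetric]) (auto simp: sum_law_def intro!: arg_cong2[where f = measure])
  then show "emeasure sum_law {..<s} = ennreal (sum_cdf s)"
    by (simp add: sum.emeasure_eq_measure sum_cdf_def cdf_def sum_law_singleton)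
  have "measure sum_law (space sum_law - {..s}) = 1 - measure sum_law {..s}"
    by (rule sum.prob_compl) (simp add: sum_law_def)
  moreover have "space sum_law - {..s} = {s<..}" by (auto simp: sum_law_def)
  ultimately show "emeasure sum_law {s<..} = ennreal (1 - sum_cdf s)"
    by (simp add: sum.emeasure_eq_measure sum_cdf_def cdf_def)
qed

text \<open>The given version \<open>gm\<close> agrees with the convolution only almost everywhere;
  continuity of both at \<open>b\<close> upgrades this to equality of the values there.\<close>

lemma density_of_sum_eq:
  assumes M: "prob_space M" and U: "has_density M U f" and T: "has_density M T g"
    and indep: "prob_space.indep_var M borel U borel T"
    and gm: "has_density M (\<lambda>\<omega>. U \<omega> + T \<omega>) gm" and cont: "isCont gm b"
  shows "gm b = sum_density b"
proof (rule isCont_AE_eq_imp_eq[OF _ cont isCont_sum_density])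
  have "density lborel (\<lambda>x. ennreal (gm x)) = distr M lborel (\<lambda>\<omega>. U \<omega> + T \<omega>)"
    using gm by (simp add: has_density_def distributed_distr_eq_density[symmetric])
  also have "\<dots> = distr M borel (\<lambda>\<omega>. U \<omega> + T \<omega>)" by (rule distr_cong) auto
  also have "\<dots> = density lborel (\<lambda>s. ennreal (sum_density s))"
    using distr_sum_eq_sum_law[OF M U T indep] by (simp add: sum_law_def)
  finally have "AE x in lborel. ennreal (gm x) = ennreal (sum_density x)"
    using finite_density_unique[of "\<lambda>x. ennreal (gm x)" lborel "\<lambda>s. ennreal (sum_density s)"]
      has_density_density_measurable[OF gm] has_density_mass[OF M gm] by simp
  then show "AE x in lborel. gm x = sum_density x"
    by eventually_elim (use has_density_nonneg[OF gm] sum_density_nonneg in simp)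
qed

text \<open>The mixture \<open>Fhat\<close> of conditional densities and the given \<open>F\<close>
  both have mass 1, so the lower bound from the rank events already identifies them almost
  everywhere.\<close>

lemma first_addend_density:
  assumes M: "prob_space M" and m: "m \<ge> 2" and X: "\<And>i. i \<in> {1..m} \<Longrightarrow> X i \<in> borel_measurable M"
    and U: "has_density M (X 1) f" and T: "has_density M (\<lambda>\<omega>. \<Sum>i=2..m. X i \<omega>) g"
    and indep: "prob_space.indep_var M borel (X 1) borel (\<lambda>\<omega>. \<Sum>i=2..m. X i \<omega>)"
    and copies: "indep_copies N n Y M m X" and k: "1 \<le> k" "k \<le> n"
    and F: "has_density N (first_addend k n m Y) F"
  shows "AE x in lborel. ennreal (F x) =
    (\<integral>\<^sup>+s. ennreal (f x * g (s - x)) * ennreal (order_stat_kernel n k (sum_cdf s)) \<partial>lborel)"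
proof -
  let ?K = "\<lambda>s. ennreal (order_stat_kernel n k (sum_cdf s))"
  define T where "T = (\<lambda>\<omega>. \<Sum>i=2..m. X i \<omega>)"
  note T = T[folded T_def] and indep = indep[folded T_def]
  interpret N: prob_space N using copies by (simp add: indep_copies_def)
  have S: "(\<Sum>i=1..m. X i \<omega>) = X 1 \<omega> + T \<omega>" for \<omega>
    using m by (simp add: T_def sum.atLeast_Suc_atMost numeral_2_eq_2)
  \<comment> \<open>One measurable map extracts first addend and full sum from a sample vector;
    through it the independence and the common law of the vectors pass to the pairs.\<close>
  define \<Phi> where "\<Phi> = (\<lambda>y :: nat \<Rightarrow> real. (y 1, \<Sum>i=1..m. y i))"
  have \<Phi>[measurable]: "\<Phi> \<in> measurable (\<Pi>\<^sub>M i\<in>{1..m}. borel) borel"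
  proof -
    have "1 \<in> {1..m}" using m by simp
    then have "\<Phi> \<in> measurable (\<Pi>\<^sub>M i\<in>{1..m}. borel) (borel \<Otimes>\<^sub>M borel)"
      unfolding \<Phi>_def by (intro measurable_Pair borel_measurable_sum measurable_component_singleton) auto
    then show ?thesis by (simp add: borel_prod)
  qed
  have \<Phi>_eq: "\<Phi> (\<lambda>i\<in>{1..m}. Z i) = (Z 1, \<Sum>i=1..m. Z i)" for Z
    using m by (auto simp: \<Phi>_def)
  define \<mu> where "\<mu> = distr M borel (\<lambda>\<omega>. (X 1 \<omega>, X 1 \<omega> + T \<omega>))"
  have [measurable]: "X 1 \<in> borel_measurable M" "T \<in> borel_measurable M"
    using U T by (auto dest: has_density_measurable)
  have sum_m: "(\<lambda>\<omega>. X 1 \<omega> + T \<omega>) \<in> borel_measurable M" by measurable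
  have pair[measurable]: "(\<lambda>\<omega>. (X 1 \<omega>, X 1 \<omega> + T \<omega>)) \<in> borel_measurable M"
    unfolding borel_prod[symmetric] by measurable
  have indepV: "N.indep_vars (\<lambda>_. borel) (\<lambda>j \<omega>. (Y j 1 \<omega>, \<Sum>i=1..m. Y j i \<omega>)) {1..n}"
  proof -
    have "N.indep_vars (\<lambda>_. \<Pi>\<^sub>M i\<in>{1..m}. borel) (\<lambda>j \<omega>. \<lambda>i\<in>{1..m}. Y j i \<omega>) {1..n}"
      using copies unfolding indep_copies_def by blast
    then have "N.indep_vars (\<lambda>_. borel) (\<lambda>j \<omega>. \<Phi> (\<lambda>i\<in>{1..m}. Y j i \<omega>)) {1..n}"
      by (rule N.indep_vars_compose2) (rule \<Phi>)
    then show ?thesis by (simp only: \<Phi>_eq)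
  qed
  have vec_m: "(\<lambda>\<omega>. \<lambda>i\<in>{1..m}. Y j i \<omega>) \<in> measurable N (\<Pi>\<^sub>M i\<in>{1..m}. borel)" if "j \<in> {1..n}" for j
    using copies that by (auto simp: indep_copies_def N.indep_vars_def)
  have X_m: "(\<lambda>\<omega>. \<lambda>i\<in>{1..m}. X i \<omega>) \<in> measurable M (\<Pi>\<^sub>M i\<in>{1..m}. borel)"
    using X by (intro measurable_restrict) auto
  have distrV: "distr N borel (\<lambda>\<omega>. (Y j 1 \<omega>, \<Sum>i=1..m. Y j i \<omega>)) = \<mu>" if j: "j \<in> {1..n}" for j
  proof -
    have "distr N borel (\<lambda>\<omega>. (Y j 1 \<omega>, \<Sum>i=1..m. Y j i \<omega>)) = distr (distr N (\<Pi>\<^sub>M i\<in>{1..m}. borel) (\<lambda>\<omega>. \<lambda>i\<in>{1..m}. Y j i \<omega>)) borel \<Phi>"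
      unfolding distr_distr[OF \<Phi> vec_m[OF j]] o_def \<Phi>_eq ..
    also have "\<dots> = distr (distr M (\<Pi>\<^sub>M i\<in>{1..m}. borel) (\<lambda>\<omega>. \<lambda>i\<in>{1..m}. X i \<omega>)) borel \<Phi>"
      using copies j by (simp add: indep_copies_def)
    also have "\<dots> = \<mu>"
      unfolding distr_distr[OF \<Phi> X_m] o_def \<Phi>_eq \<mu>_def S ..
    finally show ?thesis .
  qed
  have emeasure_\<mu>: "emeasure \<mu> {w. snd w \<in> A} = emeasure sum_law A" if [measurable]: "A \<in> sets borel" for A
  proof -
    have "{w :: real \<times> real. snd w \<in> A} \<in> sets (borel \<Otimes>\<^sub>M borel)"
      using measurable_sets[of snd "borel \<Otimes>\<^sub>M borel" borel A] by (simp add: space_pair_measure vimage_def)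
    then have "{w :: real \<times> real. snd w \<in> A} \<in> sets borel" unfolding borel_prod .
    then have "emeasure \<mu> {w. snd w \<in> A} = emeasure M ((\<lambda>\<omega>. X 1 \<omega> + T \<omega>) -` A \<inter> space M)"
      unfolding \<mu>_def by (subst emeasure_distr[OF pair]) (auto intro!: arg_cong2[where f = emeasure])
    also have "\<dots> = emeasure (distr M borel (\<lambda>\<omega>. X 1 \<omega> + T \<omega>)) A"
      by (rule emeasure_distr[OF sum_m that, symmetric])
    finally show ?thesis unfolding distr_sum_eq_sum_law[OF M U T indep] .
  qed
  define Fhat where "Fhat x = (\<integral>\<^sup>+s. ennreal (f x * g (s - x)) * ?K s \<partial>lborel)" for x
  have [measurable]: "Fhat \<in> borel_measurable borel" unfolding Fhat_def[abs_def] by measurable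
  have "AE x in lborel. Fhat x = ennreal (F x)"
  proof (rule AE_eq_if_density_le)
    show "(\<lambda>x. ennreal (F x)) \<in> borel_measurable borel" using has_density_density_measurable[OF F] by simp
    show "(\<integral>\<^sup>+x. ennreal (F x) \<partial>lborel) = 1" using has_density_mass[OF N.prob_space_axioms F] .
    have "(\<integral>\<^sup>+x. Fhat x \<partial>lborel) = (\<integral>\<^sup>+s. (\<integral>\<^sup>+x. ennreal (f x * g (s - x)) * ?K s \<partial>lborel) \<partial>lborel)"
      unfolding Fhat_def by (rule nn_integral_joint_swap[symmetric]) measurable
    also have "\<dots> = (\<integral>\<^sup>+s. ennreal (sum_density s) * ?K s \<partial>lborel)"
      by (simp add: nn_integral_multc nn_integral_sum_density)
    finally show "(\<integral>\<^sup>+x. Fhat x \<partial>lborel) = 1" using order_stat_density_mass[OF k] by simp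
    fix A :: "real set" assume [measurable]: "A \<in> sets borel"
    have um: "(\<lambda>v. indicator A (fst v) * ?K (snd v)) \<in> borel_measurable (borel \<Otimes>\<^sub>M borel)" by measurable
    have "(\<integral>\<^sup>+x. Fhat x * indicator A x \<partial>lborel) =
      (\<integral>\<^sup>+x. (\<integral>\<^sup>+s. ennreal (f x * g (s - x)) * (indicator A x * ?K s) \<partial>lborel) \<partial>lborel)"
      unfolding Fhat_def by (subst nn_integral_multc[symmetric]) (auto simp: mult_ac)
    also have "\<dots> = (\<integral>\<^sup>+\<omega>. indicator A (X 1 \<omega>) * ?K (X 1 \<omega> + T \<omega>) \<partial>M)"
      using nn_integral_addend_and_sum[OF M U T indep um] by simp
    also have "\<dots> = (\<integral>\<^sup>+v. indicator A (fst v) * ?K (snd v) \<partial>\<mu>)"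
      unfolding \<mu>_def using um by (subst nn_integral_distr[OF pair]) (auto simp: borel_prod)
    also have "\<dots> \<le> emeasure N {\<omega>\<in>space N. first_addend k n m Y \<omega> \<in> A}"
    proof (rule emeasure_first_addend_ge[OF N.prob_space_axioms indepV distrV _ _ _ k])
      show "emeasure \<mu> {w. snd w < s} = ennreal (sum_cdf s)" for s
        using emeasure_\<mu>[of "{..<s}"] by (simp add: emeasure_sum_law_less)
      show "emeasure \<mu> {w. s < snd w} = ennreal (1 - sum_cdf s)" for s
        using emeasure_\<mu>[of "{s<..}"] by (simp add: emeasure_sum_law_greater)
    qed (auto simp: sum_cdf_nonneg sum_cdf_le_1 has_density_measurable[OF F])
    also have "\<dots> = (\<integral>\<^sup>+x. ennreal (F x) * indicator A x \<partial>lborel)"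
      by (rule has_density_emeasure[OF F]) measurable
    finally show "(\<integral>\<^sup>+x. Fhat x * indicator A x \<partial>lborel) \<le> (\<integral>\<^sup>+x. ennreal (F x) * indicator A x \<partial>lborel)" .
  qed measurable
  then show ?thesis unfolding Fhat_def by (auto elim: eventually_mono)
qed

end

text \<open>The limit is read in two ways, since \<open>F n\<close> is an arbitrary version of its
  density: in L1 for every admissible \<open>k\<close>, and pointwise almost everywhere under
  continuity of \<open>gm1\<close> at the point or under a rate for \<open>k\<close>. Continuity of
  \<open>gm\<close> at \<beta> fixes the value in the denominator.\<close>

theorem proposition3:
  fixes M :: "'a measure" and X :: "nat \<Rightarrow> 'a \<Rightarrow> real" and f :: "nat \<Rightarrow> real \<Rightarrow> real"
    and m :: nat and gm gm1 :: "real \<Rightarrow> real" and \<eta> \<beta> :: real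
    and N :: "nat \<Rightarrow> 'b measure" and Y :: "nat \<Rightarrow> nat \<Rightarrow> nat \<Rightarrow> 'b \<Rightarrow> real"
    and k :: "nat \<Rightarrow> nat" and F :: "nat \<Rightarrow> real \<Rightarrow> real"
  assumes "prob_space M" and "m \<ge> 2"
    and "prob_space.indep_vars M (\<lambda>_. borel) X {1..m}"
    and "\<And>i. i \<in> {1..m} \<Longrightarrow> has_density M (X i) (f i)"
    and "has_density M (\<lambda>\<omega>. \<Sum>j=1..m. X j \<omega>) gm"
    and "has_density M (\<lambda>\<omega>. \<Sum>j=2..m. X j \<omega>) gm1"
    and "bounded (range (f 1))" and "\<And>x. f 1 x > 0"
    and "0 < \<eta>" and "\<eta> < 1"
    and "\<beta> = inv (cdf (distr M borel (\<lambda>\<omega>. \<Sum>j=1..m. X j \<omega>))) \<eta>"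
    and "isCont gm \<beta>"
    and "\<And>n. n \<ge> 1 \<Longrightarrow> 1 \<le> k n \<and> k n \<le> n"
    and "(\<lambda>n. real (k n) / real n) \<longlonglongrightarrow> \<eta>"
    and "\<And>n. n \<ge> 1 \<Longrightarrow> indep_copies (N n) n (Y n) M m X"
    and "\<And>n. n \<ge> 1 \<Longrightarrow> has_density (N n) (first_addend (k n) n m (Y n)) (F n)"
  shows "(\<lambda>n. \<integral>\<^sup>+x. ennreal \<bar>F n x - gm1 (\<beta> - x) / gm \<beta> * f 1 x\<bar> \<partial>lborel) \<longlonglongrightarrow> 0
    \<and> (AE x in lborel.
         isCont gm1 (\<beta> - x) \<or> (\<lambda>n. real (k n) - \<eta> * real n) \<in> O(\<lambda>n. sqrt (real n)) \<longrightarrow>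
           (\<lambda>n. F n x) \<longlonglongrightarrow> gm1 (\<beta> - x) / gm \<beta> * f 1 x)"
proof -
  interpret M: prob_space M by fact
  have one: "1 \<in> {1..m}" using \<open>m \<ge> 2\<close> by simp
  note U = assms(4)[OF one] and T = assms(6)
  obtain B where B: "\<And>x. \<bar>f 1 x\<bar> \<le> B"
    using \<open>bounded (range (f 1))\<close> by (auto simp: bounded_iff)
  interpret addend_densities "f 1" gm1 B
  proof
    show "f 1 \<in> borel_measurable borel" "gm1 \<in> borel_measurable borel"
      using U T by (auto dest: has_density_density_measurable)
    show "0 < f 1 x" "f 1 x \<le> B" "0 \<le> gm1 x" for x
      using assms(8) B[of x] has_density_nonneg[OF T] by auto
    show "(\<integral>\<^sup>+x. ennreal (f 1 x) \<partial>lborel) = 1" "(\<integral>\<^sup>+x. ennreal (gm1 x) \<partial>lborel) = 1"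
      using has_density_mass[OF \<open>prob_space M\<close>] U T by auto
  qed
  have split: "{1..m} = insert 1 {2..m}" using \<open>m \<ge> 2\<close> by auto
  have S: "(\<Sum>j=1..m. X j \<omega>) = X 1 \<omega> + (\<Sum>j=2..m. X j \<omega>)" for \<omega>
    unfolding split by simp
  have indep: "M.indep_var borel (X 1) borel (\<lambda>\<omega>. \<Sum>j=2..m. X j \<omega>)"
    using assms(3) unfolding split by (intro M.indep_vars_sum) auto
  have D: "distr M borel (\<lambda>\<omega>. \<Sum>j=1..m. X j \<omega>) = sum_law"
    unfolding S by (rule distr_sum_eq_sum_law[OF \<open>prob_space M\<close> U T indep])
  have "\<beta> = inv sum_cdf \<eta>"
    unfolding sum_cdf_def D[symmetric] by (rule assms(11))
  \<comment> \<open>Off the range \<open>inv\<close> would return an unspecified value; the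
    intermediate value theorem puts \<eta> in the range, so \<beta> is a genuine preimage.\<close>
  moreover have "\<eta> \<in> range sum_cdf" using sum_cdf_surj[OF assms(9,10)] by auto
  ultimately have \<beta>: "sum_cdf \<beta> = \<eta>" by (simp add: f_inv_into_f)
  interpret order_stat_limit "f 1" gm1 B \<eta> \<beta> k
    by standard (use assms(9,10,13,14) \<beta> in auto)
  have gm: "gm \<beta> = sum_density \<beta>"
    using assms(5) unfolding S by (rule density_of_sum_eq[OF \<open>prob_space M\<close> U T indep _ assms(12)])
  have X: "X i \<in> borel_measurable M" if "i \<in> {1..m}" for i
    using assms(4)[OF that] by (rule has_density_measurable)
  have F: "AE x in lborel. ennreal (F n x) = (\<integral>\<^sup>+s. ennreal (f 1 x * gm1 (s - x)) * ennreal (K n s) \<partial>lborel)"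
    if "n \<ge> 1" for n
    unfolding K_def using assms(13)[OF that]
    by (intro first_addend_density[OF \<open>prob_space M\<close> \<open>m \<ge> 2\<close> X U T indep assms(15)[OF that] _ _ assms(16)[OF that]]) auto
  have F_nonneg: "0 \<le> F n x" if "n \<ge> 1" for n x
    using has_density_nonneg[OF assms(16)[OF that]] .
  show ?thesis
    using L1_limit[OF F_nonneg F] AE_limit[OF F_nonneg F] unfolding limit_density_def gm by blast
qed

end
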